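(* Let $M$ be a compact boundaryless Riemannian surface, let $f\in\mathrm{Diff}^1(M)$ and let $\Lambda\subset M$ be a compact $f$-invariant set. Then: (1) If $c\in\mathrm{Crit}(f,\Lambda)$ is periodic of period $n$, then, up to multiplication by a scalar, $D_cf^n$ is a homothety, elliptic or parabolic; in particular all its eigenvalues have the same modulus. In particular, if $f$ is dissipative on $\Lambda$ (that is, $|\det D_xf|<1$ for $x\in\Lambda$), then $c$ is an attracting periodic point. (2) If $f_{|\Lambda}$ is far from homotheties, then there is no critical point $c\in\mathrm{Crit}(f,\Lambda)$ with critical direction $v$ such that for every $n\in\mathbb Z$ the point $f^n(c)$ is a critical point with critical direction $G^n(v)$. (3) The set $\mathrm{Crit}(f,\Lambda)$ is closed, and it depends semi-continuously on $f$: for any neighborhood $U$ of $\mathrm{Crit}(f,\Lambda)$ there exist a neighborhood $V$ of $\Lambda$ and a $C^1$-neighborhood $\mathcal V$ of $f$ such that if $h\in\mathcal V$ and $\Lambda'\subset V$ is a compact $h$-invariant set, then $\mathrm{Crit}(h,\Lambda')\subset U$.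
   Context: Projective cocycle: for a $C^1$ diffeomorphism $f$, $x\in M$ and a unit vector $v\in T^1_xM$, put $G(v)=D_xf(v)/\|D_xf(v)\|\in T^1_{f(x)}M$. For $n\in\mathbb Z$, $G^n$ is the $n$-th iterate and $g^n(v)>0$ is the absolute value of the derivative at $v$ of $G^n:T^1_xM\to T^1_{f^n(x)}M$; equivalently $g^n(v)=|\det D_xf^n|/\|D_xf^n(v)\|^2$. Critical points: $x\in\Lambda$ is critical if there is $v\in T^1_xM$ with $g^n(v)\ge1$ for all $n\in\mathbb Z$; such a $v$ is a critical direction; $\mathrm{Crit}(f,\Lambda)$ is the set of critical points in $\Lambda$. Far from homotheties: $f_{|\Lambda}$ is far from homotheties if there is $\delta>0$ such that there are no $x\in\Lambda$, $v\in T^1_xM$ with $(1-\delta)^n<g^n(v)<(1+\delta)^n$ for all $n\ge1$. Linear maps of the plane, up to scalar: homothety = multiple of the identity; elliptic = conjugate to a multiple of a linear isometry; parabolic = non-diagonalizable with a single real eigenvalue (the remaining, excluded, case is hyperbolic: two real eigenvalues of distinct moduli).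
   Formalization: In "far from homotheties", δ is required to satisfy 0 < δ < 1 instead of only δ > 0; with δ ≥ 2 allowed, the identity would count as far from homotheties (g^2 = 1 is not > (1-δ)^2) and (2) would fail. For δ < 2 the two conditions agree. *)

theory Defs
  imports "HOL-Analysis.Analysis" "HOL-Library.Function_Algebras"
begin

section \<open>Functions into a vector space as a vector space\<close>

instantiation "fun" :: (type, real_vector) real_vector
begin

definition scaleR_fun :: "real \<Rightarrow> ('a \<Rightarrow> 'b) \<Rightarrow> 'a \<Rightarrow> 'b"
  where "scaleR_fun a f = (\<lambda>x. a *\<^sub>R f x)"

instance
  by standard (simp_all add: scaleR_fun_def fun_eq_iff scaleR_add_right scaleR_add_left)

end

section \<open>Differentiability on open sets\<close>

text \<open>Meant for open sets in finite-dimensional spaces, where continuity of all directional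
  derivatives of a differentiable map is continuity of its derivative.\<close>

fun Ck_on :: "nat \<Rightarrow> 'a::real_normed_vector set \<Rightarrow> ('a \<Rightarrow> 'b::real_normed_vector) \<Rightarrow> bool" where
  "Ck_on 0 X f \<longleftrightarrow> continuous_on X f"
| "Ck_on (Suc k) X f \<longleftrightarrow>
     (\<forall>x\<in>X. f differentiable (at x)) \<and>
     (\<forall>v. Ck_on k X (\<lambda>x. frechet_derivative f (at x) v))"

definition smooth_on :: "'a::real_normed_vector set \<Rightarrow> ('a \<Rightarrow> 'b::real_normed_vector) \<Rightarrow> bool"
  where "smooth_on X f \<longleftrightarrow> (\<forall>k. Ck_on k X f)"

section \<open>Smooth surfaces\<close>

record 'm chart =
  cdom :: "'m set"
  cmap :: "'m \<Rightarrow> real^2"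

definition cinv :: "'m chart \<Rightarrow> real^2 \<Rightarrow> 'm"
  where "cinv c = inv_into (cdom c) (cmap c)"

definition is_chart :: "'m::topological_space chart \<Rightarrow> bool" where
  "is_chart c \<longleftrightarrow> open (cdom c) \<and> open (cmap c ` cdom c) \<and>
     homeomorphism (cdom c) (cmap c ` cdom c) (cmap c) (cinv c)"

definition smooth_atlas :: "'m::topological_space chart set \<Rightarrow> bool" where
  "smooth_atlas A \<longleftrightarrow>
     (\<forall>c\<in>A. is_chart c) \<and> (\<Union>c\<in>A. cdom c) = UNIV \<and>
     (\<forall>c\<in>A. \<forall>d\<in>A. smooth_on (cmap c ` (cdom c \<inter> cdom d)) (cmap d \<circ> cinv c))"

text \<open>A tangent vector at \<open>x\<close> is the family of its coordinate expressions in all charts around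
  \<open>x\<close>, related to each other by the derivatives of the transition maps. The entries at all other
  charts are zero, so that each tangent space is a linear subspace of the type of families.\<close>

type_synonym 'm tvec = "'m chart \<Rightarrow> real^2"

record 'm surface =
  charts :: "'m chart set"
  metric :: "'m \<Rightarrow> 'm tvec \<Rightarrow> 'm tvec \<Rightarrow> real"

definition charts_at :: "'m surface \<Rightarrow> 'm \<Rightarrow> 'm chart set"
  where "charts_at S x = {c \<in> charts S. x \<in> cdom c}"

definition tangent_space :: "'m surface \<Rightarrow> 'm \<Rightarrow> 'm tvec set" where
  "tangent_space S x = {v.
     (\<forall>c. c \<notin> charts_at S x \<longrightarrow> v c = 0) \<and>
     (\<forall>c\<in>charts_at S x. \<forall>d\<in>charts_at S x.
        v d = frechet_derivative (cmap d \<circ> cinv c) (at (cmap c x)) (v c))}"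

text \<open>The tangent vector at \<open>x\<close> whose coordinate expression in the chart \<open>c\<close> is \<open>a\<close>.\<close>

definition coord_vector :: "'m surface \<Rightarrow> 'm chart \<Rightarrow> 'm \<Rightarrow> real^2 \<Rightarrow> 'm tvec" where
  "coord_vector S c x a = (\<lambda>d. if d \<in> charts_at S x
     then frechet_derivative (cmap d \<circ> cinv c) (at (cmap c x)) a else 0)"

definition inner_product_on :: "'v::real_vector set \<Rightarrow> ('v \<Rightarrow> 'v \<Rightarrow> real) \<Rightarrow> bool" where
  "inner_product_on V ip \<longleftrightarrow>
     (\<forall>u\<in>V. \<forall>v\<in>V. ip u v = ip v u) \<and>
     (\<forall>u\<in>V. \<forall>v\<in>V. \<forall>w\<in>V. \<forall>a b. ip (a *\<^sub>R u + b *\<^sub>R v) w = a * ip u w + b * ip v w) \<and>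
     (\<forall>u\<in>V. u \<noteq> 0 \<longrightarrow> 0 < ip u u)"

definition riemannian_metric :: "'m surface \<Rightarrow> bool" where
  "riemannian_metric S \<longleftrightarrow>
     (\<forall>x. inner_product_on (tangent_space S x) (metric S x)) \<and>
     (\<forall>c\<in>charts S. \<forall>a b. smooth_on (cmap c ` cdom c)
        (\<lambda>p. metric S (cinv c p) (coord_vector S c (cinv c p) a) (coord_vector S c (cinv c p) b)))"

text \<open>Charts map onto open subsets of the plane, so there is no boundary; second countability
  follows from compactness. Connectedness is not required.\<close>

definition compact_riemannian_surface :: "'m::t2_space surface \<Rightarrow> bool" where
  "compact_riemannian_surface S \<longleftrightarrow>
     compact (UNIV :: 'm set) \<and> smooth_atlas (charts S) \<and> riemannian_metric S"

definition tnorm :: "'m surface \<Rightarrow> 'm \<Rightarrow> 'm tvec \<Rightarrow> real"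
  where "tnorm S x v = sqrt (metric S x v v)"

definition unit_tangent_space :: "'m surface \<Rightarrow> 'm \<Rightarrow> 'm tvec set"
  where "unit_tangent_space S x = {v \<in> tangent_space S x. tnorm S x v = 1}"

definition unit_tangent_bundle :: "'m surface \<Rightarrow> ('m \<times> 'm tvec) set"
  where "unit_tangent_bundle S = Sigma UNIV (unit_tangent_space S)"

section \<open>Diffeomorphisms of class C1\<close>

definition C1_map :: "'m::topological_space surface \<Rightarrow> ('m \<Rightarrow> 'm) \<Rightarrow> bool" where
  "C1_map S f \<longleftrightarrow> continuous_on UNIV f \<and>
     (\<forall>c\<in>charts S. \<forall>d\<in>charts S.
        Ck_on 1 (cmap c ` (cdom c \<inter> f -` cdom d)) (cmap d \<circ> f \<circ> cinv c))"

definition Diff1 :: "'m::topological_space surface \<Rightarrow> ('m \<Rightarrow> 'm) set"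
  where "Diff1 S = {f. bij f \<and> C1_map S f \<and> C1_map S (inv f)}"

definition tangent_map :: "'m surface \<Rightarrow> ('m \<Rightarrow> 'm) \<Rightarrow> 'm \<Rightarrow> 'm tvec \<Rightarrow> 'm tvec" where
  "tangent_map S f x v = (let c = (SOME c. c \<in> charts_at S x) in
     (\<lambda>d. if d \<in> charts_at S (f x)
        then frechet_derivative (cmap d \<circ> f \<circ> cinv c) (at (cmap c x)) (v c) else 0))"

text \<open>The C1 topology is generated by the sets of diffeomorphisms whose coordinate expressions
  are, on a compact subset of a chart domain, uniformly close to those of a given one, together
  with their first derivatives. (On a compact set the pointwise strict bounds are uniform.)\<close>

definition C1_close_set ::
  "'m::topological_space surface \<Rightarrow> ('m \<Rightarrow> 'm) \<Rightarrow> 'm chart \<Rightarrow> 'm chart \<Rightarrow> 'm set \<Rightarrow> real \<Rightarrow> ('m \<Rightarrow> 'm) set"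
  where "C1_close_set S f c d K e = {h \<in> Diff1 S. h ` K \<subseteq> cdom d \<and>
     (\<forall>p \<in> cmap c ` K.
        norm ((cmap d \<circ> h \<circ> cinv c) p - (cmap d \<circ> f \<circ> cinv c) p) < e \<and>
        onorm (\<lambda>a. frechet_derivative (cmap d \<circ> h \<circ> cinv c) (at p) a
                 - frechet_derivative (cmap d \<circ> f \<circ> cinv c) (at p) a) < e)}"

definition C1_topology :: "'m::topological_space surface \<Rightarrow> ('m \<Rightarrow> 'm) topology" where
  "C1_topology S = topology_generated_by
     {C1_close_set S f c d K e | f c d K e.
        f \<in> Diff1 S \<and> c \<in> charts S \<and> d \<in> charts S \<and> compact K \<and> K \<subseteq> cdom c \<and>
        f ` K \<subseteq> cdom d \<and> 0 < e}"

section \<open>The projective cocycle\<close>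

definition int_iterate :: "'a set \<Rightarrow> ('a \<Rightarrow> 'a) \<Rightarrow> int \<Rightarrow> 'a \<Rightarrow> 'a" where
  "int_iterate X F n = (if 0 \<le> n then F ^^ nat n else (inv_into X F) ^^ nat (- n))"

text \<open>Unit tangent vectors are carried together with their base point.\<close>

definition proj_map :: "'m surface \<Rightarrow> ('m \<Rightarrow> 'm) \<Rightarrow> 'm \<times> 'm tvec \<Rightarrow> 'm \<times> 'm tvec" where
  "proj_map S f = (\<lambda>(x, v). (f x, (1 / tnorm S (f x) (tangent_map S f x v)) *\<^sub>R tangent_map S f x v))"

definition proj_iterate :: "'m surface \<Rightarrow> ('m \<Rightarrow> 'm) \<Rightarrow> int \<Rightarrow> 'm \<times> 'm tvec \<Rightarrow> 'm \<times> 'm tvec"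
  where "proj_iterate S f n = int_iterate (unit_tangent_bundle S) (proj_map S f) n"

text \<open>The absolute value of the derivative of the \<open>n\<close>-th iterate between unit circles: the circle
  in the tangent space at \<open>x\<close> is parametrised by arc length from \<open>v\<close>, and the norm of the velocity of
  the image curve is taken. The choice between the two unit vectors orthogonal to \<open>v\<close> is
  irrelevant.\<close>

definition proj_deriv :: "'m surface \<Rightarrow> ('m \<Rightarrow> 'm) \<Rightarrow> int \<Rightarrow> 'm \<Rightarrow> 'm tvec \<Rightarrow> real" where
  "proj_deriv S f n x v =
     (let w = (SOME w. w \<in> unit_tangent_space S x \<and> metric S x v w = 0);
          \<gamma> = (\<lambda>t. snd (proj_iterate S f n (x, cos t *\<^sub>R v + sin t *\<^sub>R w)))
      in tnorm S (int_iterate UNIV f n x) (\<lambda>c. vector_derivative (\<lambda>t. \<gamma> t c) (at 0)))"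

section \<open>Critical points\<close>

definition critical_direction :: "'m surface \<Rightarrow> ('m \<Rightarrow> 'm) \<Rightarrow> 'm \<Rightarrow> 'm tvec \<Rightarrow> bool" where
  "critical_direction S f x v \<longleftrightarrow>
     v \<in> unit_tangent_space S x \<and> (\<forall>n::int. 1 \<le> proj_deriv S f n x v)"

definition Crit :: "'m surface \<Rightarrow> ('m \<Rightarrow> 'm) \<Rightarrow> 'm set \<Rightarrow> 'm set"
  where "Crit S f \<Lambda> = {x \<in> \<Lambda>. \<exists>v. critical_direction S f x v}"

text \<open>The bound \<open>\<delta> < 1\<close> makes \<open>(1 - \<delta>) ^ n\<close> a decaying lower bound; for \<open>\<delta> > 2\<close> it would be
  unbounded along even \<open>n\<close>, and the condition would lose its meaning.\<close>

definition far_from_homotheties :: "'m surface \<Rightarrow> ('m \<Rightarrow> 'm) \<Rightarrow> 'm set \<Rightarrow> bool" where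
  "far_from_homotheties S f \<Lambda> \<longleftrightarrow> (\<exists>\<delta>. 0 < \<delta> \<and> \<delta> < 1 \<and>
     \<not> (\<exists>x\<in>\<Lambda>. \<exists>v\<in>unit_tangent_space S x. \<forall>n::nat. 1 \<le> n \<longrightarrow>
          (1 - \<delta>) ^ n < proj_deriv S f (int n) x v \<and> proj_deriv S f (int n) x v < (1 + \<delta>) ^ n))"

section \<open>Linear endomorphisms of a plane\<close>

text \<open>These notions concern the restriction of \<open>L\<close> to an \<open>L\<close>-invariant two-dimensional subspace
  \<open>V\<close>.\<close>

definition homothety_on :: "'v::real_vector set \<Rightarrow> ('v \<Rightarrow> 'v) \<Rightarrow> bool"
  where "homothety_on V L \<longleftrightarrow> (\<exists>a::real. \<forall>v\<in>V. L v = a *\<^sub>R v)"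

definition elliptic_on :: "'v::real_vector set \<Rightarrow> ('v \<Rightarrow> 'v) \<Rightarrow> bool" where
  "elliptic_on V L \<longleftrightarrow>
     (\<exists>(P :: 'v \<Rightarrow> real^2) (R :: real^2 \<Rightarrow> real^2) (a::real).
        linear P \<and> bij_betw P V UNIV \<and> orthogonal_transformation R \<and>
        (\<forall>v\<in>V. P (L v) = a *\<^sub>R R (P v)))"

definition diagonalizable_on :: "'v::real_vector set \<Rightarrow> ('v \<Rightarrow> 'v) \<Rightarrow> bool" where
  "diagonalizable_on V L \<longleftrightarrow>
     (\<exists>B\<subseteq>V. independent B \<and> span B = V \<and> (\<forall>b\<in>B. \<exists>a::real. L b = a *\<^sub>R b))"

definition real_eigenvalue_on :: "'v::real_vector set \<Rightarrow> ('v \<Rightarrow> 'v) \<Rightarrow> real \<Rightarrow> bool"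
  where "real_eigenvalue_on V L a \<longleftrightarrow> (\<exists>v\<in>V. v \<noteq> 0 \<and> L v = a *\<^sub>R v)"

definition parabolic_on :: "'v::real_vector set \<Rightarrow> ('v \<Rightarrow> 'v) \<Rightarrow> bool"
  where "parabolic_on V L \<longleftrightarrow> \<not> diagonalizable_on V L \<and> (\<exists>!a. real_eigenvalue_on V L a)"

text \<open>Real and imaginary parts of \<open>L (u + \<i> w) = z (u + \<i> w)\<close> in the complexification of \<open>V\<close>.\<close>

definition eigenvalue_on :: "'v::real_vector set \<Rightarrow> ('v \<Rightarrow> 'v) \<Rightarrow> complex \<Rightarrow> bool" where
  "eigenvalue_on V L z \<longleftrightarrow> (\<exists>u\<in>V. \<exists>w\<in>V. (u \<noteq> 0 \<or> w \<noteq> 0) \<and>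
     L u = Re z *\<^sub>R u - Im z *\<^sub>R w \<and> L w = Im z *\<^sub>R u + Re z *\<^sub>R w)"

section \<open>Dissipation and attracting periodic points\<close>

definition orthonormal_frame :: "'m surface \<Rightarrow> 'm \<Rightarrow> (2 \<Rightarrow> 'm tvec) \<Rightarrow> bool" where
  "orthonormal_frame S x e \<longleftrightarrow> (\<forall>i. e i \<in> tangent_space S x) \<and>
     (\<forall>i j. metric S x (e i) (e j) = (if i = j then 1 else 0))"

definition abs_det :: "'m surface \<Rightarrow> ('m \<Rightarrow> 'm) \<Rightarrow> 'm \<Rightarrow> real" where
  "abs_det S f x = (THE \<delta>. \<forall>e e'. orthonormal_frame S x e \<longrightarrow> orthonormal_frame S (f x) e' \<longrightarrow>
     \<delta> = \<bar>det ((\<chi> i j. metric S (f x) (e' i) (tangent_map S f x (e j))) :: real^2^2)\<bar>)"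

definition dissipative_on :: "'m surface \<Rightarrow> ('m \<Rightarrow> 'm) \<Rightarrow> 'm set \<Rightarrow> bool"
  where "dissipative_on S f \<Lambda> \<longleftrightarrow> (\<forall>x\<in>\<Lambda>. abs_det S f x < 1)"

text \<open>A sink: all eigenvalues of the return map lie inside the unit disc, and the point is
  asymptotically stable for the return map.\<close>

definition attracting_periodic_point ::
  "'m::topological_space surface \<Rightarrow> ('m \<Rightarrow> 'm) \<Rightarrow> nat \<Rightarrow> 'm \<Rightarrow> bool" where
  "attracting_periodic_point S f n x \<longleftrightarrow>
     0 < n \<and> (f ^^ n) x = x \<and>
     (\<forall>z. eigenvalue_on (tangent_space S x) (tangent_map S (f ^^ n) x) z \<longrightarrow> cmod z < 1) \<and>
     (\<forall>W. open W \<and> x \<in> W \<longrightarrow> (\<exists>U. open U \<and> x \<in> U \<and>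
        (\<forall>y\<in>U. (\<forall>k. (f ^^ (n * k)) y \<in> W) \<and> (\<lambda>k. (f ^^ (n * k)) y) \<longlonglongrightarrow> x)))"

end

(*
  Write L for the derivative of f^n at x and kappa(x; u, w) for the square root of the Gram
  determinant of u, w divided by |u|^2. The derivative of the projective action at a unit vector v
  is kappa(f^n x; L v, L w) / kappa(x; v, w) for any w independent of v: the cocycle is a coboundary
  in the pair (v, w).

  (1) At a periodic point the criticality inequalities say |A^k a|^2 <= C |det A|^k for all integers
  k, where A is the derivative of the return map. Eigenvalues of distinct moduli would force a into
  the eigenline of the smaller one, where the negative powers of A grow too fast. If the moduli
  agree, A - (tr A)/2 squares to a scalar, and for the norm on the graph of a suitable multiple of
  this map A is conformal or, if that scalar is 0 and |det A| < 1, contracting.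
  (2) The derivative of G^(-n) at G^n v is the inverse of the derivative of G^n at v, so if both are
  at least 1 then both are equal to 1, for every n.
  (3) If x has no critical direction, then for every direction at x one of the inequalities fails
  strictly. By continuity of kappa in (h, y, direction) it still fails near (f, x, direction), and
  compactness of the circle makes the neighbourhood uniform in the direction.
*)

theory Submission
  imports Defs
begin

section \<open>Linear maps of the plane\<close>

text \<open>The obstacle in (3) is that critical points are defined with negative iterates too,
  while the C1 topology bounds only the maps themselves, in charts. Convergence of inverses has to
  be derived: preimages converge because the surface is compact, and their tangent vectors converge
  because they solve linear systems whose matrices tend to an invertible one. Continuity is stated
  along an arbitrary filter, with the map, the base point and the tangent vector all moving; only in
  this form can the one-step statement be iterated. Unit vectors are inconvenient, since
  normalisation depends on the metric at a moving point. But kappa does not change when both its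
  vectors are multiplied by the same nonzero number, so critical directions can be tested on vectors
  of Euclidean length one in a chart, a circle that is the same for all base points. In (1),
  equality of the moduli of the two eigenvalues is expressed without eigenvectors, by the real
  condition t^2 <= 4 d or t = 0 on the trace t and the determinant d.\<close>

abbreviation det2 :: "(real^2 \<Rightarrow> real^2) \<Rightarrow> real"
  where "det2 A \<equiv> det (matrix A)"

abbreviation trace2 :: "(real^2 \<Rightarrow> real^2) \<Rightarrow> real"
  where "trace2 A \<equiv> trace (matrix A)"

definition cross :: "real^2 \<Rightarrow> real^2 \<Rightarrow> real"
  where "cross a b = a$1 * b$2 - a$2 * b$1"

lemma linear_plane_nth:
  fixes A :: "real^2 \<Rightarrow> real^2"
  assumes "linear A"
  shows "A x $ i = matrix A $ i $ 1 * x $ 1 + matrix A $ i $ 2 * x $ 2"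
proof -
  have "A x = matrix A *v x"
    using matrix_vector_mul(2)[OF assms] by (metis)
  then show ?thesis
    by (simp add: matrix_vector_mult_def sum_2)
qed

lemma linear_plane_expand:
  fixes A :: "real^2 \<Rightarrow> 'b::real_vector"
  assumes "linear A"
  shows "A x = x $ 1 *\<^sub>R A (axis 1 1) + x $ 2 *\<^sub>R A (axis 2 1)"
proof -
  have "x = x $ 1 *\<^sub>R axis 1 1 + x $ 2 *\<^sub>R axis 2 1"
    by (simp add: vec_eq_iff forall_2 axis_def)
  then have "A x = A (x $ 1 *\<^sub>R axis 1 1 + x $ 2 *\<^sub>R axis 2 1)"
    by (rule arg_cong)
  then show ?thesis
    by (simp only: linear_add[OF assms] linear_cmul[OF assms])
qed

lemma cross_linear:
  assumes "linear A"
  shows "cross (A a) (A b) = det2 A * cross a b"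
  unfolding cross_def det_2 linear_plane_nth[OF assms, of a] linear_plane_nth[OF assms, of b]
  by (simp add: algebra_simps)

lemma cayley_hamilton_plane:
  fixes A :: "real^2 \<Rightarrow> real^2"
  assumes "linear A"
  shows "A (A x) = trace2 A *\<^sub>R A x - det2 A *\<^sub>R x"
proof -
  let ?M = "matrix A"
  have A: "A y $ i = ?M$i$1 * y$1 + ?M$i$2 * y$2" for y i
    by (rule linear_plane_nth[OF assms])
  have "A (A x) $ i = (trace2 A *\<^sub>R A x - det2 A *\<^sub>R x) $ i" for i
    using exhaust_2[of i] by (auto simp: A det_2 trace_def sum_2 algebra_simps)
  then show ?thesis
    by (simp add: vec_eq_iff)
qed

section \<open>Symmetric bilinear forms on the plane and their Gram determinants\<close>

lemma bilinear_plane_expand: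
  fixes B :: "real^2 \<Rightarrow> real^2 \<Rightarrow> real"
  assumes l: "\<And>b. linear (\<lambda>a. B a b)" and s: "\<And>a b. B a b = B b a"
  shows "B a b = a$1 * (b$1 * B (axis 1 1) (axis 1 1) + b$2 * B (axis 1 1) (axis 2 1))
      + a$2 * (b$1 * B (axis 1 1) (axis 2 1) + b$2 * B (axis 2 1) (axis 2 1))"
proof -
  have e: "B a b = a$1 * B (axis 1 1) b + a$2 * B (axis 2 1) b" for a b
    using linear_plane_expand[OF l[of b], of a] by simp
  show ?thesis
    by (subst e, subst (1 2) s, subst (1 2) e) (simp add: s[of "axis 2 1" "axis 1 1"])
qed

text \<open>In dimension two the Gram determinant is the square of an area, and areas are unique up
  to a constant; the constant is read off at the standard basis. This is why linear maps scale all
  Gram determinants by one common factor.\<close>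

lemma gram_bilinear:
  fixes B :: "real^2 \<Rightarrow> real^2 \<Rightarrow> real"
  assumes l: "\<And>b. linear (\<lambda>a. B a b)" and s: "\<And>a b. B a b = B b a"
  shows "B a a * B b b - (B a b)\<^sup>2 =
    (B (axis 1 1) (axis 1 1) * B (axis 2 1) (axis 2 1) - (B (axis 1 1) (axis 2 1))\<^sup>2) * (cross a b)\<^sup>2"
  unfolding bilinear_plane_expand[OF l s, of a a] bilinear_plane_expand[OF l s, of b b]
    bilinear_plane_expand[OF l s, of a b] cross_def
  by algebra

lemma gram_bilinear_pos:
  fixes B :: "real^2 \<Rightarrow> real^2 \<Rightarrow> real"
  assumes l: "\<And>b. linear (\<lambda>a. B a b)" and s: "\<And>a b. B a b = B b a"
    and pos: "\<And>a. a \<noteq> 0 \<Longrightarrow> 0 < B a a"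
  shows "0 < B (axis 1 1) (axis 1 1) * B (axis 2 1) (axis 2 1) - (B (axis 1 1) (axis 2 1))\<^sup>2"
proof -
  define p q r where "p = B (axis 1 1) (axis 1 1)" and "q = B (axis 1 1) (axis 2 1)"
    and "r = B (axis 2 1) (axis 2 1)"
  have p: "p > 0"
    unfolding p_def by (rule pos) (simp add: axis_eq_0_iff)
  \<comment> \<open>The vector (-q, p) is orthogonal to the first basis vector with respect to
    \<open>B\<close>, so its square is \<open>p\<close> times the Gram determinant.\<close>
  have "0 < B (vector [- q, p]) (vector [- q, p])"
    using p by (intro pos) (auto simp: vec_eq_iff forall_2)
  also have "\<dots> = p * (p * r - q\<^sup>2)"
    unfolding bilinear_plane_expand[OF l s, of "vector [- q, p]"] p_def[symmetric] q_def[symmetric] r_def[symmetric]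
    by (simp add: power2_eq_square algebra_simps)
  finally show ?thesis
    using p unfolding p_def[symmetric] q_def[symmetric] r_def[symmetric] by (simp add: zero_less_mult_iff)
qed

lemma lagrange_identity_plane:
  fixes a b :: "real^2"
  shows "(a \<bullet> a) * (b \<bullet> b) - (a \<bullet> b)\<^sup>2 = (cross a b)\<^sup>2"
  by (simp add: inner_vec_def sum_2 cross_def power2_eq_square algebra_simps)

text \<open>If the eigenvalues had distinct moduli, the growth conditions would put \<open>a\<close> into the
  eigenline of the smaller one, on which \<open>B\<close> expands too much.\<close>

lemma growth_imp_equal_moduli:
  fixes A B :: "real^2 \<Rightarrow> real^2" and q :: "real^2 \<Rightarrow> real"
  assumes A: "linear A" and B: "linear B" and BA: "\<And>x. B (A x) = x" and d0: "det2 A \<noteq> 0"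
    and q_scale: "\<And>s x. q (s *\<^sub>R x) = s\<^sup>2 * q x"
    and q_diff: "\<And>x y. q (x - y) \<le> 2 * q x + 2 * q y"
    and q_pos: "\<And>x. x \<noteq> 0 \<Longrightarrow> 0 < q x"
    and a: "a \<noteq> 0"
    and forw: "\<And>k. q ((A ^^ k) a) \<le> \<bar>det2 A\<bar> ^ k * q a"
    and bwd: "\<And>k. q ((B ^^ k) a) \<le> (1 / \<bar>det2 A\<bar>) ^ k * q a"
  shows "(trace2 A)\<^sup>2 \<le> 4 * det2 A \<or> trace2 A = 0"
proof (rule ccontr)
  define t d where "t = trace2 A" and "d = det2 A"
  assume "\<not> ?thesis"
  then have disc: "t\<^sup>2 > 4 * d" and t: "t \<noteq> 0"
    by (auto simp: t_def d_def)
  define r where "r = sqrt (t\<^sup>2 - 4 * d)"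
  have r: "r\<^sup>2 = t\<^sup>2 - 4 * d" "r > 0"
    using disc by (auto simp: r_def)
  have prod: "(t + r) / 2 * ((t - r) / 2) = d" "(t - r) / 2 * ((t + r) / 2) = d"
  proof -
    have "(t + r) * (t - r) = 4 * d"
      using r(1) by (simp add: power2_eq_square algebra_simps)
    then show "(t + r) / 2 * ((t - r) / 2) = d" "(t - r) / 2 * ((t + r) / 2) = d"
      by (simp_all add: mult.commute)
  qed
  have sum: "(t + r) / 2 + (t - r) / 2 = t" "(t - r) / 2 + (t + r) / 2 = t"
    by (simp_all flip: add_divide_distrib)
  \<comment> \<open>The roots of the characteristic polynomial, named so that \<open>la\<close> is
    the larger in modulus; which sign of the square root does this depends on the sign of
    \<open>t\<close>.\<close>
  obtain la mu where lm: "la + mu = t" "la * mu = d" "\<bar>mu\<bar> < \<bar>la\<bar>"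
  proof (cases "t > 0")
    case True
    then have "\<bar>t - r\<bar> < \<bar>t + r\<bar>"
      using r(2) by linarith
    then show thesis
      by (intro that[OF sum(1) prod(1)]) simp
  next
    case False
    then have "\<bar>t + r\<bar> < \<bar>t - r\<bar>"
      using r(2) t by linarith
    then show thesis
      by (intro that[OF sum(2) prod(2)]) simp
  qed
  have mu: "mu \<noteq> 0" and la: "la \<noteq> 0" and d: "d \<noteq> 0"
    using lm d0 by (auto simp: d_def)
  \<comment> \<open>Both growth bounds will be brought to the form that the powers of this ratio
    stay bounded.\<close>
  define x where "x = \<bar>la\<bar> / \<bar>mu\<bar>"
  have x: "x > 1"
    using lm(3) mu by (simp add: x_def)
  have qa: "q a > 0"
    using q_pos a by blast
  have pow_unbounded: "\<not> (\<forall>k. x ^ k * c \<le> C)" if "c > 0" for c C :: real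
  proof -
    obtain k where "C / c < x ^ k"
      using real_arch_pow[OF x] by blast
    then have "C < x ^ k * c"
      using that by (simp add: field_simps)
    then show ?thesis
      by (meson not_le)
  qed
  \<comment> \<open>Up to a factor, \<open>b\<close> is the component of \<open>a\<close> along the
    eigenline of \<open>la\<close>: the map \<open>A - mu\<close> kills the other eigenline.\<close>
  define b where "b = A a - mu *\<^sub>R a"
  have linA: "A (u + v) = A u + A v" "A (s *\<^sub>R u) = s *\<^sub>R A u" "A (u - v) = A u - A v" for u v s
    using A by (simp_all add: linear_add linear_cmul linear_diff)
  have Ab: "A b = la *\<^sub>R b"
  proof -
    have "A b = t *\<^sub>R A a - d *\<^sub>R a - mu *\<^sub>R A a"
      using cayley_hamilton_plane[OF A, of a] by (simp add: b_def linA t_def d_def)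
    also have "\<dots> = la *\<^sub>R b"
      by (simp add: b_def flip: lm(1,2)) (simp add: algebra_simps)
    finally show ?thesis .
  qed
  have Ab_pow: "(A ^^ k) b = la ^ k *\<^sub>R b" for k
    by (induction k) (simp_all add: Ab linA)
  have Ab_pow': "(A ^^ k) b = (A ^^ Suc k) a - mu *\<^sub>R (A ^^ k) a" for k
    by (induction k) (simp_all add: b_def linA)
  have "b = 0"
  proof (rule ccontr)
    assume "b \<noteq> 0"
    then have qb: "q b > 0"
      using q_pos by blast
    \<comment> \<open>On \<open>b\<close> the form grows like \<open>la ^ (2 * k)\<close>, but the
      forward bound allows only the growth of \<open>\<bar>la * mu\<bar> ^ k\<close>; the quotient
      of the two is \<open>x ^ k\<close>.\<close>
    have "x ^ k * q b \<le> (2 * \<bar>d\<bar> + 2 * mu\<^sup>2) * q a" for k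
    proof -
      have "(la ^ k)\<^sup>2 * q b = q ((A ^^ k) b)"
        by (simp add: Ab_pow q_scale)
      also have "\<dots> \<le> 2 * q ((A ^^ Suc k) a) + 2 * (mu\<^sup>2 * q ((A ^^ k) a))"
        unfolding Ab_pow' by (rule order_trans[OF q_diff]) (simp add: q_scale)
      also have "\<dots> \<le> 2 * (\<bar>d\<bar> ^ Suc k * q a) + 2 * (mu\<^sup>2 * (\<bar>d\<bar> ^ k * q a))"
        using forw[of k] forw[of "Suc k"] unfolding d_def
        by (intro add_mono mult_left_mono) auto
      also have "\<dots> = \<bar>d\<bar> ^ k * ((2 * \<bar>d\<bar> + 2 * mu\<^sup>2) * q a)"
        by (simp add: algebra_simps)
      finally have "(la ^ k)\<^sup>2 * q b / \<bar>d\<bar> ^ k \<le> (2 * \<bar>d\<bar> + 2 * mu\<^sup>2) * q a"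
        using d by (simp add: divide_le_eq mult.commute)
      moreover have "(la ^ k)\<^sup>2 * q b / \<bar>d\<bar> ^ k = x ^ k * q b"
      proof -
        have "(la ^ k)\<^sup>2 = (\<bar>la\<bar> * \<bar>la\<bar>) ^ k"
          by (simp add: power2_eq_square power_mult_distrib)
        moreover have "\<bar>la\<bar> * \<bar>la\<bar> / \<bar>d\<bar> = x"
          unfolding x_def lm(2)[symmetric] abs_mult using la by (intro mult_divide_mult_cancel_left) auto
        ultimately show ?thesis
          by (metis power_divide times_divide_eq_left)
      qed
      ultimately show ?thesis by simp
    qed
    then show False
      using pow_unbounded[OF qb] by blast
  qed
  then have "A a = mu *\<^sub>R a"
    by (simp add: b_def)
  then have "a = mu *\<^sub>R B a"
    using BA[of a] B by (simp add: linear_cmul)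
  then have Ba: "B a = (1 / mu) *\<^sub>R a"
    using mu by (metis divide_self_if one_neq_zero scaleR_one scaleR_scaleR times_divide_eq_left mult_1)
  have Ba_pow: "(B ^^ k) a = (1 / mu) ^ k *\<^sub>R a" for k
    using B by (induction k) (simp_all add: Ba linear_cmul)
  \<comment> \<open>Now \<open>a\<close> spans the eigenline of \<open>mu\<close>. Backward
    iteration multiplies the form by \<open>mu ^ (-2 * k)\<close>, against an allowed
    \<open>\<bar>la * mu\<bar> ^ (-k)\<close>; the quotient is again \<open>x ^ k\<close>.\<close>
  have "x ^ k * q a \<le> q a" for k
  proof -
    have "((1 / mu) ^ k)\<^sup>2 * q a \<le> (1 / \<bar>d\<bar>) ^ k * q a"
      using bwd[of k] by (simp add: Ba_pow q_scale d_def)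
    then have "\<bar>d\<bar> ^ k * (((1 / mu) ^ k)\<^sup>2 * q a) \<le> \<bar>d\<bar> ^ k * ((1 / \<bar>d\<bar>) ^ k * q a)"
      by (intro mult_left_mono) auto
    moreover have "\<bar>d\<bar> ^ k * ((1 / \<bar>d\<bar>) ^ k * q a) = q a"
      using d by (simp add: power_divide)
    moreover have mul_div: "p * m * (1 / (m * m)) = p / m" if "m \<noteq> 0" for p m :: real
      using that by simp
    moreover have "\<bar>d\<bar> ^ k * (((1 / mu) ^ k)\<^sup>2 * q a) = x ^ k * q a"
    proof -
      have "((1 / mu) ^ k)\<^sup>2 = (1 / (\<bar>mu\<bar> * \<bar>mu\<bar>)) ^ k"
        by (simp add: power2_eq_square power_divide power_mult_distrib)
      moreover have "\<bar>d\<bar> * (1 / (\<bar>mu\<bar> * \<bar>mu\<bar>)) = x"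
        using mul_div[of "\<bar>mu\<bar>" "\<bar>la\<bar>"] mu by (simp add: x_def abs_mult flip: lm(2))
      ultimately show ?thesis
        by (metis mult.assoc power_mult_distrib)
    qed
    ultimately show ?thesis by simp
  qed
  then show False
    using pow_unbounded[OF qa] by blast
qed

text \<open>A nonreal root has its conjugate as the other root, so the product \<open>d\<close> of
  the roots is the squared modulus. A real root is either double or, when \<open>t = 0\<close>, one
  of two opposite numbers.\<close>

lemma complex_root_modulus:
  fixes t d :: real and z :: complex
  assumes "t\<^sup>2 \<le> 4 * d \<or> t = 0"
    and "z\<^sup>2 - of_real t * z + of_real d = 0"
  shows "(cmod z)\<^sup>2 = \<bar>d\<bar>"
proof -
  define x y where "x = Re z" and "y = Im z"
  have re: "x\<^sup>2 - y\<^sup>2 - t * x + d = 0" and im: "2 * x * y - t * y = 0"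
    using arg_cong[OF assms(2), of Re] arg_cong[OF assms(2), of Im]
    unfolding power2_eq_square by (simp_all add: x_def y_def)
  have "x\<^sup>2 + y\<^sup>2 = \<bar>d\<bar>"
  proof (cases "y = 0")
    case True
    then have eq: "x\<^sup>2 - t * x + d = 0"
      using re by simp
    show ?thesis
    proof (cases "t = 0")
      case True
      then have "d \<le> 0"
        using eq zero_le_power2[of x] \<open>t = 0\<close> by (simp add: add_eq_0_iff)
      then show ?thesis
        using eq \<open>y = 0\<close> \<open>t = 0\<close> by simp
    next
      case False
      then have "4 * d \<ge> t\<^sup>2"
        using assms(1) by blast
      moreover have "(2 * x - t)\<^sup>2 = t\<^sup>2 - 4 * d"
        using eq by (simp add: power2_eq_square algebra_simps)
      ultimately have "(2 * x - t)\<^sup>2 = 0"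
        using zero_le_power2[of "2 * x - t"] by linarith
      then have "2 * x = t"
        by simp
      then have "x\<^sup>2 = d"
        using eq by (auto simp: power2_eq_square)
      then show ?thesis
        using \<open>y = 0\<close> by (metis abs_of_nonneg add.right_neutral power_zero_numeral zero_le_power2)
    qed
  next
    case False
    then have "t = 2 * x"
      using im by algebra
    then have "d = x\<^sup>2 + y\<^sup>2"
      using re by (simp add: power2_eq_square)
    then show ?thesis
      by (simp add: abs_of_nonneg)
  qed
  then show ?thesis
    by (simp add: cmod_power2 x_def y_def)
qed

section \<open>Isometries to Euclidean coordinates and adapted norms\<close>

lemma bilinear_form_isometry:
  fixes B :: "real^2 \<Rightarrow> real^2 \<Rightarrow> real"
  assumes l: "\<And>b. linear (\<lambda>a. B a b)" and s: "\<And>a b. B a b = B b a"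
    and pos: "\<And>a. a \<noteq> 0 \<Longrightarrow> 0 < B a a"
  obtains P :: "real^2 \<Rightarrow> real^2" where "linear P" "bij P" "\<And>a b. P a \<bullet> P b = B a b"
proof -
  define p q r where "p = B (axis 1 1) (axis 1 1)" and "q = B (axis 1 1) (axis 2 1)"
    and "r = B (axis 2 1) (axis 2 1)"
  have e: "B a b = a$1 * (b$1 * p + b$2 * q) + a$2 * (b$1 * q + b$2 * r)" for a b
    unfolding p_def q_def r_def by (rule bilinear_plane_expand[OF l s])
  have p: "p > 0"
    unfolding p_def by (rule pos) (simp add: axis_eq_0_iff)
  have g: "p * r - q\<^sup>2 > 0"
    unfolding p_def q_def r_def by (rule gram_bilinear_pos[OF l s pos])
  \<comment> \<open>The Cholesky factor: \<open>P\<close> is the upper triangular matrix whose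
    transpose times itself is the matrix of \<open>B\<close>.\<close>
  define P :: "real^2 \<Rightarrow> real^2" where
    "P a = vector [sqrt p * a$1 + q / sqrt p * a$2, sqrt ((p * r - q\<^sup>2) / p) * a$2]" for a
  have lin: "linear P"
    by (rule linearI) (simp_all add: P_def vec_eq_iff forall_2 algebra_simps add_divide_distrib)
  have inner: "P a \<bullet> P b = B a b" for a b
  proof -
    have "P a \<bullet> P b = (sqrt p * sqrt p) * a$1 * b$1 + (sqrt p / sqrt p) * q * (a$1 * b$2 + a$2 * b$1)
       + (q * q / (sqrt p * sqrt p)) * a$2 * b$2
       + (sqrt ((p * r - q\<^sup>2) / p) * sqrt ((p * r - q\<^sup>2) / p)) * a$2 * b$2"
      by (simp add: P_def inner_vec_def sum_2 algebra_simps add_divide_distrib)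
    also have "\<dots> = p * a$1 * b$1 + q * (a$1 * b$2 + a$2 * b$1) + (q * q / p + (p * r - q * q) / p) * a$2 * b$2"
      using p g by (simp add: real_sqrt_mult_self algebra_simps power2_eq_square)
    also have "q * q / p + (p * r - q * q) / p = r"
      using p by (simp add: field_simps)
    finally show ?thesis
      by (simp add: e algebra_simps)
  qed
  have "inj P"
  proof (rule linear_injective_0[OF lin, THEN iffD2, rule_format])
    fix a assume "P a = 0"
    then have "B a a = 0"
      using inner[of a a] by simp
    then show "a = 0"
      using pos[of a] by fastforce
  qed
  then have "bij P"
    using linear_injective_imp_surjective[OF lin] by (simp add: bij_def)
  then show thesis
    using that lin inner by blast
qed

text \<open>Completing the square in the Cayley-Hamilton identity. The factor \<open>m\<close> stays
  free: it serves to normalise the square to 1 or -1, or as a weight when the square is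
  zero.\<close>

lemma shifted_linear_square:
  fixes A :: "real^2 \<Rightarrow> real^2"
  assumes A: "linear A" and N: "\<And>x. N x = m *\<^sub>R (A x - (trace2 A / 2) *\<^sub>R x)"
  shows "linear N" "N (N x) = (m\<^sup>2 * ((trace2 A / 2)\<^sup>2 - det2 A)) *\<^sub>R x"
    and "N (A x) = A (N x)"
proof -
  note linA = linear_add[OF A] linear_cmul[OF A] linear_diff[OF A]
  show "linear N"
    by (rule linearI) (simp_all add: N linA algebra_simps)
  show "N (A x) = A (N x)"
    by (simp add: N linA)
  have "N (N x) = m\<^sup>2 *\<^sub>R (A (A x) - trace2 A *\<^sub>R A x + (trace2 A / 2)\<^sup>2 *\<^sub>R x)"
  proof -
    have half: "trace2 A *\<^sub>R A x = (trace2 A / 2) *\<^sub>R A x + (trace2 A / 2) *\<^sub>R A x"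
      by (simp flip: scaleR_add_left)
    show ?thesis
      unfolding half by (simp add: N linA power2_eq_square algebra_simps)
  qed
  also have "\<dots> = (m\<^sup>2 * ((trace2 A / 2)\<^sup>2 - det2 A)) *\<^sub>R x"
    unfolding cayley_hamilton_plane[OF A, of x] by (simp add: algebra_simps)
  finally show "N (N x) = (m\<^sup>2 * ((trace2 A / 2)\<^sup>2 - det2 A)) *\<^sub>R x" .
qed

lemma norm_lincomb_power2:
  fixes x y :: "'a::real_inner"
  shows "(norm (a *\<^sub>R x + b *\<^sub>R y))\<^sup>2 = a\<^sup>2 * (norm x)\<^sup>2 + 2 * a * b * (x \<bullet> y) + b\<^sup>2 * (norm y)\<^sup>2"
  unfolding power2_norm_eq_inner by (simp add: inner_simps power2_eq_square inner_commute algebra_simps)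

text \<open>If \<open>(A - t/2)\<^sup>2\<close> is a nonzero scalar, normalise it to \<open>N\<close> with \<open>N\<^sup>2 = \<plusminus>1\<close>; then \<open>A\<close> is
  conformal for the norm of the graph of \<open>N\<close>.\<close>

lemma conformal_graph_norm:
  fixes A :: "real^2 \<Rightarrow> real^2"
  assumes A: "linear A" and d: "(trace2 A)\<^sup>2 < 4 * det2 A \<or> trace2 A = 0 \<and> det2 A \<noteq> 0"
  obtains N :: "real^2 \<Rightarrow> real^2" where "linear N"
    "\<And>x. (norm (A x))\<^sup>2 + (norm (N (A x)))\<^sup>2 = \<bar>det2 A\<bar> * ((norm x)\<^sup>2 + (norm (N x))\<^sup>2)"
proof (cases "(trace2 A)\<^sup>2 < 4 * det2 A")
  case True
  define \<alpha> s where "\<alpha> = trace2 A / 2" and "s = sqrt (det2 A - \<alpha>\<^sup>2)"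
  have s: "s\<^sup>2 = det2 A - \<alpha>\<^sup>2" "s > 0"
    using True by (auto simp: s_def \<alpha>_def power2_eq_square)
  define N where "N x = (1 / s) *\<^sub>R (A x - (trace2 A / 2) *\<^sub>R x)" for x
  note N = shifted_linear_square[OF A N_def]
  have "(1 / s)\<^sup>2 * (\<alpha>\<^sup>2 - det2 A) = - 1"
    using s by (simp add: field_simps)
  then have NN: "N (N x) = - x" for x
    using N(2)[of x] by (simp add: \<alpha>_def)
  have Ax: "A x = \<alpha> *\<^sub>R x + s *\<^sub>R N x" for x
    using s by (simp add: N_def \<alpha>_def)
  have ANx: "N (A x) = \<alpha> *\<^sub>R N x + (- s) *\<^sub>R x" for x
    unfolding N(3) Ax[of "N x"] NN by simp
  show thesis
  proof (rule that[OF N(1)])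
    fix x
    \<comment> \<open>As \<open>N\<close> squares to -1, \<open>A\<close> acts like multiplication
      by the complex number \<open>\<alpha> + i s\<close>, and the mixed terms of the two squared
      norms cancel.\<close>
    have "(norm (A x))\<^sup>2 + (norm (N (A x)))\<^sup>2 = (\<alpha>\<^sup>2 + s\<^sup>2) * ((norm x)\<^sup>2 + (norm (N x))\<^sup>2)"
      unfolding ANx unfolding Ax[of x] norm_lincomb_power2
      by (simp add: inner_commute algebra_simps)
    also have "\<alpha>\<^sup>2 + s\<^sup>2 = \<bar>det2 A\<bar>"
      using s(1) by (smt (verit) zero_le_power2)
    finally show "(norm (A x))\<^sup>2 + (norm (N (A x)))\<^sup>2 = \<bar>det2 A\<bar> * ((norm x)\<^sup>2 + (norm (N x))\<^sup>2)" .
  qed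
next
  case False
  \<comment> \<open>The remaining case has two opposite real eigenvalues. Here \<open>A\<close> is
    \<open>s\<close> times an involution \<open>N\<close>, so it exchanges the two components of the
    graph norm up to the factor \<open>s\<close>.\<close>
  then have t: "trace2 A = 0" and d: "det2 A < 0"
    using d by auto
  define s where "s = sqrt (- det2 A)"
  have s: "s\<^sup>2 = - det2 A" "s > 0"
    using d by (auto simp: s_def)
  define N where "N x = (1 / s) *\<^sub>R (A x - (trace2 A / 2) *\<^sub>R x)" for x
  note N = shifted_linear_square[OF A N_def]
  have "(1 / s)\<^sup>2 * - det2 A = 1"
    using s d by (simp add: field_simps)
  then have NN: "N (N x) = x" for x
    using N(2)[of x] t by simp
  have Ax: "A x = s *\<^sub>R N x" for x
    using s t by (simp add: N_def)
  have ANx: "N (A x) = s *\<^sub>R x" for x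
    unfolding N(3) Ax[of "N x"] NN by simp
  show thesis
  proof (rule that[OF N(1)])
    fix x
    have "(norm (A x))\<^sup>2 + (norm (N (A x)))\<^sup>2 = s\<^sup>2 * ((norm x)\<^sup>2 + (norm (N x))\<^sup>2)"
      unfolding ANx unfolding Ax[of x] by (simp add: power_mult_distrib algebra_simps)
    also have "s\<^sup>2 = \<bar>det2 A\<bar>"
      using s(1) d by simp
    finally show "(norm (A x))\<^sup>2 + (norm (N (A x)))\<^sup>2 = \<bar>det2 A\<bar> * ((norm x)\<^sup>2 + (norm (N x))\<^sup>2)" .
  qed
qed

text \<open>Outside the case of a double eigenvalue \<open>A\<close> is conformal with factor
  \<open>sqrt \<bar>det2 A\<bar>\<close>. For a double eigenvalue \<open>\<alpha>\<close>, the
  difference of \<open>A\<close> and \<open>\<alpha>\<close> is nilpotent; weighting it by a large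
  \<open>m\<close> makes its contribution to the norm so small that it fits into the gap between
  \<open>\<bar>\<alpha>\<bar>\<close> and 1.\<close>

lemma contracting_graph_norm:
  fixes A :: "real^2 \<Rightarrow> real^2"
  assumes A: "linear A" and d0: "det2 A \<noteq> 0" and d1: "\<bar>det2 A\<bar> < 1"
    and td: "(trace2 A)\<^sup>2 \<le> 4 * det2 A \<or> trace2 A = 0"
  obtains N :: "real^2 \<Rightarrow> real^2" and \<sigma> where "linear N" "0 \<le> \<sigma>" "\<sigma> < 1"
    "\<And>x. norm (A x, N (A x)) \<le> \<sigma> * norm (x, N x)"
proof -
  have "\<exists>(N :: real^2 \<Rightarrow> real^2) \<rho>. linear N \<and> 0 \<le> \<rho> \<and> \<rho> < 1 \<and>
    (\<forall>x. (norm (A x))\<^sup>2 + (norm (N (A x)))\<^sup>2 \<le> \<rho> * ((norm x)\<^sup>2 + (norm (N x))\<^sup>2))"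
  proof (cases "(trace2 A)\<^sup>2 = 4 * det2 A")
    case True
    define \<alpha> where "\<alpha> = trace2 A / 2"
    have \<alpha>: "\<alpha>\<^sup>2 = det2 A" "\<alpha>\<^sup>2 < 1"
      using True d1 by (auto simp: \<alpha>_def power2_eq_square)
    have \<alpha>_pos: "\<alpha>\<^sup>2 > 0"
      using \<alpha> d0 by (metis zero_less_power2 power_zero_numeral)
    \<comment> \<open>The parameter of a Young inequality for the mixed term, chosen so that
      \<open>(1 + \<eta>) * \<alpha>\<^sup>2\<close> lies halfway between
      \<open>\<alpha>\<^sup>2\<close> and 1.\<close>
    define \<eta> where "\<eta> = (1 - \<alpha>\<^sup>2) / (2 * \<alpha>\<^sup>2)"
    define \<rho> where "\<rho> = (1 + \<eta>) * \<alpha>\<^sup>2"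
    have \<eta>: "\<eta> > 0"
      using \<alpha> \<alpha>_pos by (simp add: \<eta>_def)
    have \<rho>: "\<rho> = (1 + \<alpha>\<^sup>2) / 2"
      using \<alpha>_pos by (simp add: \<rho>_def \<eta>_def field_simps)
    have \<rho>1: "\<rho> < 1" "0 \<le> \<rho>" "\<alpha>\<^sup>2 < \<rho>"
      using \<alpha>(2) unfolding \<rho> by (auto intro: add_nonneg_nonneg)
    \<comment> \<open>This weight makes the coefficients of \<open>(norm (N x))\<^sup>2\<close>
      balance exactly.\<close>
    define m where "m = sqrt ((1 + 1 / \<eta>) / (\<rho> - \<alpha>\<^sup>2))"
    have m: "m\<^sup>2 * (\<rho> - \<alpha>\<^sup>2) = 1 + 1 / \<eta>" "m > 0"
      using \<eta> \<rho>1 by (auto simp: m_def add_pos_pos)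
    define N where "N x = m *\<^sub>R (A x - (trace2 A / 2) *\<^sub>R x)" for x
    note N = shifted_linear_square[OF A N_def]
    have NN: "N (N x) = 0" for x
      using N(2)[of x] \<alpha> by (simp add: \<alpha>_def)
    have Ax: "A x = \<alpha> *\<^sub>R x + (1 / m) *\<^sub>R N x" for x
      using m(2) by (simp add: N_def \<alpha>_def)
    have ANx: "N (A x) = \<alpha> *\<^sub>R N x" for x
      unfolding N(3) Ax[of "N x"] NN by simp
    have "(norm (A x))\<^sup>2 + (norm (N (A x)))\<^sup>2 \<le> \<rho> * ((norm x)\<^sup>2 + (norm (N x))\<^sup>2)" for x
    proof -
      \<comment> \<open>The Young inequality, obtained as the nonnegativity of a square.\<close>
      have "0 \<le> (norm ((sqrt \<eta> * \<alpha>) *\<^sub>R x + (- 1 / (sqrt \<eta> * m)) *\<^sub>R N x))\<^sup>2"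
        by simp
      also have "\<dots> = \<eta> * \<alpha>\<^sup>2 * (norm x)\<^sup>2 - 2 * \<alpha> / m * (x \<bullet> N x) + 1 / (\<eta> * m\<^sup>2) * (norm (N x))\<^sup>2"
        unfolding norm_lincomb_power2 using \<eta> m(2)
        by (simp add: power_mult_distrib power_divide)
      finally have "2 * \<alpha> / m * (x \<bullet> N x) \<le> \<eta> * \<alpha>\<^sup>2 * (norm x)\<^sup>2 + 1 / (\<eta> * m\<^sup>2) * (norm (N x))\<^sup>2"
        by simp
      moreover have "(norm (A x))\<^sup>2 = \<alpha>\<^sup>2 * (norm x)\<^sup>2 + 2 * \<alpha> / m * (x \<bullet> N x) + 1 / m\<^sup>2 * (norm (N x))\<^sup>2"
        unfolding Ax[of x] norm_lincomb_power2 by (simp add: power_divide)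
      moreover have "1 / m\<^sup>2 + 1 / (\<eta> * m\<^sup>2) = \<rho> - \<alpha>\<^sup>2"
      proof -
        have "1 / m\<^sup>2 + 1 / (\<eta> * m\<^sup>2) = (1 + 1 / \<eta>) / m\<^sup>2"
          by (simp add: add_divide_distrib)
        also have "\<dots> = \<rho> - \<alpha>\<^sup>2"
          unfolding m(1)[symmetric] using m(2) by simp
        finally show ?thesis .
      qed
      then have "1 / m\<^sup>2 * (norm (N x))\<^sup>2 + 1 / (\<eta> * m\<^sup>2) * (norm (N x))\<^sup>2 = (\<rho> - \<alpha>\<^sup>2) * (norm (N x))\<^sup>2"
        by (metis distrib_right)
      moreover have "(norm (N (A x)))\<^sup>2 = \<alpha>\<^sup>2 * (norm (N x))\<^sup>2"
        by (simp add: ANx power_mult_distrib)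
      moreover have "\<rho> * (norm x)\<^sup>2 = \<alpha>\<^sup>2 * (norm x)\<^sup>2 + \<eta> * \<alpha>\<^sup>2 * (norm x)\<^sup>2"
        by (simp add: \<rho>_def algebra_simps)
      ultimately show ?thesis
        by (simp only: distrib_left left_diff_distrib)
    qed
    then show ?thesis
      using N(1) \<rho>1 by blast
  next
    case False
    then obtain N :: "real^2 \<Rightarrow> real^2" where "linear N"
      "\<And>x. (norm (A x))\<^sup>2 + (norm (N (A x)))\<^sup>2 = \<bar>det2 A\<bar> * ((norm x)\<^sup>2 + (norm (N x))\<^sup>2)"
      using conformal_graph_norm[OF A] td d0 by (metis order_le_less)
    then show ?thesis
      using d1 by (metis abs_ge_zero order_refl)
  qed
  then obtain N :: "real^2 \<Rightarrow> real^2" and \<rho> where N: "linear N" "0 \<le> \<rho>" "\<rho> < 1"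
    and le: "\<And>x. (norm (A x))\<^sup>2 + (norm (N (A x)))\<^sup>2 \<le> \<rho> * ((norm x)\<^sup>2 + (norm (N x))\<^sup>2)"
    by blast
  show thesis
  proof (rule that[OF N(1)])
    show "norm (A x, N (A x)) \<le> sqrt \<rho> * norm (x, N x)" for x
      unfolding norm_Pair real_sqrt_mult[symmetric] by (rule real_sqrt_le_mono[OF le])
  qed (use N in auto)
qed

text \<open>The norm of \<open>(x, N x)\<close> serves as an adapted norm.\<close>

lemma local_contraction:
  fixes \<phi> A N :: "'a::euclidean_space \<Rightarrow> 'a"
  assumes der: "(\<phi> has_derivative A) (at p)" and fp: "\<phi> p = p" and N: "linear N"
    and \<sigma>: "0 \<le> \<sigma>" "\<sigma> < 1" "\<And>x. norm (A x, N (A x)) \<le> \<sigma> * norm (x, N x)"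
    and "0 < \<epsilon>"
  obtains U where "open U" "p \<in> U" "U \<subseteq> ball p \<epsilon>" "\<phi> ` U \<subseteq> U"
    "\<And>q. q \<in> U \<Longrightarrow> (\<lambda>k. (\<phi> ^^ k) q) \<longlonglongrightarrow> p"
proof -
  define Q where "Q x = norm (x, N x)" for x
  have le_Q: "norm x \<le> Q x" for x
    unfolding Q_def by (rule norm_fst_le)
  have Q_triangle: "Q (x + y) \<le> Q x + Q y" for x y
    unfolding Q_def linear_add[OF N] by (metis norm_triangle_ineq add_Pair)
  obtain C where C: "C > 0" "\<And>x. Q x \<le> C * norm x"
  proof -
    have "bounded_linear (\<lambda>x. (x, N x))"
      using N by (intro bounded_linear_Pair bounded_linear_ident linear_conv_bounded_linear[THEN iffD1])
    then show thesis
      using bounded_linear.pos_bounded that unfolding Q_def by (metis mult.commute)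
  qed
  \<comment> \<open>The midpoint of \<open>\<sigma>\<close> and 1. The gap
    \<open>(1 - \<sigma>) / 2\<close> absorbs the remainder of the linear approximation; dividing it
    by \<open>C\<close> below pays for measuring that remainder in \<open>Q\<close>.\<close>
  define \<tau> where "\<tau> = (1 + \<sigma>) / 2"
  have \<tau>: "0 \<le> \<tau>" "\<tau> < 1" "\<tau> = \<sigma> + (1 - \<sigma>) / 2"
    using \<sigma> by (auto simp: \<tau>_def field_simps)
  have "(1 - \<sigma>) / 2 / C > 0"
    using \<sigma> C by simp
  then obtain r where r: "r > 0"
    "\<And>y. norm (y - p) < r \<Longrightarrow> norm (\<phi> y - \<phi> p - A (y - p)) \<le> (1 - \<sigma>) / 2 / C * norm (y - p)"
    using der unfolding has_derivative_at_alt by blast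
  have step: "Q (\<phi> y - p) \<le> \<tau> * Q (y - p)" if "norm (y - p) < r" for y
  proof -
    have "Q (\<phi> y - p) \<le> Q (A (y - p)) + Q (\<phi> y - \<phi> p - A (y - p))"
      using Q_triangle[of "A (y - p)" "\<phi> y - \<phi> p - A (y - p)"] by (simp add: fp)
    also have "Q (A (y - p)) \<le> \<sigma> * Q (y - p)"
      using \<sigma> by (simp add: Q_def)
    also have "Q (\<phi> y - \<phi> p - A (y - p)) \<le> C * ((1 - \<sigma>) / 2 / C * norm (y - p))"
      using C r(2)[OF that] by (meson order_trans mult_left_mono less_imp_le)
    also have "\<dots> = (1 - \<sigma>) / 2 * norm (y - p)"
      using C by simp
    also have "\<dots> \<le> (1 - \<sigma>) / 2 * Q (y - p)"
      using \<sigma> le_Q by (intro mult_left_mono) auto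
    finally show ?thesis
      by (simp add: \<tau>(3) algebra_simps)
  qed
  define \<delta> where "\<delta> = min r \<epsilon>"
  have \<delta>: "\<delta> > 0" "\<delta> \<le> r" "\<delta> \<le> \<epsilon>"
    using r \<open>0 < \<epsilon>\<close> by (auto simp: \<delta>_def)
  \<comment> \<open>A ball for \<open>Q\<close>, not for the Euclidean norm, because only
    \<open>Q\<close> is known to shrink at every step.\<close>
  define U where "U = {q. Q (q - p) < \<delta>}"
  have pow: "Q ((\<phi> ^^ k) q - p) \<le> \<tau> ^ k * Q (q - p) \<and> (\<phi> ^^ k) q \<in> U" if "q \<in> U" for k q
  proof (induction k)
    case (Suc k)
    let ?y = "(\<phi> ^^ k) q"
    have y: "Q (\<phi> ?y - p) \<le> \<tau> * Q (?y - p)"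
      using Suc le_Q[of "?y - p"] \<delta> by (intro step) (auto simp: U_def)
    moreover have "\<tau> * Q (?y - p) \<le> \<tau> * (\<tau> ^ k * Q (q - p))"
      using Suc \<tau> by (intro mult_left_mono) auto
    moreover have "\<tau> * Q (?y - p) \<le> 1 * Q (?y - p)"
      using \<tau> by (intro mult_right_mono) (auto simp: Q_def)
    ultimately show ?case
      using Suc by (auto simp: U_def mult.assoc)
  qed (use that in simp)
  show thesis
  proof (rule that[of U])
    have "continuous_on UNIV (\<lambda>q. N (q - p))"
      by (rule linear_continuous_on_compose[OF _ N]) (intro continuous_intros)
    then have "continuous_on UNIV (\<lambda>q. Q (q - p))"
      unfolding Q_def by (intro continuous_on_norm continuous_on_Pair) (auto intro: continuous_intros)
    then show "open U"
      unfolding U_def by (intro open_Collect_less continuous_on_const)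
    show "p \<in> U"
      using \<delta> N by (simp add: U_def Q_def linear_0 norm_Pair)
    show "U \<subseteq> ball p \<epsilon>"
      using le_less_trans[OF le_Q] \<delta>(3) by (fastforce simp: U_def dist_norm norm_minus_commute)
    show "\<phi> ` U \<subseteq> U"
      using pow[of _ 1] by auto
    show "(\<lambda>k. (\<phi> ^^ k) q) \<longlonglongrightarrow> p" if "q \<in> U" for q
    proof (rule LIM_zero_cancel, rule Lim_null_comparison)
      show "\<forall>\<^sub>F k in sequentially. norm ((\<phi> ^^ k) q - p) \<le> \<tau> ^ k * Q (q - p)"
        using pow[OF that] le_Q by (intro always_eventually) (meson order_trans)
      show "(\<lambda>k. \<tau> ^ k * Q (q - p)) \<longlonglongrightarrow> 0"
        using \<tau> by (intro tendsto_mult_left_zero LIMSEQ_power_zero) auto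
    qed
  qed
qed

text \<open>The Cayley-Hamilton relation applied to a complex eigenvector says that the
  characteristic polynomial at \<open>z\<close> annihilates a nonzero vector, so it vanishes; all of
  it is done in real and imaginary parts.\<close>

lemma eigenvalue_on_modulus:
  fixes L :: "'v::real_vector \<Rightarrow> 'v"
  assumes lin: "\<And>u v a b. u \<in> V \<Longrightarrow> v \<in> V \<Longrightarrow> L (a *\<^sub>R u + b *\<^sub>R v) = a *\<^sub>R L u + b *\<^sub>R L v"
    and ch: "\<And>v. v \<in> V \<Longrightarrow> L (L v) = t *\<^sub>R L v - d *\<^sub>R v"
    and td: "t\<^sup>2 \<le> 4 * d \<or> t = 0"
    and z: "eigenvalue_on V L z"
  shows "(cmod z)\<^sup>2 = \<bar>d\<bar>"
proof (rule complex_root_modulus[OF td])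
  define x y where "x = Re z" and "y = Im z"
  obtain u w where uw: "u \<in> V" "w \<in> V" "u \<noteq> 0 \<or> w \<noteq> 0"
    and Lu: "L u = x *\<^sub>R u + (- y) *\<^sub>R w" and Lw: "L w = y *\<^sub>R u + x *\<^sub>R w"
    using z unfolding eigenvalue_on_def x_def y_def by auto
  \<comment> \<open>Real and imaginary part of \<open>z\<^sup>2 - t * z + d\<close>.\<close>
  define p q where "p = x\<^sup>2 - y\<^sup>2 - t * x + d" and "q = x * y + x * y - t * y"
  have "x *\<^sub>R (x *\<^sub>R u + (- y) *\<^sub>R w) + (- y) *\<^sub>R (y *\<^sub>R u + x *\<^sub>R w) =
      t *\<^sub>R (x *\<^sub>R u + (- y) *\<^sub>R w) - d *\<^sub>R u"
    using ch[OF uw(1)] by (simp only: Lu Lw lin[OF uw(1,2)])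
  then have 1: "p *\<^sub>R u - q *\<^sub>R w = 0"
    unfolding p_def q_def
    by (simp add: algebra_simps power2_eq_square) (metis mult.assoc mult_2_right scaleR_add_left)
  have "y *\<^sub>R (x *\<^sub>R u + (- y) *\<^sub>R w) + x *\<^sub>R (y *\<^sub>R u + x *\<^sub>R w) =
      t *\<^sub>R (y *\<^sub>R u + x *\<^sub>R w) - d *\<^sub>R w"
    using ch[OF uw(2)] by (simp only: Lu Lw lin[OF uw(1,2)])
  then have 2: "q *\<^sub>R u + p *\<^sub>R w = 0"
    unfolding p_def q_def
    by (simp add: algebra_simps power2_eq_square) (metis mult.assoc mult_2_right scaleR_add_left)
  \<comment> \<open>Multiplication by the conjugate \<open>p - i q\<close> turns the two real
    equations into one for each of \<open>u\<close> and \<open>w\<close>.\<close>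
  have "(p\<^sup>2 + q\<^sup>2) *\<^sub>R u = p *\<^sub>R (p *\<^sub>R u - q *\<^sub>R w) + q *\<^sub>R (q *\<^sub>R u + p *\<^sub>R w)"
    by (simp add: algebra_simps power2_eq_square)
  moreover have "(p\<^sup>2 + q\<^sup>2) *\<^sub>R w = p *\<^sub>R (q *\<^sub>R u + p *\<^sub>R w) - q *\<^sub>R (p *\<^sub>R u - q *\<^sub>R w)"
    by (simp add: algebra_simps power2_eq_square)
  ultimately have "p\<^sup>2 + q\<^sup>2 = 0"
    using uw(3) unfolding 1 2 by auto
  then have "p = 0" "q = 0"
    by (simp_all add: sum_power2_eq_zero_iff)
  then show "z\<^sup>2 - of_real t * z + of_real d = 0"
    unfolding power2_eq_square by (simp add: complex_eq_iff p_def q_def x_def y_def power2_eq_square)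
qed

text \<open>Off the double eigenvalue, an isometry from the graph norm to the Euclidean norm turns
  \<open>A\<close> into a scaled orthogonal map; this covers opposite real eigenvalues, since
  \<open>R\<close> may be a reflection. At a double eigenvalue \<open>l\<close>, the map
  \<open>N\<close> is nilpotent, and all eigenvectors of \<open>A\<close> lie in its kernel; unless
  \<open>N\<close> is zero they cannot span the plane.\<close>

lemma equal_moduli_classification:
  fixes L :: "'v::real_vector \<Rightarrow> 'v" and \<phi> :: "'v \<Rightarrow> real^2"
  assumes V: "subspace V" and \<phi>: "linear \<phi>" "bij_betw \<phi> V UNIV"
    and LV: "\<And>v. v \<in> V \<Longrightarrow> L v \<in> V" and A: "linear A" "\<And>v. v \<in> V \<Longrightarrow> \<phi> (L v) = A (\<phi> v)"
    and d0: "det2 A \<noteq> 0"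
    and td: "(trace2 A)\<^sup>2 \<le> 4 * det2 A \<or> trace2 A = 0"
  shows "homothety_on V L \<or> elliptic_on V L \<or> parabolic_on V L"
proof -
  have eqI: "u = v" if "\<phi> u = \<phi> v" "u \<in> V" "v \<in> V" for u v
    using \<phi>(2) that by (metis bij_betw_def inj_onD)
  have surj: "\<exists>v\<in>V. \<phi> v = x" for x
    using \<phi>(2) by (metis UNIV_I bij_betw_def imageE)
  have scale: "a *\<^sub>R v \<in> V" if "v \<in> V" for a v
    using V that by (rule subspace_scale)
  note lin\<phi> = linear_add[OF \<phi>(1)] linear_cmul[OF \<phi>(1)] linear_0[OF \<phi>(1)]
  show ?thesis
  proof (cases "(trace2 A)\<^sup>2 = 4 * det2 A")
    case False
    then obtain N :: "real^2 \<Rightarrow> real^2" where N: "linear N"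
      "\<And>x. (norm (A x))\<^sup>2 + (norm (N (A x)))\<^sup>2 = \<bar>det2 A\<bar> * ((norm x)\<^sup>2 + (norm (N x))\<^sup>2)"
      using conformal_graph_norm[OF A(1)] td d0 by (metis order_le_less)
    obtain P :: "real^2 \<Rightarrow> real^2" where P: "linear P" "bij P"
      "\<And>a b. P a \<bullet> P b = a \<bullet> b + N a \<bullet> N b"
    proof (rule bilinear_form_isometry)
      show "linear (\<lambda>a. a \<bullet> b + N a \<bullet> N b)" for b :: "real^2"
        by (rule linearI) (simp_all add: linear_add[OF N(1)] linear_cmul[OF N(1)] inner_simps algebra_simps)
      show "a \<bullet> b + N a \<bullet> N b = b \<bullet> a + N b \<bullet> N a" for a b :: "real^2"
        by (simp add: inner_commute)
      show "0 < a \<bullet> a + N a \<bullet> N a" if "a \<noteq> 0" for a :: "real^2"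
        using that by (simp add: add_pos_nonneg)
    qed blast
    have normP: "(norm (P x))\<^sup>2 = (norm x)\<^sup>2 + (norm (N x))\<^sup>2" for x
      unfolding power2_norm_eq_inner using P(3) by simp
    define s where "s = sqrt \<bar>det2 A\<bar>"
    have s: "s > 0" "s\<^sup>2 = \<bar>det2 A\<bar>"
      using d0 by (auto simp: s_def)
    define R where "R y = (1 / s) *\<^sub>R P (A (inv P y))" for y
    have invP: "linear (inv P)" "\<And>y. P (inv P y) = y" "\<And>x. inv P (P x) = x"
      using P by (simp_all add: linear_injective_isomorphism inj_linear_imp_inv_linear bij_is_inj bij_is_surj surj_f_inv_f)
    have "linear R"
      unfolding R_def by (rule linearI)
        (simp_all add: linear_add[OF invP(1)] linear_cmul[OF invP(1)] linear_add[OF A(1)] linear_cmul[OF A(1)]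
          linear_add[OF P(1)] linear_cmul[OF P(1)] algebra_simps)
    moreover have "norm (R y) = norm y" for y
    proof -
      have "(norm (R y))\<^sup>2 = (1 / s)\<^sup>2 * (norm (P (A (inv P y))))\<^sup>2"
        by (simp add: R_def power_mult_distrib power_divide)
      also have "\<dots> = (1 / s)\<^sup>2 * s\<^sup>2 * (norm (P (inv P y)))\<^sup>2"
        unfolding normP N(2) s(2) by simp
      also have "\<dots> = (norm y)\<^sup>2"
        using s(1) by (simp add: invP(2) power_divide)
      finally show ?thesis
        by simp
    qed
    ultimately have "orthogonal_transformation R"
      by (simp add: orthogonal_transformation)
    moreover have "linear (P \<circ> \<phi>)" "bij_betw (P \<circ> \<phi>) V UNIV"
      using \<phi> P by (auto intro: linear_compose bij_betw_trans)
    moreover have "(P \<circ> \<phi>) (L v) = s *\<^sub>R R ((P \<circ> \<phi>) v)" if "v \<in> V" for v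
      using s(1) by (simp add: R_def invP(3) A(2)[OF that])
    ultimately have "elliptic_on V L"
      unfolding elliptic_on_def by blast
    then show ?thesis by blast
  next
    case True
    define l where "l = trace2 A / 2"
    define N where "N x = 1 *\<^sub>R (A x - (trace2 A / 2) *\<^sub>R x)" for x
    have "l\<^sup>2 - det2 A = 0"
      using True by (simp add: l_def power2_eq_square)
    then have NN: "N (N x) = 0" for x
      using shifted_linear_square(2)[OF A(1) N_def, of x] by (simp add: l_def)
    have N: "N x = A x - l *\<^sub>R x" for x
      by (simp add: N_def l_def)
    show ?thesis
    proof (cases "\<forall>x. N x = 0")
      case True
      have "L v = l *\<^sub>R v" if "v \<in> V" for v
        using True that LV scale N by (intro eqI) (auto simp: A(2) lin\<phi>)
      then show ?thesis
        unfolding homothety_on_def by blast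
    next
      case False
      then obtain x where x: "N x \<noteq> 0"
        by blast
      \<comment> \<open>On an eigenvector \<open>N\<close> acts as the scalar \<open>a - l\<close>,
        whose square has to vanish.\<close>
      have eig: "a = l" if "v \<in> V" "v \<noteq> 0" "L v = a *\<^sub>R v" for a v
      proof (rule ccontr)
        assume "a \<noteq> l"
        have Nv: "N (\<phi> v) = (a - l) *\<^sub>R \<phi> v"
          using A(2)[OF that(1)] that(3) by (simp add: N lin\<phi> algebra_simps)
        have "N (N (\<phi> v)) = (a - l) *\<^sub>R (a - l) *\<^sub>R \<phi> v"
          by (simp only: Nv linear_cmul[OF shifted_linear_square(1)[OF A(1) N_def]])
        then have "\<phi> v = 0"
          using NN[of "\<phi> v"] \<open>a \<noteq> l\<close> Nv by simp
        then show False
          using that eqI[of v 0] V by (simp add: lin\<phi> subspace_0)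
      qed
      obtain v where v: "v \<in> V" "\<phi> v = N x"
        using surj by blast
      have "L v = l *\<^sub>R v"
        using v NN[of x] LV scale N[of "N x"] by (intro eqI) (auto simp: A(2) lin\<phi>)
      moreover have "v \<noteq> 0"
        using v x lin\<phi> by auto
      ultimately have unique: "\<exists>!a. real_eigenvalue_on V L a"
        unfolding real_eigenvalue_on_def using v eig by (intro ex1I[of _ l]) blast+
      have "\<not> diagonalizable_on V L"
      proof
        assume "diagonalizable_on V L"
        then obtain B where B: "B \<subseteq> V" "independent B" "span B = V" "\<And>b. b \<in> B \<Longrightarrow> \<exists>a. L b = a *\<^sub>R b"
          unfolding diagonalizable_on_def by blast
        have "\<phi> b \<in> {y. N y = 0}" if "b \<in> B" for b
        proof -
          have "b \<noteq> 0"
            using B(2) that dependent_zero by blast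
          then have "L b = l *\<^sub>R b"
            using B(4)[OF that] eig that B(1) by blast
          then show ?thesis
            using A(2)[of b] B(1) that by (simp add: N lin\<phi> subset_iff)
        qed
        moreover have "subspace {y. N y = 0}"
          using shifted_linear_square(1)[OF A(1) N_def] by (rule linear_subspace_kernel)
        ultimately have "span (\<phi> ` B) \<subseteq> {y. N y = 0}"
          by (intro span_minimal) auto
        then have "\<phi> ` V \<subseteq> {y. N y = 0}"
          using linear_span_image[OF \<phi>(1), of B] B(3) by simp
        moreover obtain v where "v \<in> V" "\<phi> v = x"
          using surj by blast
        ultimately show False
          using x by auto
      qed
      with unique have "parabolic_on V L"
        by (simp add: parabolic_on_def)
      then show ?thesis
        by blast
    qed
  qed
qed

section \<open>Limits along filters\<close>

text \<open>A tube lemma in which the filter \<open>F\<close> replaces the neighbourhoods in one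
  factor. It is applied to the circle of directions, to the part of the invariant set outside
  \<open>U\<close>, and to the complement of a neighbourhood of a preimage.\<close>

lemma eventually_nhds_compact:
  fixes C :: "'b::topological_space set"
  assumes C: "compact C" and P: "\<And>p. p \<in> C \<Longrightarrow> \<forall>\<^sub>F zq in F \<times>\<^sub>F nhds p. P (fst zq) (snd zq)"
  obtains V where "open V" "C \<subseteq> V" "\<forall>\<^sub>F z in F. \<forall>q\<in>V. P z q"
proof -
  have "\<exists>W. open W \<and> p \<in> W \<and> (\<forall>\<^sub>F z in F. \<forall>q\<in>W. P z q)" if "p \<in> C" for p
  proof -
    obtain Pf Pg where Pfg: "eventually Pf F" "eventually Pg (nhds p)" "\<And>z q. Pf z \<Longrightarrow> Pg q \<Longrightarrow> P z q"
      using P[OF \<open>p \<in> C\<close>] unfolding eventually_prod_filter by auto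
    obtain W where "open W" "p \<in> W" "\<And>q. q \<in> W \<Longrightarrow> Pg q"
      using Pfg(2) unfolding eventually_nhds by blast
    moreover from this Pfg have "\<forall>\<^sub>F z in F. \<forall>q\<in>W. P z q"
      by (auto elim!: eventually_mono)
    ultimately show ?thesis by blast
  qed
  then obtain W where W: "\<And>p. p \<in> C \<Longrightarrow> open (W p) \<and> p \<in> W p \<and> (\<forall>\<^sub>F z in F. \<forall>q\<in>W p. P z q)"
    by metis
  then have "\<And>p. p \<in> C \<Longrightarrow> open (W p)" "C \<subseteq> (\<Union>p\<in>C. W p)"
    by auto
  then obtain D where D: "D \<subseteq> C" "finite D" "C \<subseteq> (\<Union>p\<in>D. W p)"
    by (rule compactE_image[OF C])
  have "\<forall>\<^sub>F z in F. \<forall>p\<in>D. \<forall>q\<in>W p. P z q"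
    using D W by (intro eventually_ball_finite) auto
  then show thesis
    using D W by (intro that[of "\<Union>p\<in>D. W p"]) (auto elim!: eventually_mono)
qed

section \<open>Convergence of linear maps of the plane\<close>

lemma isCont_nhds: "isCont f a \<Longrightarrow> (f \<longlongrightarrow> f a) (nhds a)"
  by (simp only: isCont_def tendsto_at_iff_tendsto_nhds)

text \<open>Convergence in operator norm, written as a pointwise bound so that no linearity of
  \<open>M z\<close> is presupposed.\<close>

definition linear_tendsto :: "'z filter \<Rightarrow> ('z \<Rightarrow> real^2 \<Rightarrow> real^2) \<Rightarrow> (real^2 \<Rightarrow> real^2) \<Rightarrow> bool"
  where "linear_tendsto F M L \<longleftrightarrow> (\<forall>e>0. \<forall>\<^sub>F z in F. \<forall>a. norm (M z a - L a) \<le> e * norm a)"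

lemma linear_tendsto_apply:
  assumes L: "linear L" and M: "linear_tendsto F M L" and a: "(a \<longlongrightarrow> l) F"
  shows "((\<lambda>z. M z (a z)) \<longlongrightarrow> L l) F"
proof -
  have "((\<lambda>z. M z (a z) - L (a z)) \<longlongrightarrow> 0) F"
  proof (rule tendstoI)
    fix e :: real assume "0 < e"
    define k where "k = e / (norm l + 1)"
    have n: "0 < norm l + 1"
      by (simp add: add_nonneg_pos)
    then have "0 < k"
      using \<open>0 < e\<close> by (simp add: k_def)
    then have "\<forall>\<^sub>F z in F. \<forall>a. norm (M z a - L a) \<le> k * norm a"
      using M by (simp add: linear_tendsto_def)
    moreover have "\<forall>\<^sub>F z in F. norm (a z) < norm l + 1"
      using tendsto_norm[OF a] by (rule order_tendstoD) simp
    ultimately show "\<forall>\<^sub>F z in F. dist (M z (a z) - L (a z)) 0 < e"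
    proof eventually_elim
      case (elim z)
      then have "norm (M z (a z) - L (a z)) \<le> k * norm (a z)"
        by blast
      also have "\<dots> < k * (norm l + 1)"
        using elim \<open>0 < k\<close> by simp
      also have "\<dots> = e"
        using n by (simp add: k_def)
      finally show ?case by simp
    qed
  qed
  moreover have "((\<lambda>z. L (a z)) \<longlongrightarrow> L l) F"
    by (rule bounded_linear.tendsto[OF linear_conv_bounded_linear[THEN iffD1, OF L] a])
  ultimately have "((\<lambda>z. (M z (a z) - L (a z)) + L (a z)) \<longlongrightarrow> 0 + L l) F"
    by (rule tendsto_add)
  then show ?thesis
    by simp
qed

text \<open>No bound on \<open>b\<close> is known in advance. An injective \<open>L\<close>
  satisfies a lower bound \<open>m * norm x \<le> norm (L x)\<close>, and this absorbs the error
  made by replacing \<open>M z\<close> with \<open>L\<close> at \<open>b z\<close>. The lemma serves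
  to pass to the limit in inverse derivatives.\<close>

lemma linear_tendsto_solve:
  assumes L: "linear L" "inj L" and M: "linear_tendsto F M L" and lim: "((\<lambda>z. M z (b z)) \<longlongrightarrow> L l) F"
  shows "(b \<longlongrightarrow> l) F"
proof (rule tendstoI)
  fix e :: real assume "0 < e"
  obtain m where m: "m > 0" "\<And>x. m * norm x \<le> norm (L x)"
    using linear_inj_bounded_below_pos[OF L] by blast
  \<comment> \<open>The first bound lets half of \<open>m * norm (b z - l)\<close> absorb the part
    of the error proportional to it; the second keeps the part due to \<open>l\<close> below
    \<open>m * e / 4\<close>.\<close>
  define k where "k = min (m / 2) (m * e / (4 * (norm l + 1)))"
  have n: "0 < norm l + 1"
    by (simp add: add_nonneg_pos)
  have k: "0 < k" "k \<le> m / 2" "k * (norm l + 1) \<le> m * e / 4"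
  proof -
    show "0 < k"
      using m n \<open>0 < e\<close> by (auto simp: k_def)
    show "k \<le> m / 2"
      unfolding k_def by (rule min.cobounded1)
    have cancel: "p / (4 * N) * N = p / 4" if "N \<noteq> 0" for p N :: real
      using that by simp
    have "k * (norm l + 1) \<le> m * e / (4 * (norm l + 1)) * (norm l + 1)"
      using n by (intro mult_right_mono) (auto simp: k_def)
    moreover from n have "m * e / (4 * (norm l + 1)) * (norm l + 1) = m * e / 4"
      by (intro cancel) linarith
    ultimately show "k * (norm l + 1) \<le> m * e / 4"
      by (simp only:)
  qed
  have "\<forall>\<^sub>F z in F. \<forall>a. norm (M z a - L a) \<le> k * norm a"
    using M k by (simp add: linear_tendsto_def)
  moreover have "\<forall>\<^sub>F z in F. dist (M z (b z)) (L l) < m * e / 4"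
    using lim m \<open>0 < e\<close> by (intro tendstoD) auto
  ultimately show "\<forall>\<^sub>F z in F. dist (b z) l < e"
  proof eventually_elim
    case (elim z)
    let ?d = "norm (b z - l)"
    have "m * ?d \<le> norm (L (b z) - L l)"
      using m(2)[of "b z - l"] by (simp add: linear_diff[OF L(1)])
    also have "\<dots> \<le> norm (M z (b z) - L (b z)) + norm (M z (b z) - L l)"
      using norm_triangle_ineq4[of "M z (b z) - L l" "M z (b z) - L (b z)"] by (simp add: add.commute)
    also have "\<dots> \<le> k * norm (b z) + m * e / 4"
      using elim by (intro add_mono) (auto simp: dist_norm)
    also have "norm (b z) \<le> ?d + norm l"
      using norm_triangle_sub[of "b z" l] by simp
    finally have "m * ?d \<le> k * (?d + norm l) + m * e / 4"
      using k(1) by simp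
    also have "\<dots> = k * ?d + k * norm l + m * e / 4"
      by (simp add: algebra_simps)
    also have "k * ?d \<le> m / 2 * ?d"
      using k(2) by (intro mult_right_mono) auto
    also have "k * norm l < m * e / 4"
      using k(1,3) by (simp add: distrib_left)
    finally have "m * ?d < m / 2 * ?d + m * e / 4 + m * e / 4"
      by simp
    then have "m * ?d < m * e"
      by (simp add: algebra_simps)
    then show ?case
      using m(1) by (simp add: dist_norm)
  qed
qed

text \<open>It turns closeness of two linear maps on the standard basis into closeness in operator
  norm.\<close>

lemma linear_plane_bound:
  fixes A :: "real^2 \<Rightarrow> 'b::real_normed_vector"
  assumes "linear A"
  shows "norm (A a) \<le> (norm (A (axis 1 1)) + norm (A (axis 2 1))) * norm a"
proof -
  have "norm (A a) \<le> \<bar>a$1\<bar> * norm (A (axis 1 1)) + \<bar>a$2\<bar> * norm (A (axis 2 1))"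
    unfolding linear_plane_expand[OF assms, of a] by (rule norm_triangle_le) simp
  also have "\<dots> \<le> norm a * norm (A (axis 1 1)) + norm a * norm (A (axis 2 1))"
    using component_le_norm_cart[of a] by (intro add_mono mult_right_mono) auto
  finally show ?thesis
    by (simp add: algebra_simps)
qed

locale riemannian_surface =
  fixes S :: "'m::t2_space surface"
  assumes surface: "compact_riemannian_surface S"
begin

lemma compact_M: "compact (UNIV :: 'm set)"
  and smooth_atlas: "smooth_atlas (charts S)"
  and riemannian: "riemannian_metric S"
  using surface unfolding compact_riemannian_surface_def by blast+

lemma charts_atD: "c \<in> charts_at S x \<Longrightarrow> c \<in> charts S" "c \<in> charts_at S x \<Longrightarrow> x \<in> cdom c"
  by (auto simp: charts_at_def)

lemma charts_at_nonempty: obtains c where "c \<in> charts_at S x"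
  using smooth_atlas by (force simp: smooth_atlas_def charts_at_def)

lemma chartD:
  assumes "c \<in> charts S"
  shows "open (cdom c)" "open (cmap c ` cdom c)"
    and "homeomorphism (cdom c) (cmap c ` cdom c) (cmap c) (cinv c)"
  using assms smooth_atlas unfolding smooth_atlas_def is_chart_def by blast+

lemma cinv_cmap: "c \<in> charts_at S x \<Longrightarrow> cinv c (cmap c x) = x"
  using chartD(3) charts_atD homeomorphism_apply1 by metis

lemma isCont_cmap: "c \<in> charts_at S x \<Longrightarrow> isCont (cmap c) x"
  by (meson chartD(1,3) charts_atD continuous_on_eq_continuous_at homeomorphism_cont1)

lemma isCont_cinv: "c \<in> charts_at S x \<Longrightarrow> isCont (cinv c) (cmap c x)"
  by (meson chartD(2,3) charts_atD continuous_on_eq_continuous_at homeomorphism_cont2 imageI)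

lemma open_cmap_image:
  assumes "c \<in> charts S" "open W" "W \<subseteq> cdom c"
  shows "open (cmap c ` W)"
proof -
  have "openin (top_of_set (cdom c)) W"
    using assms by (simp add: open_openin_trans openin_open_eq chartD(1))
  then have "openin (top_of_set (cmap c ` cdom c)) (cmap c ` W)"
    using homeomorphism_imp_open_map[OF chartD(3)[OF assms(1)]] by blast
  then show ?thesis
    using chartD(2)[OF assms(1)] by (simp add: openin_open_eq)
qed

lemma eventually_in_open:
  assumes "isCont f a" "open W" "f a \<in> W"
  shows "\<forall>\<^sub>F p in nhds a. f p \<in> W"
  using assms unfolding isCont_def tendsto_at_iff_tendsto_nhds by (rule topological_tendstoD)

section \<open>Differentiability in charts\<close>

abbreviation rep :: "'m chart \<Rightarrow> 'm chart \<Rightarrow> ('m \<Rightarrow> 'm) \<Rightarrow> real^2 \<Rightarrow> real^2"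
  where "rep c d f \<equiv> cmap d \<circ> f \<circ> cinv c"

definition chart_deriv :: "'m chart \<Rightarrow> 'm chart \<Rightarrow> ('m \<Rightarrow> 'm) \<Rightarrow> 'm \<Rightarrow> real^2 \<Rightarrow> real^2"
  where "chart_deriv c d f x = frechet_derivative (rep c d f) (at (cmap c x))"

text \<open>Continuity is included because \<open>cmap d\<close> is meaningful only on
  \<open>cdom d\<close>: the chain rule needs points near \<open>x\<close> to be mapped into the
  domain of the intermediate chart.\<close>

definition tdiff :: "('m \<Rightarrow> 'm) \<Rightarrow> 'm \<Rightarrow> bool" where
  "tdiff f x \<longleftrightarrow> isCont f x \<and>
     (\<forall>c\<in>charts_at S x. \<forall>d\<in>charts_at S (f x). rep c d f differentiable (at (cmap c x)))"

lemma chart_deriv_id: "frechet_derivative (cmap d \<circ> cinv c) (at (cmap c x)) = chart_deriv c d id x"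
  by (simp add: chart_deriv_def)

lemma C1_map_imp_tdiff:
  assumes "C1_map S f"
  shows "tdiff f x"
  unfolding tdiff_def
proof (intro conjI ballI)
  show "isCont f x"
    using assms by (simp add: C1_map_def continuous_on_eq_continuous_at)
  fix c d assume cd: "c \<in> charts_at S x" "d \<in> charts_at S (f x)"
  then have "Ck_on 1 (cmap c ` (cdom c \<inter> f -` cdom d)) (rep c d f)"
    using assms charts_atD by (auto simp: C1_map_def)
  moreover have "cmap c x \<in> cmap c ` (cdom c \<inter> f -` cdom d)"
    using cd charts_atD by auto
  ultimately show "rep c d f differentiable (at (cmap c x))"
    by (simp only: One_nat_def Ck_on.simps)
qed

text \<open>The chart expressions of the identity are the transition maps. Changes of coordinates
  thus become instances of \<open>chart_deriv\<close> and fall under the same chain rule as the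
  dynamics.\<close>

lemma C1_map_id: "C1_map S id"
proof -
  have "Ck_on 1 (cmap c ` (cdom c \<inter> cdom d)) (cmap d \<circ> cinv c)" if "c \<in> charts S" "d \<in> charts S" for c d
    using that smooth_atlas unfolding smooth_atlas_def smooth_on_def by blast
  then show ?thesis
    by (simp add: C1_map_def del: Ck_on.simps One_nat_def)
qed

lemma tdiff_id: "tdiff id x"
  by (rule C1_map_imp_tdiff[OF C1_map_id])

lemma rep_has_derivative:
  assumes "tdiff f x" "c \<in> charts_at S x" "d \<in> charts_at S (f x)"
  shows "(rep c d f has_derivative chart_deriv c d f x) (at (cmap c x))"
  using assms by (auto simp: tdiff_def chart_deriv_def frechet_derivative_works)

lemma linear_chart_deriv:
  assumes "tdiff f x" "c \<in> charts_at S x" "d \<in> charts_at S (f x)"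
  shows "linear (chart_deriv c d f x)"
  using rep_has_derivative[OF assms] has_derivative_linear by blast

lemma rep_compose_has_derivative:
  assumes g: "tdiff g x" and f: "tdiff f (g x)"
    and c: "c \<in> charts_at S x" and d: "d \<in> charts_at S (g x)" and e: "e \<in> charts_at S (f (g x))"
  shows "(rep c e (f \<circ> g) has_derivative chart_deriv d e f (g x) \<circ> chart_deriv c d g x) (at (cmap c x))"
proof (rule has_derivative_transform_eventually)
  have "rep c d g (cmap c x) = cmap d (g x)"
    using c by (simp add: cinv_cmap)
  then show "(rep d e f \<circ> rep c d g has_derivative chart_deriv d e f (g x) \<circ> chart_deriv c d g x) (at (cmap c x))"
    using rep_has_derivative[OF g c d] rep_has_derivative[OF f d e] by (intro diff_chain_at) simp_all
  have "isCont (g \<circ> cinv c) (cmap c x)"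
    unfolding comp_def by (rule isCont_o2[OF isCont_cinv[OF c]]) (use g c in \<open>simp add: tdiff_def cinv_cmap\<close>)
  then have "\<forall>\<^sub>F p in nhds (cmap c x). (g \<circ> cinv c) p \<in> cdom d"
    using d c by (intro eventually_in_open) (simp_all add: cinv_cmap chartD charts_atD del: comp_apply add: comp_apply[of g "cinv c" "cmap c x"])
  then have "\<forall>\<^sub>F p in nhds (cmap c x). (rep d e f \<circ> rep c d g) p = rep c e (f \<circ> g) p"
    by eventually_elim (use d in \<open>auto simp: cinv_cmap charts_at_def\<close>)
  then show "\<forall>\<^sub>F p in at (cmap c x). (rep d e f \<circ> rep c d g) p = rep c e (f \<circ> g) p"
    by (rule eventually_nhds_conv_at[THEN iffD1, THEN conjunct1])
  show "(rep d e f \<circ> rep c d g) (cmap c x) = rep c e (f \<circ> g) (cmap c x)"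
    using c d by (simp add: cinv_cmap)
qed simp

lemma tdiff_compose:
  assumes "tdiff g x" "tdiff f (g x)"
  shows "tdiff (f \<circ> g) x"
  unfolding tdiff_def
proof (intro conjI ballI)
  show "isCont (f \<circ> g) x"
    using assms unfolding comp_def by (auto simp: tdiff_def intro: isCont_o2)
  fix c e assume "c \<in> charts_at S x" "e \<in> charts_at S ((f \<circ> g) x)"
  moreover obtain d where "d \<in> charts_at S (g x)"
    using charts_at_nonempty .
  ultimately show "rep c e (f \<circ> g) differentiable at (cmap c x)"
    using rep_compose_has_derivative[OF assms] unfolding differentiable_def by fastforce
qed

lemma chart_deriv_compose:
  assumes "tdiff g x" "tdiff f (g x)"
    and "c \<in> charts_at S x" "d \<in> charts_at S (g x)" "e \<in> charts_at S (f (g x))"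
  shows "chart_deriv c e (f \<circ> g) x a = chart_deriv d e f (g x) (chart_deriv c d g x a)"
  using frechet_derivative_at[OF rep_compose_has_derivative[OF assms]]
  by (simp add: chart_deriv_def[of c e] fun_eq_iff)

lemma chart_deriv_id_same:
  assumes "c \<in> charts_at S x"
  shows "chart_deriv c c id x a = a"
proof -
  have "(rep c c id has_derivative id) (at (cmap c x))"
  proof (rule has_derivative_transform_eventually)
    show "(id has_derivative id) (at (cmap c x))"
      by (simp add: id_def)
    have "\<forall>\<^sub>F p in nhds (cmap c x). p \<in> cmap c ` cdom c"
      using assms by (intro eventually_nhds_in_open) (auto simp: chartD charts_atD)
    then have "\<forall>\<^sub>F p in nhds (cmap c x). id p = rep c c id p"
      by eventually_elim (use assms in \<open>auto simp: cinv_cmap charts_at_def\<close>)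
    then show "\<forall>\<^sub>F p in at (cmap c x). id p = rep c c id p"
      by (rule eventually_nhds_conv_at[THEN iffD1, THEN conjunct1])
  qed (use assms in \<open>auto simp: cinv_cmap\<close>)
  then show ?thesis
    using frechet_derivative_at unfolding chart_deriv_def by fastforce
qed

lemma chart_deriv_id_trans:
  assumes "c \<in> charts_at S x" "d \<in> charts_at S x" "e \<in> charts_at S x"
  shows "chart_deriv d e id x (chart_deriv c d id x a) = chart_deriv c e id x a"
  using chart_deriv_compose[of id x id c d e a] assms tdiff_id by simp

section \<open>Tangent spaces and tangent maps\<close>

lemma tangent_spaceD:
  assumes "v \<in> tangent_space S x" "c \<in> charts_at S x" "d \<in> charts_at S x"
  shows "v d = chart_deriv c d id x (v c)"
  using assms unfolding tangent_space_def chart_deriv_id by blast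

lemma tangent_space_outside: "v \<in> tangent_space S x \<Longrightarrow> c \<notin> charts_at S x \<Longrightarrow> v c = 0"
  by (auto simp: tangent_space_def)

lemma tangent_spaceI:
  assumes "\<And>c. c \<notin> charts_at S x \<Longrightarrow> v c = 0"
    and "\<And>c d. c \<in> charts_at S x \<Longrightarrow> d \<in> charts_at S x \<Longrightarrow> v d = chart_deriv c d id x (v c)"
  shows "v \<in> tangent_space S x"
  using assms unfolding tangent_space_def chart_deriv_id by blast

lemma linear_transition:
  "c \<in> charts_at S x \<Longrightarrow> d \<in> charts_at S x \<Longrightarrow> linear (chart_deriv c d id x)"
  by (rule linear_chart_deriv) (auto simp: tdiff_id)

text \<open>The transition derivatives determine all coordinate expressions from one of them, so
  every identity between tangent vectors can be checked in a single chart.\<close>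

lemma tangent_space_eqI:
  assumes "u \<in> tangent_space S x" "v \<in> tangent_space S x" "c \<in> charts_at S x" "u c = v c"
  shows "u = v"
proof
  fix d
  show "u d = v d"
    using tangent_spaceD[OF assms(1,3), of d] tangent_spaceD[OF assms(2,3), of d] assms(4)
      tangent_space_outside[OF assms(1), of d] tangent_space_outside[OF assms(2), of d]
    by (cases "d \<in> charts_at S x") auto
qed

lemma subspace_tangent_space: "subspace (tangent_space S x)"
  unfolding subspace_def
proof (intro conjI ballI allI)
  show "0 \<in> tangent_space S x"
    using linear_transition by (intro tangent_spaceI) (auto simp: linear_0)
  show "u + v \<in> tangent_space S x" if uv: "u \<in> tangent_space S x" "v \<in> tangent_space S x" for u v
  proof (rule tangent_spaceI)
    show "(u + v) d = chart_deriv c d id x ((u + v) c)"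
      if c: "c \<in> charts_at S x" and d: "d \<in> charts_at S x" for c d
      using tangent_spaceD[OF uv(1) c d] tangent_spaceD[OF uv(2) c d] linear_add[OF linear_transition[OF c d]]
      by simp
  qed (simp add: uv[THEN tangent_space_outside])
  show "a *\<^sub>R u \<in> tangent_space S x" if u: "u \<in> tangent_space S x" for a u
  proof (rule tangent_spaceI)
    show "(a *\<^sub>R u) d = chart_deriv c d id x ((a *\<^sub>R u) c)"
      if c: "c \<in> charts_at S x" and d: "d \<in> charts_at S x" for c d
      using tangent_spaceD[OF u c d] linear_cmul[OF linear_transition[OF c d]] by (simp add: scaleR_fun_def)
  qed (simp add: u[THEN tangent_space_outside] scaleR_fun_def)
qed

lemma tangent_lincomb:
  "u \<in> tangent_space S x \<Longrightarrow> v \<in> tangent_space S x \<Longrightarrow> a *\<^sub>R u + b *\<^sub>R v \<in> tangent_space S x"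
  by (meson subspace_tangent_space subspace_add subspace_scale)

lemma lincomb_nth: "(a *\<^sub>R u + b *\<^sub>R v) c = a *\<^sub>R u c + b *\<^sub>R (v c :: real^2)"
  by (simp add: scaleR_fun_def)

lemma coord_vector_nth:
  "d \<in> charts_at S x \<Longrightarrow> coord_vector S c x a d = chart_deriv c d id x a"
  by (simp add: coord_vector_def chart_deriv_id)

lemma coord_vector_same: "c \<in> charts_at S x \<Longrightarrow> coord_vector S c x a c = a"
  by (simp add: coord_vector_nth chart_deriv_id_same)

lemma coord_vector_in:
  assumes "c \<in> charts_at S x"
  shows "coord_vector S c x a \<in> tangent_space S x"
proof (rule tangent_spaceI)
  show "coord_vector S c x a d = 0" if "d \<notin> charts_at S x" for d
    using that by (simp add: coord_vector_def)
  show "coord_vector S c x a e = chart_deriv d e id x (coord_vector S c x a d)"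
    if "d \<in> charts_at S x" "e \<in> charts_at S x" for d e
    using that chart_deriv_id_trans[OF assms that] by (simp add: coord_vector_nth)
qed

lemma coord_vector_nth_same:
  assumes "v \<in> tangent_space S x" "c \<in> charts_at S x"
  shows "coord_vector S c x (v c) = v"
  by (rule tangent_space_eqI[OF coord_vector_in assms(1) assms(2)])
    (simp_all add: coord_vector_same assms)

lemma coord_vector_lincomb:
  assumes "c \<in> charts_at S x"
  shows "coord_vector S c x (a *\<^sub>R p + b *\<^sub>R q) = a *\<^sub>R coord_vector S c x p + b *\<^sub>R coord_vector S c x q"
  by (rule tangent_space_eqI[OF coord_vector_in tangent_lincomb[OF coord_vector_in coord_vector_in] assms])
    (simp_all add: coord_vector_same scaleR_fun_def assms)

lemma bij_betw_tangent_nth: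
  assumes "c \<in> charts_at S x"
  shows "bij_betw (\<lambda>v. v c) (tangent_space S x) UNIV"
proof (rule bij_betw_byWitness[of _ "coord_vector S c x"])
  show "\<forall>v\<in>tangent_space S x. coord_vector S c x (v c) = v"
    using coord_vector_nth_same[OF _ assms] by (intro ballI)
  show "\<forall>a\<in>UNIV. coord_vector S c x a c = a"
    using coord_vector_same[OF assms] by (intro ballI)
  show "coord_vector S c x ` UNIV \<subseteq> tangent_space S x"
    using coord_vector_in[OF assms] by (intro image_subsetI)
qed (rule subset_UNIV)

lemma linear_nth: "linear (\<lambda>v :: 'm tvec. v c)"
  by (rule linearI) (simp_all add: scaleR_fun_def)

lemma tangent_map_outside: "d \<notin> charts_at S (f x) \<Longrightarrow> tangent_map S f x v d = 0"
  by (simp add: tangent_map_def Let_def)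

text \<open>The chart picked by \<open>SOME\<close> does not matter: by the chain rule, passing to
  it and differentiating there is the same as differentiating in \<open>c\<close>.\<close>

lemma tangent_map_nth:
  assumes "tdiff f x" "v \<in> tangent_space S x" "c \<in> charts_at S x" "d \<in> charts_at S (f x)"
  shows "tangent_map S f x v d = chart_deriv c d f x (v c)"
proof -
  define c' where "c' = (SOME c. c \<in> charts_at S x)"
  have c': "c' \<in> charts_at S x"
    unfolding c'_def using assms(3) by (rule someI)
  have "tangent_map S f x v d = chart_deriv c' d f x (v c')"
    using assms(4) by (simp add: tangent_map_def c'_def chart_deriv_def Let_def)
  also have "\<dots> = chart_deriv c' d f x (chart_deriv c c' id x (v c))"
    using tangent_spaceD[OF assms(2,3) c'] by simp
  also have "\<dots> = chart_deriv c d f x (v c)"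
    using chart_deriv_compose[of id x f c c' d "v c"] assms c' tdiff_id by simp
  finally show ?thesis .
qed

lemma tangent_map_in:
  assumes "tdiff f x" "v \<in> tangent_space S x"
  shows "tangent_map S f x v \<in> tangent_space S (f x)"
proof (rule tangent_spaceI)
  obtain b where b: "b \<in> charts_at S x"
    using charts_at_nonempty .
  show "tangent_map S f x v d = chart_deriv c d id (f x) (tangent_map S f x v c)"
    if "c \<in> charts_at S (f x)" "d \<in> charts_at S (f x)" for c d
    using that assms b tdiff_id chart_deriv_compose[of f x id b c d "v b"]
    by (simp add: tangent_map_nth[OF _ _ b])
qed (simp add: tangent_map_outside)

lemma tangent_map_compose:
  assumes "tdiff g x" "tdiff f (g x)" "v \<in> tangent_space S x"
  shows "tangent_map S (f \<circ> g) x v = tangent_map S f (g x) (tangent_map S g x v)"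
proof -
  obtain c d e where c: "c \<in> charts_at S x" and d: "d \<in> charts_at S (g x)" and e: "e \<in> charts_at S (f (g x))"
    using charts_at_nonempty by metis
  note tdiff = assms(1,2) tdiff_compose[OF assms(1,2)]
  have in1: "tangent_map S g x v \<in> tangent_space S (g x)"
    using tangent_map_in tdiff assms by blast
  have "tangent_map S (f \<circ> g) x v e = tangent_map S f (g x) (tangent_map S g x v) e"
    using tangent_map_nth[OF tdiff(3) assms(3) c] tangent_map_nth[OF tdiff(2) in1 d e]
      tangent_map_nth[OF tdiff(1) assms(3) c d] chart_deriv_compose[OF tdiff(1,2) c d e] e
    by simp
  moreover have "tangent_map S (f \<circ> g) x v \<in> tangent_space S (f (g x))"
    using tangent_map_in[OF tdiff(3) assms(3)] by simp
  ultimately show ?thesis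
    using tangent_space_eqI tangent_map_in[OF tdiff(2) in1] e by blast
qed

lemma tangent_map_id:
  assumes "v \<in> tangent_space S x"
  shows "tangent_map S id x v = v"
proof -
  obtain c where c: "c \<in> charts_at S x"
    using charts_at_nonempty .
  have "tangent_map S id x v c = v c"
    using tangent_map_nth[OF tdiff_id assms c, of c] c by (simp add: chart_deriv_id_same)
  then show ?thesis
    using tangent_space_eqI[OF _ assms c] tangent_map_in[OF tdiff_id assms] by simp
qed

lemma tangent_map_lincomb:
  assumes f: "tdiff f x" and u: "u \<in> tangent_space S x" and v: "v \<in> tangent_space S x"
  shows "tangent_map S f x (a *\<^sub>R u + b *\<^sub>R v) = a *\<^sub>R tangent_map S f x u + b *\<^sub>R tangent_map S f x v"
proof -
  obtain c d where c: "c \<in> charts_at S x" and d: "d \<in> charts_at S (f x)"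
    using charts_at_nonempty by metis
  note lin = linear_chart_deriv[OF f c d]
  have "tangent_map S f x (a *\<^sub>R u + b *\<^sub>R v) d = (a *\<^sub>R tangent_map S f x u + b *\<^sub>R tangent_map S f x v) d"
    unfolding tangent_map_nth[OF f tangent_lincomb[OF u v] c d] lincomb_nth
      tangent_map_nth[OF f u c d] tangent_map_nth[OF f v c d]
    by (simp add: linear_add[OF lin] linear_cmul[OF lin])
  then show ?thesis
    by (rule tangent_space_eqI[OF tangent_map_in[OF f tangent_lincomb[OF u v]]
        tangent_lincomb[OF tangent_map_in[OF f u] tangent_map_in[OF f v]] d])
qed


section \<open>The metric and Gram determinants\<close>

lemma metric_inner_product: "inner_product_on (tangent_space S x) (metric S x)"
  using riemannian by (simp add: riemannian_metric_def)

lemma metric_sym: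
  assumes "u \<in> tangent_space S x" "w \<in> tangent_space S x"
  shows "metric S x u w = metric S x w u"
  using metric_inner_product[of x, unfolded inner_product_on_def, THEN conjunct1, rule_format, OF assms] .

lemma metric_lincomb_left:
  assumes "u \<in> tangent_space S x" "v \<in> tangent_space S x" "w \<in> tangent_space S x"
  shows "metric S x (a *\<^sub>R u + b *\<^sub>R v) w = a * metric S x u w + b * metric S x v w"
  using metric_inner_product[of x, unfolded inner_product_on_def, THEN conjunct2, THEN conjunct1, rule_format, OF assms] .

lemma metric_lincomb_right:
  assumes "u \<in> tangent_space S x" "v \<in> tangent_space S x" "w \<in> tangent_space S x"
  shows "metric S x w (a *\<^sub>R u + b *\<^sub>R v) = a * metric S x w u + b * metric S x w v"
  using metric_lincomb_left[OF assms] metric_sym[OF assms(3) tangent_lincomb[OF assms(1,2)]]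
    metric_sym[OF assms(3,1)] metric_sym[OF assms(3,2)] by simp

lemma metric_pos:
  assumes "u \<in> tangent_space S x" "u \<noteq> 0"
  shows "0 < metric S x u u"
  using metric_inner_product[of x, unfolded inner_product_on_def, THEN conjunct2, THEN conjunct2, rule_format, OF assms] .

lemma metric_zero_left: "w \<in> tangent_space S x \<Longrightarrow> metric S x 0 w = 0"
  using metric_lincomb_left[of 0 x 0 w 0 0] subspace_0[OF subspace_tangent_space] by simp

lemma metric_scale:
  assumes "u \<in> tangent_space S x" "w \<in> tangent_space S x"
  shows "metric S x (a *\<^sub>R u) (b *\<^sub>R w) = a * b * metric S x u w"
proof -
  have "b *\<^sub>R w \<in> tangent_space S x"
    using assms subspace_tangent_space by (simp add: subspace_scale)
  then show ?thesis
    using metric_lincomb_left[of u x u "b *\<^sub>R w" a 0] metric_lincomb_right[of w x w u b 0] assms by simp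
qed

lemma tangent_scale: "u \<in> tangent_space S x \<Longrightarrow> a *\<^sub>R u \<in> tangent_space S x"
  using subspace_tangent_space by (simp add: subspace_scale)

definition metric_form :: "'m chart \<Rightarrow> 'm \<Rightarrow> real^2 \<Rightarrow> real^2 \<Rightarrow> real"
  where "metric_form c x a b = metric S x (coord_vector S c x a) (coord_vector S c x b)"

lemma metric_eq_form:
  "u \<in> tangent_space S x \<Longrightarrow> w \<in> tangent_space S x \<Longrightarrow> c \<in> charts_at S x \<Longrightarrow>
    metric S x u w = metric_form c x (u c) (w c)"
  unfolding metric_form_def by (metis coord_vector_nth_same)

lemma metric_form:
  assumes "c \<in> charts_at S x"
  shows "linear (\<lambda>a. metric_form c x a b)" "metric_form c x a b = metric_form c x b a"
    and "a \<noteq> 0 \<Longrightarrow> 0 < metric_form c x a a"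
proof -
  note cin = coord_vector_in[OF assms]
  show "linear (\<lambda>a. metric_form c x a b)"
  proof (rule linearI)
    show "metric_form c x (p + q) b = metric_form c x p b + metric_form c x q b" for p q
      using metric_lincomb_left[OF cin cin cin, of 1 p 1 q b] coord_vector_lincomb[OF assms, of 1 p 1 q]
      by (simp add: metric_form_def)
    show "metric_form c x (r *\<^sub>R p) b = r *\<^sub>R metric_form c x p b" for r p
      using metric_lincomb_left[OF cin cin cin, of r p 0 p b] coord_vector_lincomb[OF assms, of r p 0 p]
      by (simp add: metric_form_def)
  qed
  show "metric_form c x a b = metric_form c x b a"
    unfolding metric_form_def by (rule metric_sym[OF cin cin])
  assume "a \<noteq> 0"
  then have "coord_vector S c x a \<noteq> 0"
    using coord_vector_same[OF assms, of a] by (metis zero_fun_apply)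
  then show "0 < metric_form c x a a"
    unfolding metric_form_def by (rule metric_pos[OF cin])
qed

text \<open>The squared area of the parallelogram spanned by \<open>u\<close> and
  \<open>w\<close>.\<close>

definition gram :: "'m \<Rightarrow> 'm tvec \<Rightarrow> 'm tvec \<Rightarrow> real"
  where "gram x u w = metric S x u u * metric S x w w - (metric S x u w)\<^sup>2"

text \<open>The determinant of the metric matrix in the chart, that is, the square of the Riemannian
  area density.\<close>

definition gram_density :: "'m chart \<Rightarrow> 'm \<Rightarrow> real" where
  "gram_density c x = metric_form c x (axis 1 1) (axis 1 1) * metric_form c x (axis 2 1) (axis 2 1)
     - (metric_form c x (axis 1 1) (axis 2 1))\<^sup>2"

lemma gram_eq:
  assumes "u \<in> tangent_space S x" "w \<in> tangent_space S x" "c \<in> charts_at S x"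
  shows "gram x u w = gram_density c x * (cross (u c) (w c))\<^sup>2"
  unfolding gram_def gram_density_def metric_eq_form[OF assms(1,1,3)] metric_eq_form[OF assms(1,2,3)]
    metric_eq_form[OF assms(2,2,3)]
  by (rule gram_bilinear[OF metric_form(1,2)[OF assms(3)]])

lemma gram_density_pos: "c \<in> charts_at S x \<Longrightarrow> 0 < gram_density c x"
  unfolding gram_density_def by (rule gram_bilinear_pos[OF metric_form])

lemma gram_nonneg: "u \<in> tangent_space S x \<Longrightarrow> w \<in> tangent_space S x \<Longrightarrow> 0 \<le> gram x u w"
  using gram_eq gram_density_pos charts_at_nonempty
  by (metis less_imp_le mult_nonneg_nonneg zero_le_power2)

lemma gram_pos_iff:
  assumes "u \<in> tangent_space S x" "w \<in> tangent_space S x" "c \<in> charts_at S x"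
  shows "0 < gram x u w \<longleftrightarrow> cross (u c) (w c) \<noteq> 0"
  using gram_eq[OF assms] gram_density_pos[OF assms(3)] by (simp add: zero_less_mult_iff)

lemma gram_tangent_map:
  assumes f: "tdiff f x" and uw: "u \<in> tangent_space S x" "w \<in> tangent_space S x"
    and c: "c \<in> charts_at S x" and d: "d \<in> charts_at S (f x)"
  shows "gram (f x) (tangent_map S f x u) (tangent_map S f x w) =
    gram_density d (f x) / gram_density c x * (det2 (chart_deriv c d f x))\<^sup>2 * gram x u w"
  using gram_density_pos[OF c]
  unfolding gram_eq[OF uw c] gram_eq[OF tangent_map_in[OF f uw(1)] tangent_map_in[OF f uw(2)] d]
    tangent_map_nth[OF f uw(1) c d] tangent_map_nth[OF f uw(2) c d] cross_linear[OF linear_chart_deriv[OF f c d]]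
  by (simp add: power_mult_distrib)

text \<open>The factor \<open>J\<close> does not depend on the pair \<open>u\<close>,
  \<open>w\<close>. This is the only information about the determinant that the formula for the
  projective cocycle uses.\<close>

lemma gram_scaling:
  assumes "tdiff f x"
  obtains J where "0 \<le> J" "\<And>u w. u \<in> tangent_space S x \<Longrightarrow> w \<in> tangent_space S x \<Longrightarrow>
    gram (f x) (tangent_map S f x u) (tangent_map S f x w) = J * gram x u w"
proof -
  obtain c d where c: "c \<in> charts_at S x" and d: "d \<in> charts_at S (f x)"
    using charts_at_nonempty by metis
  show thesis
  proof (rule that[of "gram_density d (f x) / gram_density c x * (det2 (chart_deriv c d f x))\<^sup>2"])
    show "0 \<le> gram_density d (f x) / gram_density c x * (det2 (chart_deriv c d f x))\<^sup>2"
      using gram_density_pos[OF c] gram_density_pos[OF d] by simp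
  qed (rule gram_tangent_map[OF assms _ _ c d])
qed

lemma orthonormal_coordinates:
  obtains \<Phi> :: "real^2 \<Rightarrow> 'm tvec"
  where "\<And>a. \<Phi> a \<in> tangent_space S x" "\<And>a b. metric S x (\<Phi> a) (\<Phi> b) = a \<bullet> b"
    and "\<And>v. v \<in> tangent_space S x \<Longrightarrow> \<exists>a. v = \<Phi> a"
proof -
  obtain c where c: "c \<in> charts_at S x"
    using charts_at_nonempty .
  obtain P :: "real^2 \<Rightarrow> real^2" where P: "linear P" "bij P" "\<And>a b. P a \<bullet> P b = metric_form c x a b"
    using bilinear_form_isometry[OF metric_form(1)[OF c] metric_form(2)[OF c] metric_form(3)[OF c]] by blast
  have inv: "P (inv P a) = a" "inv P (P a) = a" for a
    using P(2) by (simp_all add: bij_is_inj bij_is_surj surj_f_inv_f)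
  show thesis
  proof (rule that[of "\<lambda>a. coord_vector S c x (inv P a)"])
    show "metric S x (coord_vector S c x (inv P a)) (coord_vector S c x (inv P b)) = a \<bullet> b" for a b
      using P(3)[of "inv P a" "inv P b"] by (simp add: metric_form_def inv)
    show "\<exists>a. v = coord_vector S c x (inv P a)" if "v \<in> tangent_space S x" for v
      using coord_vector_nth_same[OF that c] inv(2) by metis
  qed (rule coord_vector_in[OF c])
qed

lemma unit_tangent_iff:
  "v \<in> unit_tangent_space S x \<longleftrightarrow> v \<in> tangent_space S x \<and> metric S x v v = 1"
  unfolding unit_tangent_space_def tnorm_def by auto

lemma orthogonal_unit_vector:
  assumes "v \<in> unit_tangent_space S x"
  obtains w where "w \<in> unit_tangent_space S x" "metric S x v w = 0"
proof -
  obtain \<Phi> :: "real^2 \<Rightarrow> 'm tvec" where \<Phi>: "\<And>a. \<Phi> a \<in> tangent_space S x" "\<And>a b. metric S x (\<Phi> a) (\<Phi> b) = a \<bullet> b"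
    "\<And>v. v \<in> tangent_space S x \<Longrightarrow> \<exists>a. v = \<Phi> a"
    by (rule orthonormal_coordinates[of x]) blast
  obtain a where a: "v = \<Phi> a"
    using \<Phi>(3) assms by (auto simp: unit_tangent_iff)
  have "a \<bullet> a = 1"
    using assms by (simp add: unit_tangent_iff a \<Phi>(2))
  then show thesis
    by (intro that[of "\<Phi> (vector [- (a$2), a$1])"])
      (simp_all add: a unit_tangent_iff \<Phi>(1,2) inner_vec_def sum_2 algebra_simps)
qed

section \<open>Orthonormal frames and the determinant of the tangent map\<close>

lemma orthonormal_frame_exists: "\<exists>e. orthonormal_frame S x e"
proof -
  obtain \<Phi> :: "real^2 \<Rightarrow> 'm tvec" where \<Phi>: "\<And>a. \<Phi> a \<in> tangent_space S x" "\<And>a b. metric S x (\<Phi> a) (\<Phi> b) = a \<bullet> b"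
    "\<And>v. v \<in> tangent_space S x \<Longrightarrow> \<exists>a. v = \<Phi> a"
    by (rule orthonormal_coordinates[of x]) blast
  have "orthonormal_frame S x (\<lambda>i. \<Phi> (axis i 1))"
    by (auto simp: orthonormal_frame_def \<Phi> inner_axis_axis)
  then show ?thesis by blast
qed

lemma orthonormal_frame_gram: "orthonormal_frame S x e \<Longrightarrow> gram x (e 1) (e 2) = 1"
  by (simp add: orthonormal_frame_def gram_def)

text \<open>In orthonormal coordinates the matrix with entries \<open>a\<^sub>i \<bullet> b\<^sub>j\<close> is a product, so its
  determinant is the product of the two cross products.\<close>

lemma frame_matrix_det:
  assumes e: "orthonormal_frame S x e" and uw: "u 1 \<in> tangent_space S x" "u 2 \<in> tangent_space S x"
  shows "(det ((\<chi> i j. metric S x (e i) (u j)) :: real^2^2))\<^sup>2 = gram x (u 1) (u 2)"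
proof -
  obtain \<Phi> :: "real^2 \<Rightarrow> 'm tvec" where \<Phi>: "\<And>a. \<Phi> a \<in> tangent_space S x" "\<And>a b. metric S x (\<Phi> a) (\<Phi> b) = a \<bullet> b"
    "\<And>v. v \<in> tangent_space S x \<Longrightarrow> \<exists>a. v = \<Phi> a"
    by (rule orthonormal_coordinates[of x]) blast
  obtain a1 a2 b1 b2 where ab: "e 1 = \<Phi> a1" "e 2 = \<Phi> a2" "u 1 = \<Phi> b1" "u 2 = \<Phi> b2"
    using \<Phi>(3) uw e unfolding orthonormal_frame_def by metis
  have "det ((\<chi> i j. metric S x (e i) (u j)) :: real^2^2) = cross a1 a2 * cross b1 b2"
    by (simp add: det_2 ab \<Phi>(2) cross_def inner_vec_def sum_2 algebra_simps)
  moreover have "(cross a1 a2)\<^sup>2 = gram x (e 1) (e 2)" "(cross b1 b2)\<^sup>2 = gram x (u 1) (u 2)"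
    by (simp_all add: gram_def ab \<Phi>(2) lagrange_identity_plane)
  ultimately show ?thesis
    using orthonormal_frame_gram[OF e] by (simp add: power_mult_distrib)
qed

text \<open>The squared determinant in any two orthonormal frames is the factor by which squared
  areas are multiplied. It is therefore independent of the frames, and the definite description
  denotes its root.\<close>

lemma abs_det_gram:
  assumes f: "tdiff f x"
  shows "0 \<le> abs_det S f x"
    and "u \<in> tangent_space S x \<Longrightarrow> w \<in> tangent_space S x \<Longrightarrow>
      gram (f x) (tangent_map S f x u) (tangent_map S f x w) = (abs_det S f x)\<^sup>2 * gram x u w"
proof -
  obtain J where J: "0 \<le> J" "\<And>u w. u \<in> tangent_space S x \<Longrightarrow> w \<in> tangent_space S x \<Longrightarrow>
    gram (f x) (tangent_map S f x u) (tangent_map S f x w) = J * gram x u w"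
    using gram_scaling[OF f] by blast
  have det: "\<bar>det ((\<chi> i j. metric S (f x) (e' i) (tangent_map S f x (e j))) :: real^2^2)\<bar> = sqrt J"
    if e: "orthonormal_frame S x e" and e': "orthonormal_frame S (f x) e'" for e e'
  proof -
    have ein: "e i \<in> tangent_space S x" for i
      using e by (simp add: orthonormal_frame_def)
    have "(det ((\<chi> i j. metric S (f x) (e' i) (tangent_map S f x (e j))) :: real^2^2))\<^sup>2 = J"
      using frame_matrix_det[OF e', of "\<lambda>j. tangent_map S f x (e j)"] tangent_map_in[OF f ein] J(2)[OF ein ein]
        orthonormal_frame_gram[OF e] by simp
    then show ?thesis
      by (metis real_sqrt_abs)
  qed
  \<comment> \<open>Uniqueness of the described number requires that frames exist; otherwise its
    condition would hold for every number.\<close>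
  obtain e e' where "orthonormal_frame S x e" "orthonormal_frame S (f x) e'"
    using orthonormal_frame_exists by metis
  then have "abs_det S f x = sqrt J"
    unfolding abs_det_def using det by (intro the_equality) auto
  with J show "0 \<le> abs_det S f x" "u \<in> tangent_space S x \<Longrightarrow> w \<in> tangent_space S x \<Longrightarrow>
      gram (f x) (tangent_map S f x u) (tangent_map S f x w) = (abs_det S f x)\<^sup>2 * gram x u w"
    by simp_all
qed

section \<open>Diffeomorphisms and their action on unit tangent vectors\<close>

text \<open>Everything at a fixed map is pointwise, so differentiability suffices there; closure
  under composition then follows from the chain rule, with no continuity of derivatives to carry
  along.\<close>

definition diffeo :: "('m \<Rightarrow> 'm) \<Rightarrow> bool"
  where "diffeo f \<longleftrightarrow> bij f \<and> (\<forall>x. tdiff f x) \<and> (\<forall>x. tdiff (inv f) x)"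

lemma diffeo_Diff1: "f \<in> Diff1 S \<Longrightarrow> diffeo f"
  by (simp add: Diff1_def diffeo_def C1_map_imp_tdiff)

lemma diffeo_tdiff: "diffeo f \<Longrightarrow> tdiff f x"
  by (simp add: diffeo_def)

lemma diffeo_inv: "diffeo f \<Longrightarrow> diffeo (inv f)"
  by (simp add: diffeo_def bij_imp_bij_inv inv_inv_eq)

lemma diffeo_id: "diffeo id"
  by (simp add: diffeo_def tdiff_id)

lemma diffeo_compose: "diffeo f \<Longrightarrow> diffeo g \<Longrightarrow> diffeo (f \<circ> g)"
  unfolding diffeo_def by (auto simp: bij_comp o_inv_distrib intro: tdiff_compose)

lemma diffeo_funpow: "diffeo f \<Longrightarrow> diffeo (f ^^ n)"
  by (induction n) (auto simp: diffeo_id diffeo_compose)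

lemma int_iterate_UNIV: "int_iterate UNIV f n = (if 0 \<le> n then f ^^ nat n else inv f ^^ nat (- n))"
  by (simp add: int_iterate_def)

lemma diffeo_int_iterate: "diffeo f \<Longrightarrow> diffeo (int_iterate UNIV f n)"
  by (simp add: int_iterate_UNIV diffeo_funpow diffeo_inv)

lemma diffeo_comp_inv:
  assumes "diffeo f"
  shows "inv f \<circ> f = id" "f \<circ> inv f = id"
  using assms by (auto simp: diffeo_def bij_is_inj bij_is_surj surj_f_inv_f fun_eq_iff)

lemma int_iterate_neg:
  assumes "diffeo f"
  shows "int_iterate UNIV f (- n) \<circ> int_iterate UNIV f n = id"
proof -
  have "(h ^^ k) ((g ^^ k) x) = x" if "\<And>x. h (g x) = x" for h g :: "'m \<Rightarrow> 'm" and k x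
  proof (induction k arbitrary: x)
    case (Suc k)
    then show ?case
      using that by (simp add: funpow_swap1)
  qed simp
  moreover have "inv f (f x) = x" "f (inv f x) = x" for x
    using diffeo_comp_inv[OF assms] by (simp_all add: fun_eq_iff)
  ultimately show ?thesis
    by (auto simp: int_iterate_UNIV fun_eq_iff)
qed

lemma tangent_map_inverse:
  assumes "diffeo f" "diffeo g" "g \<circ> f = id" "v \<in> tangent_space S x"
  shows "tangent_map S g (f x) (tangent_map S f x v) = v"
  using tangent_map_compose[of f x g v] assms by (simp add: diffeo_tdiff tangent_map_id)

lemma tangent_map_zero:
  assumes "tdiff f x"
  shows "tangent_map S f x 0 = 0"
  using tangent_map_lincomb[OF assms, of 0 0 0 0] subspace_0[OF subspace_tangent_space] by simp

lemma tangent_map_nonzero: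
  assumes "diffeo f" "v \<in> tangent_space S x" "v \<noteq> 0"
  shows "tangent_map S f x v \<noteq> 0"
  using tangent_map_inverse[OF assms(1) diffeo_inv[OF assms(1)] diffeo_comp_inv(1)[OF assms(1)] assms(2)]
    tangent_map_zero[OF diffeo_tdiff[OF diffeo_inv[OF assms(1)]]] assms(3) by metis

text \<open>The inverse map scales areas by a finite factor as well, so it would send a degenerate
  image back to a degenerate pair.\<close>

lemma gram_tangent_map_pos:
  assumes f: "diffeo f" and uw: "u \<in> tangent_space S x" "w \<in> tangent_space S x" and "0 < gram x u w"
  shows "0 < gram (f x) (tangent_map S f x u) (tangent_map S f x w)"
proof -
  obtain J where J: "\<And>u w. u \<in> tangent_space S (f x) \<Longrightarrow> w \<in> tangent_space S (f x) \<Longrightarrow>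
    gram (inv f (f x)) (tangent_map S (inv f) (f x) u) (tangent_map S (inv f) (f x) w) = J * gram (f x) u w"
    using gram_scaling[OF diffeo_tdiff[OF diffeo_inv[OF f]], of "f x"] by blast
  have "inv f (f x) = x"
    using diffeo_comp_inv(1)[OF f] by (simp add: fun_eq_iff)
  then have "gram x u w = J * gram (f x) (tangent_map S f x u) (tangent_map S f x w)"
    using J[OF tangent_map_in[OF diffeo_tdiff[OF f] uw(1)] tangent_map_in[OF diffeo_tdiff[OF f] uw(2)]] uw f
    by (simp add: diffeo_tdiff tangent_map_inverse diffeo_inv diffeo_comp_inv)
  then have "gram (f x) (tangent_map S f x u) (tangent_map S f x w) \<noteq> 0"
    using assms(4) by auto
  moreover have "0 \<le> gram (f x) (tangent_map S f x u) (tangent_map S f x w)"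
    using uw f by (intro gram_nonneg tangent_map_in) (auto simp: diffeo_tdiff)
  ultimately show ?thesis by simp
qed

section \<open>Iterates of the projective map\<close>

abbreviation UT :: "('m \<times> 'm tvec) set"
  where "UT \<equiv> unit_tangent_bundle S"

lemma UT_iff: "(x, v) \<in> UT \<longleftrightarrow> v \<in> unit_tangent_space S x"
  by (simp add: unit_tangent_bundle_def)

lemma unit_nonzero: "v \<in> unit_tangent_space S x \<Longrightarrow> v \<noteq> 0"
  using metric_zero_left[of 0 x] subspace_0[OF subspace_tangent_space] by (auto simp: unit_tangent_iff)

lemma normalize_unit:
  assumes "v \<in> tangent_space S x" "v \<noteq> 0"
  shows "(1 / tnorm S x v) *\<^sub>R v \<in> unit_tangent_space S x"
  using metric_pos[OF assms] metric_scale[OF assms(1,1)] assms(1)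
  by (simp add: unit_tangent_iff tangent_scale tnorm_def)

lemma tnorm_scale:
  "v \<in> tangent_space S x \<Longrightarrow> 0 \<le> a \<Longrightarrow> tnorm S x (a *\<^sub>R v) = a * tnorm S x v"
  by (simp add: tnorm_def metric_scale real_sqrt_mult)

lemma tangent_map_scale:
  "tdiff f x \<Longrightarrow> v \<in> tangent_space S x \<Longrightarrow> tangent_map S f x (a *\<^sub>R v) = a *\<^sub>R tangent_map S f x v"
  using tangent_map_lincomb[of f x v v a 0] by simp

lemma proj_map_in:
  assumes "diffeo f" "z \<in> UT"
  shows "proj_map S f z \<in> UT"
proof -
  obtain x v where z: "z = (x, v)"
    by (cases z)
  then have v: "v \<in> tangent_space S x" "v \<noteq> 0"
    using assms(2) unit_nonzero by (auto simp: UT_iff unit_tangent_iff)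
  then show ?thesis
    using assms(1) unfolding z proj_map_def
    by (simp add: UT_iff normalize_unit tangent_map_nonzero tangent_map_in diffeo_tdiff)
qed

text \<open>A positive normalising factor passes through the linear tangent map and is cancelled by
  the next normalisation. Hence iterates of the projective map are projective maps of
  iterates.\<close>

lemma proj_map_compose:
  assumes f: "diffeo f" and g: "diffeo g" and z: "z \<in> UT"
  shows "proj_map S f (proj_map S g z) = proj_map S (f \<circ> g) z"
proof -
  obtain x v where xv: "z = (x, v)"
    by (cases z)
  then have v: "v \<in> tangent_space S x" "v \<noteq> 0"
    using z unit_nonzero by (auto simp: UT_iff unit_tangent_iff)
  define u where "u = tangent_map S g x v"
  have u: "u \<in> tangent_space S (g x)" "u \<noteq> 0"
    using v g by (auto simp: u_def tangent_map_in diffeo_tdiff tangent_map_nonzero)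
  define s where "s = 1 / tnorm S (g x) u"
  have s: "s > 0"
    using metric_pos[OF u] by (simp add: s_def tnorm_def)
  have Tu: "tangent_map S f (g x) u \<in> tangent_space S (f (g x))"
    using u f by (simp add: tangent_map_in diffeo_tdiff)
  have "tangent_map S f (g x) (s *\<^sub>R u) = s *\<^sub>R tangent_map S f (g x) u"
    using u f by (simp add: tangent_map_scale diffeo_tdiff)
  moreover have "tangent_map S (f \<circ> g) x v = tangent_map S f (g x) u"
    using f g v by (simp add: u_def tangent_map_compose diffeo_tdiff)
  ultimately show ?thesis
    using s Tu by (simp add: xv proj_map_def tnorm_scale flip: u_def s_def)
qed

lemma proj_map_id: "z \<in> UT \<Longrightarrow> proj_map S id z = z"
  by (cases z) (simp add: UT_iff proj_map_def unit_tangent_iff tangent_map_id tnorm_def)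

text \<open>The projective map forgets lengths, so it has an inverse only on the unit tangent
  bundle; there the inverse is the projective map of \<open>inv f\<close>.\<close>

lemma proj_map_inv_into:
  assumes f: "diffeo f" and z: "z \<in> UT"
  shows "inv_into UT (proj_map S f) z = proj_map S (inv f) z"
proof (rule inv_into_f_eq)
  note i = diffeo_inv[OF f]
  show "inj_on (proj_map S f) UT"
    by (rule inj_on_inverseI[of _ "proj_map S (inv f)"])
      (simp add: proj_map_compose[OF i f] diffeo_comp_inv[OF f] proj_map_id)
  show "proj_map S (inv f) z \<in> UT"
    by (rule proj_map_in[OF i z])
  show "proj_map S f (proj_map S (inv f) z) = z"
    by (simp add: proj_map_compose[OF f i z] diffeo_comp_inv[OF f] proj_map_id[OF z])
qed

lemma proj_map_funpow:
  assumes f: "diffeo f" and F: "\<And>z. z \<in> UT \<Longrightarrow> F z = proj_map S f z" and z: "z \<in> UT"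
  shows "(F ^^ n) z = proj_map S (f ^^ n) z"
proof (induction n)
  case 0
  show ?case
    by (simp add: proj_map_id[OF z, unfolded id_def] id_def)
next
  case (Suc n)
  have "(F ^^ Suc n) z = proj_map S f (proj_map S (f ^^ n) z)"
    using Suc F[OF proj_map_in[OF diffeo_funpow[OF f] z]] by simp
  then show ?case
    using proj_map_compose[OF f diffeo_funpow[OF f] z] by (simp only: funpow.simps(2))
qed

lemma proj_iterate_eq:
  assumes "diffeo f" "z \<in> UT"
  shows "proj_iterate S f n z = proj_map S (int_iterate UNIV f n) z"
  using proj_map_funpow[OF assms(1) refl assms(2)]
    proj_map_funpow[OF diffeo_inv[OF assms(1)] proj_map_inv_into[OF assms(1)] assms(2)]
  by (simp add: proj_iterate_def int_iterate_def)


section \<open>A formula for the projective cocycle\<close>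

text \<open>This is kappa: area divided by squared length, hence unchanged when both vectors are
  multiplied by the same nonzero number.\<close>

definition conf :: "'m \<Rightarrow> 'm tvec \<Rightarrow> 'm tvec \<Rightarrow> real"
  where "conf x u w = sqrt (gram x u w) / metric S x u u"

text \<open>The squared length of the image curve before normalisation equals \<open>p\<close> at 0
  and has derivative \<open>2 * q\<close> there; the rest is the product rule. It is applied in each
  chart separately, where the curve lies in the plane.\<close>

lemma normalized_circle_velocity:
  fixes a b :: "'a::real_normed_vector"
  assumes "0 < p"
  shows "((\<lambda>t. (1 / sqrt ((cos t)\<^sup>2 * p + 2 * cos t * sin t * q + (sin t)\<^sup>2 * r)) *\<^sub>R (cos t *\<^sub>R a + sin t *\<^sub>R b))
    has_vector_derivative ((- q / (p * sqrt p)) *\<^sub>R a + (1 / sqrt p) *\<^sub>R b)) (at 0)"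
proof -
  have 1: "((\<lambda>t. 1 / sqrt ((cos t)\<^sup>2 * p + 2 * cos t * sin t * q + (sin t)\<^sup>2 * r))
      has_field_derivative (- q / (p * sqrt p))) (at 0)"
  proof -
    have h: "((\<lambda>t. (cos t)\<^sup>2 * p + 2 * cos t * sin t * q + (sin t)\<^sup>2 * r) has_field_derivative 2 * q) (at 0)"
      by (auto intro!: derivative_eq_intros)
    have "((\<lambda>s. 1 / sqrt s) has_field_derivative - 1 / (2 * p * sqrt p)) (at p)"
      using assms by (auto intro!: derivative_eq_intros simp: field_simps)
    then have "((\<lambda>s. 1 / sqrt s) has_field_derivative - 1 / (2 * p * sqrt p))
        (at ((cos 0)\<^sup>2 * p + 2 * cos 0 * sin 0 * q + (sin 0)\<^sup>2 * r))"
      by simp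
    from DERIV_chain2[OF this h] show ?thesis
      by simp
  qed
  have "(cos has_field_derivative 0) (at (0::real))" "(sin has_field_derivative 1) (at (0::real))"
    by (auto intro!: derivative_eq_intros)
  from this[THEN has_vector_derivative_scaleR, OF has_vector_derivative_const]
  have "((\<lambda>t. cos t *\<^sub>R a) has_vector_derivative 0) (at 0)"
    "((\<lambda>t. sin t *\<^sub>R b) has_vector_derivative b) (at 0)"
    by fastforce+
  from has_vector_derivative_add[OF this]
  have 2: "((\<lambda>t. cos t *\<^sub>R a + sin t *\<^sub>R b) has_vector_derivative b) (at 0)"
    by simp
  show ?thesis
    using has_vector_derivative_scaleR[OF 1 2] by (simp add: add.commute)
qed

lemma conf_ratio:
  assumes f: "tdiff f x" and u: "u \<in> tangent_space S x"
    and w: "w \<in> tangent_space S x" "w' \<in> tangent_space S x" "0 < gram x u w" "0 < gram x u w'"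
  shows "conf (f x) (tangent_map S f x u) (tangent_map S f x w) / conf x u w =
    conf (f x) (tangent_map S f x u) (tangent_map S f x w') / conf x u w'"
proof -
  obtain J where J: "\<And>u w. u \<in> tangent_space S x \<Longrightarrow> w \<in> tangent_space S x \<Longrightarrow>
    gram (f x) (tangent_map S f x u) (tangent_map S f x w) = J * gram x u w"
    using gram_scaling[OF f] by blast
  show ?thesis
    using w unfolding conf_def J[OF u w(1)] J[OF u w(2)] real_sqrt_mult by simp
qed

text \<open>The velocity of the normalised curve is the component of \<open>L w0\<close> orthogonal
  to \<open>L v\<close>, divided by the length of \<open>L v\<close>. The length of that component
  is the area of the pair divided by the length of \<open>L v\<close>, so together they give
  \<open>conf\<close>. By the common area factor, any independent \<open>w\<close> may replace
  \<open>w0\<close>.\<close>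

lemma proj_deriv_eq:
  assumes f: "diffeo f" and v: "v \<in> unit_tangent_space S x"
    and w: "w \<in> tangent_space S x" "0 < gram x v w"
  shows "proj_deriv S f n x v =
    conf (int_iterate UNIV f n x) (tangent_map S (int_iterate UNIV f n) x v) (tangent_map S (int_iterate UNIV f n) x w)
      / conf x v w"
proof -
  define F y where "F = int_iterate UNIV f n" and "y = F x"
  define L where "L = tangent_map S F x"
  define w0 where "w0 = (SOME w. w \<in> unit_tangent_space S x \<and> metric S x v w = 0)"
  obtain w1 where "w1 \<in> unit_tangent_space S x" "metric S x v w1 = 0"
    by (rule orthogonal_unit_vector[OF v])
  then have ex: "\<exists>w. w \<in> unit_tangent_space S x \<and> metric S x v w = 0"
    by blast
  have "w0 \<in> unit_tangent_space S x \<and> metric S x v w0 = 0"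
    unfolding w0_def by (rule someI_ex[OF ex])
  then have w0: "w0 \<in> tangent_space S x" "metric S x w0 w0 = 1" "metric S x v w0 = 0"
    by (auto simp: unit_tangent_iff)
  have v': "v \<in> tangent_space S x" "metric S x v v = 1" "v \<noteq> 0"
    using v unit_nonzero by (auto simp: unit_tangent_iff)
  have F: "diffeo F"
    unfolding F_def by (rule diffeo_int_iterate[OF f])
  note td = diffeo_tdiff[OF F]
  have Lin: "L v \<in> tangent_space S y" "L w0 \<in> tangent_space S y"
    using v' w0 td by (auto simp: L_def y_def intro: tangent_map_in)
  define p q r where "p = metric S y (L v) (L v)" and "q = metric S y (L v) (L w0)"
    and "r = metric S y (L w0) (L w0)"
  have metric_comb: "metric S y (s *\<^sub>R L v + t *\<^sub>R L w0) (s *\<^sub>R L v + t *\<^sub>R L w0) = s\<^sup>2 * p + 2 * s * t * q + t\<^sup>2 * r"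
    for s t
    unfolding metric_lincomb_left[OF Lin tangent_lincomb[OF Lin]] metric_lincomb_right[OF Lin Lin(1)]
      metric_lincomb_right[OF Lin Lin(2)] metric_sym[OF Lin(2,1)]
    by (simp add: p_def q_def r_def power2_eq_square algebra_simps)
  have p: "p > 0"
    unfolding p_def using metric_pos[OF Lin(1)] tangent_map_nonzero[OF F v'(1,3)] by (simp add: L_def)
  define \<gamma> where "\<gamma> t = snd (proj_iterate S f n (x, cos t *\<^sub>R v + sin t *\<^sub>R w0))" for t
  have \<gamma>: "\<gamma> t = (1 / sqrt ((cos t)\<^sup>2 * p + 2 * cos t * sin t * q + (sin t)\<^sup>2 * r)) *\<^sub>R (cos t *\<^sub>R L v + sin t *\<^sub>R L w0)"
    for t
  proof -
    let ?u = "cos t *\<^sub>R v + sin t *\<^sub>R w0"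
    have "metric S x ?u ?u = (cos t)\<^sup>2 + (sin t)\<^sup>2"
      unfolding metric_lincomb_left[OF v'(1) w0(1) tangent_lincomb[OF v'(1) w0(1)]]
        metric_lincomb_right[OF v'(1) w0(1) v'(1)] metric_lincomb_right[OF v'(1) w0(1) w0(1)]
        metric_sym[OF w0(1) v'(1)]
      by (simp add: v' w0 power2_eq_square)
    then have "(x, ?u) \<in> UT"
      by (simp add: UT_iff unit_tangent_iff tangent_lincomb v' w0)
    moreover have "tangent_map S F x ?u = cos t *\<^sub>R L v + sin t *\<^sub>R L w0"
      unfolding L_def by (rule tangent_map_lincomb[OF td v'(1) w0(1)])
    ultimately show ?thesis
      unfolding \<gamma>_def proj_iterate_eq[OF f] F_def[symmetric]
      by (simp add: proj_map_def proj_iterate_eq[OF f] tnorm_def metric_comb flip: F_def y_def)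
  qed
  have "vector_derivative (\<lambda>t. \<gamma> t c) (at 0) = ((- q / (p * sqrt p)) *\<^sub>R L v + (1 / sqrt p) *\<^sub>R L w0) c" for c
  proof -
    have "\<gamma> t c = (1 / sqrt ((cos t)\<^sup>2 * p + 2 * cos t * sin t * q + (sin t)\<^sup>2 * r)) *\<^sub>R (cos t *\<^sub>R L v c + sin t *\<^sub>R L w0 c)" for t
      by (simp add: \<gamma> scaleR_fun_def)
    then show ?thesis
      unfolding lincomb_nth
      by (simp only: vector_derivative_at[OF normalized_circle_velocity[OF p, of q r "L v c" "L w0 c"]])
  qed
  then have velocity: "(\<lambda>c. vector_derivative (\<lambda>t. \<gamma> t c) (at 0)) = (- q / (p * sqrt p)) *\<^sub>R L v + (1 / sqrt p) *\<^sub>R L w0"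
    by (rule ext)
  have "proj_deriv S f n x v = tnorm S y ((- q / (p * sqrt p)) *\<^sub>R L v + (1 / sqrt p) *\<^sub>R L w0)"
    unfolding proj_deriv_def Let_def w0_def[symmetric] \<gamma>_def[symmetric] velocity F_def[symmetric] y_def ..
  also have "\<dots> = sqrt ((p * r - q\<^sup>2) / p\<^sup>2)"
  proof -
    have "(- q / (p * sqrt p))\<^sup>2 * p + 2 * (- q / (p * sqrt p)) * (1 / sqrt p) * q + (1 / sqrt p)\<^sup>2 * r
      = q\<^sup>2 / (p\<^sup>2 * (sqrt p)\<^sup>2) * p - 2 * q\<^sup>2 / (p * (sqrt p)\<^sup>2) + r / (sqrt p)\<^sup>2"
      by (simp add: power_divide power_mult_distrib power2_eq_square)
    also have "\<dots> = (p * r - q\<^sup>2) / p\<^sup>2"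
      using p by (simp add: field_simps power2_eq_square)
    finally show ?thesis
      unfolding tnorm_def metric_comb by (rule arg_cong)
  qed
  also have "\<dots> = conf y (L v) (L w0)"
    using p by (simp add: conf_def gram_def real_sqrt_divide flip: p_def q_def r_def)
  \<comment> \<open>The denominator is 1, since \<open>v\<close> and \<open>w0\<close> are
    orthonormal.\<close>
  also have "\<dots> = conf y (L v) (L w0) / conf x v w0"
    by (simp add: conf_def gram_def v' w0)
  also have "\<dots> = conf y (L v) (L w) / conf x v w"
    unfolding y_def L_def by (rule conf_ratio[OF td v'(1) w0(1) w(1) _ w(2)]) (simp add: gram_def v' w0)
  finally show ?thesis
    by (simp only: L_def y_def F_def)
qed


lemma conf_scale:
  assumes "u \<in> tangent_space S x" "w \<in> tangent_space S x" "s \<noteq> 0"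
  shows "conf x (s *\<^sub>R u) (s *\<^sub>R w) = conf x u w"
proof -
  have "gram x (s *\<^sub>R u) (s *\<^sub>R w) = (s\<^sup>2)\<^sup>2 * gram x u w"
    unfolding gram_def metric_scale[OF assms(1,1)] metric_scale[OF assms(1,2)] metric_scale[OF assms(2,2)]
    by (simp add: power2_eq_square algebra_simps)
  then show ?thesis
    using assms by (simp add: conf_def metric_scale real_sqrt_mult power2_eq_square)
qed

lemma conf_pos:
  assumes "u \<in> tangent_space S x" "0 < gram x u w" "u \<noteq> 0"
  shows "0 < conf x u w"
  using assms metric_pos by (simp add: conf_def)

lemma critical_direction_iff:
  assumes f: "diffeo f" and v: "v \<in> unit_tangent_space S x"
    and w: "w \<in> tangent_space S x" "0 < gram x v w"
  shows "critical_direction S f x v \<longleftrightarrow> (\<forall>n. conf x v w \<le> conf (int_iterate UNIV f n x)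
    (tangent_map S (int_iterate UNIV f n) x v) (tangent_map S (int_iterate UNIV f n) x w))"
proof -
  have "0 < conf x v w"
    using v w unit_nonzero by (intro conf_pos) (auto simp: unit_tangent_iff)
  then show ?thesis
    unfolding critical_direction_def proj_deriv_eq[OF f v w] using v by simp
qed

lemma orthogonal_gram_pos:
  assumes "v \<in> unit_tangent_space S x"
  obtains w where "w \<in> tangent_space S x" "0 < gram x v w"
  by (rule orthogonal_unit_vector[OF assms], rule that)
    (use assms in \<open>auto simp: unit_tangent_iff gram_def\<close>)

text \<open>The auxiliary vector \<open>w\<close> is transported together with \<open>v\<close>.
  Then the two derivatives are reciprocal quotients of the same two values of
  \<open>conf\<close>.\<close>

lemma proj_deriv_inverse:
  assumes f: "diffeo f" and v: "v \<in> unit_tangent_space S x"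
  shows "proj_deriv S f (- n) (int_iterate UNIV f n x) (snd (proj_iterate S f n (x, v))) * proj_deriv S f n x v = 1"
proof -
  define F G where "F = int_iterate UNIV f n" and "G = int_iterate UNIV f (- n)"
  have F: "diffeo F" and G: "diffeo G" and GF: "G \<circ> F = id"
    using diffeo_int_iterate[OF f] int_iterate_neg[OF f] by (auto simp: F_def G_def)
  obtain w where w: "w \<in> tangent_space S x" "0 < gram x v w"
    using orthogonal_gram_pos[OF v] .
  have v': "v \<in> tangent_space S x" "v \<noteq> 0"
    using v unit_nonzero by (auto simp: unit_tangent_iff)
  define a b where "a = tangent_map S F x v" and "b = tangent_map S F x w"
  have ab: "a \<in> tangent_space S (F x)" "b \<in> tangent_space S (F x)" "0 < gram (F x) a b" "a \<noteq> 0"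
    unfolding a_def b_def using v' w F
    by (auto intro: tangent_map_in gram_tangent_map_pos simp: diffeo_tdiff tangent_map_nonzero)
  define s where "s = 1 / tnorm S (F x) a"
  have s: "s \<noteq> 0"
    using metric_pos[OF ab(1,4)] by (simp add: s_def tnorm_def)
  have u: "snd (proj_iterate S f n (x, v)) = s *\<^sub>R a"
    using v by (simp add: proj_iterate_eq[OF f] UT_iff proj_map_def s_def a_def flip: F_def)
  have unit: "s *\<^sub>R a \<in> unit_tangent_space S (F x)"
    unfolding s_def by (rule normalize_unit[OF ab(1,4)])
  have "gram (F x) (s *\<^sub>R a) (s *\<^sub>R b) = s ^ 4 * gram (F x) a b"
    unfolding gram_def metric_scale[OF ab(1,1)] metric_scale[OF ab(1,2)] metric_scale[OF ab(2,2)] by algebra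
  then have g: "0 < gram (F x) (s *\<^sub>R a) (s *\<^sub>R b)"
    using ab(3) s by (simp add: zero_less_mult_iff)
  have back_vec: "tangent_map S G (F x) (s *\<^sub>R a) = s *\<^sub>R v" "tangent_map S G (F x) (s *\<^sub>R b) = s *\<^sub>R w"
    using ab v' w F G GF by (simp_all add: tangent_map_scale diffeo_tdiff a_def b_def tangent_map_inverse)
  have "G (F x) = x"
    using GF by (simp add: fun_eq_iff)
  then have "proj_deriv S f (- n) (F x) (s *\<^sub>R a) = conf x v w / conf (F x) a b"
    unfolding proj_deriv_eq[OF f unit tangent_scale[OF ab(2)] g] G_def[symmetric] back_vec
    by (simp add: conf_scale v' w ab s)
  moreover have "proj_deriv S f n x v = conf (F x) a b / conf x v w"
    unfolding proj_deriv_eq[OF f v w] F_def[symmetric] a_def b_def ..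
  moreover have "0 < conf x v w" "0 < conf (F x) a b"
    using conf_pos v' w ab by auto
  ultimately show ?thesis
    unfolding u F_def[symmetric] by simp
qed

lemma no_critical_orbit:
  assumes f: "diffeo f" and far: "far_from_homotheties S f \<Lambda>" and c: "c \<in> \<Lambda>"
    and crit: "\<And>n. critical_direction S f (int_iterate UNIV f n c) (snd (proj_iterate S f n (c, v)))"
    and cv: "critical_direction S f c v"
  shows False
proof -
  have v: "v \<in> unit_tangent_space S c"
    using cv by (simp add: critical_direction_def)
  have "proj_deriv S f n c v = 1" for n
  proof -
    have "1 \<le> proj_deriv S f n c v"
      "1 \<le> proj_deriv S f (- n) (int_iterate UNIV f n c) (snd (proj_iterate S f n (c, v)))"
      using cv crit[of n] by (auto simp: critical_direction_def)
    then show ?thesis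
      using proj_deriv_inverse[OF f v, of n]
      by (smt (verit) mult_le_cancel_right1 mult_le_cancel_left1)
  qed
  moreover obtain \<delta> where \<delta>: "0 < \<delta>" "\<delta> < 1"
    "\<not> (\<exists>x\<in>\<Lambda>. \<exists>v\<in>unit_tangent_space S x. \<forall>n::nat. 1 \<le> n \<longrightarrow>
      (1 - \<delta>) ^ n < proj_deriv S f (int n) x v \<and> proj_deriv S f (int n) x v < (1 + \<delta>) ^ n)"
    using far unfolding far_from_homotheties_def by blast
  \<comment> \<open>The constant value 1 lies strictly inside the forbidden band at every positive
    time.\<close>
  moreover have "(1 - \<delta>) ^ n < 1 \<and> 1 < (1 + \<delta>) ^ n" if "1 \<le> n" for n :: nat
    using \<delta>(1,2) that by (auto intro: power_Suc_less_one one_less_power simp: power_less_one_iff)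
  ultimately show False
    using c v by metis
qed

section \<open>Periodic critical points\<close>

text \<open>By invariance the whole orbit stays in \<open>\<Lambda>\<close>, so the area shrinks
  strictly at each of the \<open>n\<close> steps; dissipation bounds the determinant of
  \<open>f\<close> itself, not directly that of the return map.\<close>

lemma gram_dissipative:
  assumes f: "diffeo f" and dis: "dissipative_on S f \<Lambda>" and inv: "f ` \<Lambda> = \<Lambda>" and x: "x \<in> \<Lambda>"
    and uw: "u \<in> tangent_space S x" "w \<in> tangent_space S x" and g: "0 < gram x u w" and n: "0 < n"
  shows "gram ((f ^^ n) x) (tangent_map S (f ^^ n) x u) (tangent_map S (f ^^ n) x w) < gram x u w"
proof -
  have orbit: "(f ^^ k) x \<in> \<Lambda>" for k
    using x inv by (induction k) auto
  define g where "g k = gram ((f ^^ k) x) (tangent_map S (f ^^ k) x u) (tangent_map S (f ^^ k) x w)" for k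
  have step: "g (Suc k) < g k" for k
  proof -
    note fk = diffeo_funpow[OF f, of k]
    have pos: "0 < g k"
      unfolding g_def by (rule gram_tangent_map_pos[OF fk uw g])
    have Tin: "tangent_map S (f ^^ k) x u \<in> tangent_space S ((f ^^ k) x)"
      "tangent_map S (f ^^ k) x w \<in> tangent_space S ((f ^^ k) x)"
      using uw by (auto intro: tangent_map_in diffeo_tdiff[OF fk])
    have "g (Suc k) = (abs_det S f ((f ^^ k) x))\<^sup>2 * g k"
      using abs_det_gram(2)[OF diffeo_tdiff[OF f] Tin]
        tangent_map_compose[OF diffeo_tdiff[OF fk] diffeo_tdiff[OF f] uw(1)]
        tangent_map_compose[OF diffeo_tdiff[OF fk] diffeo_tdiff[OF f] uw(2)]
      by (simp add: g_def)
    moreover have "(abs_det S f ((f ^^ k) x))\<^sup>2 < 1"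
      using dis orbit abs_det_gram(1)[OF diffeo_tdiff[OF f]]
      by (simp add: dissipative_on_def power_less_one_iff)
    ultimately show ?thesis
      using pos by simp
  qed
  have "g n < g 0"
    using lift_Suc_mono_less[of "\<lambda>k. - g k" 0 n] step n by simp
  moreover have "g 0 = gram x u w"
    using uw by (simp add: g_def tangent_map_id[unfolded id_def] id_def)
  ultimately show ?thesis
    by (simp add: g_def)
qed

section \<open>The return map at a periodic point, in a chart\<close>

lemma chart_deriv_funpow:
  assumes G: "diffeo G" and per: "G x = x" and c: "c \<in> charts_at S x"
  shows "chart_deriv c c (G ^^ k) x a = (chart_deriv c c G x ^^ k) a" and "(G ^^ k) x = x"
proof -
  show pt: "(G ^^ k) x = x" for k
    by (induction k) (auto simp: per)
  show "chart_deriv c c (G ^^ k) x a = (chart_deriv c c G x ^^ k) a"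
  proof (induction k)
    case 0
    then show ?case
      using chart_deriv_id_same[OF c] by (simp add: id_def)
  next
    case (Suc k)
    have "chart_deriv c c (G \<circ> G ^^ k) x a = chart_deriv c c G x (chart_deriv c c (G ^^ k) x a)"
      using chart_deriv_compose[of "G ^^ k" x G c c c a]
      by (simp add: pt per c diffeo_tdiff diffeo_funpow G)
    with Suc show ?case
      by (simp only: funpow.simps(2) comp_apply[of "chart_deriv c c G x"])
  qed
qed

lemma cross_funpow:
  assumes "linear A"
  shows "cross ((A ^^ k) a) ((A ^^ k) b) = det2 A ^ k * cross a b"
  by (induction k) (simp_all add: cross_linear[OF assms])

text \<open>The area of the transported pair is multiplied by exactly
  \<open>\<bar>det2 (chart_deriv c c G x)\<bar> ^ k\<close>, so the inequality for
  \<open>conf\<close> becomes a bound on the squared length alone. \<open>G\<close> is abstract so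
  as to stand for the return map and for its inverse.\<close>

lemma critical_growth:
  assumes f: "diffeo f" and cv: "critical_direction S f x v" and c: "c \<in> charts_at S x"
    and G: "diffeo G" and per: "G x = x" and iter: "\<And>k. \<exists>n. G ^^ k = int_iterate UNIV f n"
  shows "metric_form c x ((chart_deriv c c G x ^^ k) (v c)) ((chart_deriv c c G x ^^ k) (v c))
    \<le> \<bar>det2 (chart_deriv c c G x)\<bar> ^ k * metric_form c x (v c) (v c)"
proof -
  define A where "A = chart_deriv c c G x"
  have A: "linear A"
    unfolding A_def using c per by (intro linear_chart_deriv diffeo_tdiff[OF G]) auto
  have v: "v \<in> unit_tangent_space S x"
    using cv by (simp add: critical_direction_def)
  then have v': "v \<in> tangent_space S x" "v \<noteq> 0"
    using unit_nonzero by (auto simp: unit_tangent_iff)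
  obtain w where w: "w \<in> tangent_space S x" "0 < gram x v w"
    using orthogonal_gram_pos[OF v] .
  define u z where "u = tangent_map S (G ^^ k) x v" and "z = tangent_map S (G ^^ k) x w"
  note Gk = diffeo_funpow[OF G, of k]
  note pt = chart_deriv_funpow(2)[OF G per c, of k]
  have uz: "u \<in> tangent_space S x" "z \<in> tangent_space S x" "u \<noteq> 0"
    using tangent_map_in[OF diffeo_tdiff[OF Gk] v'(1)] tangent_map_in[OF diffeo_tdiff[OF Gk] w(1)]
      tangent_map_nonzero[OF Gk v'] by (auto simp: u_def z_def pt)
  have uc: "u c = (A ^^ k) (v c)" and zc: "z c = (A ^^ k) (w c)"
    using tangent_map_nth[OF diffeo_tdiff[OF Gk] v'(1) c, of c] tangent_map_nth[OF diffeo_tdiff[OF Gk] w(1) c, of c]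
    by (simp_all add: u_def z_def pt c chart_deriv_funpow(1)[OF G per c] A_def)
  have "gram x u z = (det2 A ^ k)\<^sup>2 * gram x v w"
    unfolding gram_eq[OF uz(1,2) c] gram_eq[OF v'(1) w(1) c] uc zc cross_funpow[OF A]
    by (simp add: power_mult_distrib)
  then have gram: "sqrt (gram x u z) = \<bar>det2 A\<bar> ^ k * sqrt (gram x v w)"
    by (simp add: real_sqrt_mult power_abs)
  obtain n where n: "G ^^ k = int_iterate UNIV f n"
    using iter by blast
  have "conf x v w \<le> conf x u z"
    using critical_direction_iff[OF f v w] cv pt unfolding u_def z_def n by metis
  then have "sqrt (gram x v w) / metric S x v v \<le> \<bar>det2 A\<bar> ^ k * sqrt (gram x v w) / metric S x u u"
    by (simp add: conf_def gram)
  then have "metric S x u u \<le> \<bar>det2 A\<bar> ^ k * metric S x v v"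
    using w(2) metric_pos[OF uz(1,3)] metric_pos[OF v'] by (simp add: field_simps)
  then show ?thesis
    using metric_eq_form[OF uz(1,1) c] metric_eq_form[OF v'(1,1) c] by (simp add: uc flip: A_def)
qed

text \<open>The first claim is the parallelogram law with the square of \<open>a + b\<close>
  dropped. Both supply the hypotheses on \<open>q\<close> in
  \<open>growth_imp_equal_moduli\<close>.\<close>

lemma metric_form_parallelogram:
  assumes "c \<in> charts_at S x"
  shows "metric_form c x (a - b) (a - b) \<le> 2 * metric_form c x a a + 2 * metric_form c x b b"
    and "metric_form c x (s *\<^sub>R a) (s *\<^sub>R a) = s\<^sup>2 * metric_form c x a a"
proof -
  note l = metric_form(1)[OF assms] and sym = metric_form(2)[OF assms]
  note add = linear_add[OF l] and diff = linear_diff[OF l] and mul = linear_cmul[OF l]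
  have right: "metric_form c x a (p + q) = metric_form c x a p + metric_form c x a q"
    "metric_form c x a (p - q) = metric_form c x a p - metric_form c x a q"
    "metric_form c x a (r *\<^sub>R p) = r * metric_form c x a p" for a p q r
    unfolding sym[of a] add diff mul by simp_all
  have "0 \<le> metric_form c x (a + b) (a + b)"
    using metric_form(3)[OF assms, of "a + b"] linear_0[OF l] by (cases "a + b = 0") auto
  then show "metric_form c x (a - b) (a - b) \<le> 2 * metric_form c x a a + 2 * metric_form c x b b"
    unfolding add diff right by simp
  show "metric_form c x (s *\<^sub>R a) (s *\<^sub>R a) = s\<^sup>2 * metric_form c x a a"
    unfolding mul right by (simp add: power2_eq_square)
qed

lemma inv_funpow:
  assumes "diffeo f"
  shows "inv (f ^^ n) = inv f ^^ n"
  using assms by (intro inv_fn) (simp add: diffeo_def)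

lemma critical_periodic_moduli:
  assumes f: "diffeo f" and cv: "critical_direction S f x v" and c: "c \<in> charts_at S x"
    and per: "(f ^^ n) x = x"
  defines "A \<equiv> chart_deriv c c (f ^^ n) x"
  shows "det2 A \<noteq> 0" "(trace2 A)\<^sup>2 \<le> 4 * det2 A \<or> trace2 A = 0"
proof -
  define F where "F = f ^^ n"
  have F: "diffeo F" "F x = x"
    using f per by (auto simp: F_def diffeo_funpow)
  have iF: "diffeo (inv F)" "inv F x = x"
    using F diffeo_comp_inv(1)[OF F(1)] diffeo_inv by (auto simp: fun_eq_iff) (metis)
  define B where "B = chart_deriv c c (inv F) x"
  have lin: "linear A" "linear B"
    unfolding A_def B_def F_def[symmetric] using c F iF
    by (auto intro!: linear_chart_deriv simp: diffeo_tdiff)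
  have BA: "B (A a) = a" for a
    using chart_deriv_compose[OF diffeo_tdiff[OF F(1)] diffeo_tdiff[OF iF(1)] c, of c c a] c F iF
      diffeo_comp_inv(1)[OF F(1)] chart_deriv_id_same[OF c, of a]
    by (simp add: A_def B_def flip: F_def)
  \<comment> \<open>Multiplicativity of the determinant, read off from the area of the standard
    basis.\<close>
  have "det2 B * det2 A * cross (axis 1 1) (axis 2 1) = cross (axis 1 1) (axis 2 1)"
    using cross_linear[OF lin(2), of "A (axis 1 1)" "A (axis 2 1)"] cross_linear[OF lin(1), of "axis 1 1" "axis 2 1"]
    by (simp add: BA)
  moreover have "cross (axis 1 1) (axis 2 1) = 1"
    by (simp add: cross_def axis_def)
  ultimately have det: "det2 B * det2 A = 1"
    by simp
  then show d0: "det2 A \<noteq> 0"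
    by auto
  have detB: "\<bar>det2 B\<bar> = 1 / \<bar>det2 A\<bar>"
    using det d0 by (simp add: field_simps flip: abs_mult)
  have v: "v \<in> tangent_space S x" "v \<noteq> 0"
    using cv unit_nonzero by (auto simp: critical_direction_def unit_tangent_iff)
  have vc: "v c \<noteq> 0"
    using v tangent_space_eqI[OF v(1) subspace_0[OF subspace_tangent_space] c] by auto
  have iter: "\<exists>m. F ^^ k = int_iterate UNIV f m" "\<exists>m. inv F ^^ k = int_iterate UNIV f m" for k
  proof -
    have "F ^^ k = int_iterate UNIV f (int (n * k))"
      by (simp add: F_def int_iterate_UNIV funpow_mult nat_mult_distrib flip: of_nat_mult)
    then show "\<exists>m. F ^^ k = int_iterate UNIV f m" by blast
    \<comment> \<open>The case split is needed because \<open>m = 0\<close> falls into the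
      nonnegative branch of \<open>int_iterate\<close>.\<close>
    have "inv f ^^ m = int_iterate UNIV f (- int m)" for m
      by (cases m) (simp_all add: int_iterate_UNIV nat_add_distrib)
    from this[of "n * k"] have "inv F ^^ k = int_iterate UNIV f (- int (n * k))"
      by (simp only: F_def inv_funpow[OF f] funpow_mult)
    then show "\<exists>m. inv F ^^ k = int_iterate UNIV f m" by blast
  qed
  show "(trace2 A)\<^sup>2 \<le> 4 * det2 A \<or> trace2 A = 0"
  \<comment> \<open>The quadratic form \<open>q\<close> is the squared Riemannian length at
    \<open>x\<close>, expressed in the chart.\<close>
  proof (rule growth_imp_equal_moduli[OF lin BA d0 _ _ _ vc])
    show "metric_form c x (s *\<^sub>R a) (s *\<^sub>R a) = s\<^sup>2 * metric_form c x a a" for s a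
      by (rule metric_form_parallelogram(2)[OF c])
    show "metric_form c x (a - b) (a - b) \<le> 2 * metric_form c x a a + 2 * metric_form c x b b" for a b
      by (rule metric_form_parallelogram(1)[OF c])
    show "0 < metric_form c x a a" if "a \<noteq> 0" for a
      using metric_form(3)[OF c that] .
    show "metric_form c x ((A ^^ k) (v c)) ((A ^^ k) (v c)) \<le> \<bar>det2 A\<bar> ^ k * metric_form c x (v c) (v c)" for k
      unfolding A_def F_def[symmetric] by (rule critical_growth[OF f cv c F iter(1)])
    show "metric_form c x ((B ^^ k) (v c)) ((B ^^ k) (v c)) \<le> (1 / \<bar>det2 A\<bar>) ^ k * metric_form c x (v c) (v c)" for k
      unfolding detB[symmetric] unfolding B_def by (rule critical_growth[OF f cv c iF iter(2)])
  qed
qed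

text \<open>Dissipation gives \<open>\<bar>det2 A\<bar> < 1\<close>, and this number is the squared
  modulus of every eigenvalue. Asymptotic stability is proved for the chart expression of the return
  map, which contracts an adapted norm, and is then carried back to the surface.\<close>

lemma critical_periodic_attracting:
  assumes f: "diffeo f" and x: "x \<in> \<Lambda>" and inv: "f ` \<Lambda> = \<Lambda>" and dis: "dissipative_on S f \<Lambda>"
    and c: "c \<in> charts_at S x" and n: "0 < n" and per: "(f ^^ n) x = x"
    and A: "A = chart_deriv c c (f ^^ n) x" "det2 A \<noteq> 0" "(trace2 A)\<^sup>2 \<le> 4 * det2 A \<or> trace2 A = 0"
    and eig: "\<And>z. eigenvalue_on (tangent_space S x) (tangent_map S (f ^^ n) x) z \<Longrightarrow> (cmod z)\<^sup>2 = \<bar>det2 A\<bar>"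
  shows "attracting_periodic_point S f n x"
proof -
  define F where "F = f ^^ n"
  have F: "diffeo F" "F x = x"
    using f per by (auto simp: F_def diffeo_funpow)
  have AF: "A = chart_deriv c c F x"
    by (simp add: A(1) F_def)
  have cF: "c \<in> charts_at S (F x)"
    using c F by simp
  define u w where "u = coord_vector S c x (axis 1 1)" and "w = coord_vector S c x (axis 2 1)"
  have uw: "u \<in> tangent_space S x" "w \<in> tangent_space S x" "0 < gram x u w"
    using gram_pos_iff[of u x w c] c
    by (simp_all add: u_def w_def coord_vector_in coord_vector_same cross_def axis_def)
  have "gram x (tangent_map S F x u) (tangent_map S F x w) = (det2 A)\<^sup>2 * gram x u w"
    using gram_tangent_map[OF diffeo_tdiff[OF F(1)] uw(1,2) c cF] gram_density_pos[OF c] by (simp add: F AF)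
  moreover have "gram x (tangent_map S F x u) (tangent_map S F x w) < gram x u w"
    using gram_dissipative[OF f dis inv x uw n] by (simp add: F(2) flip: F_def)
  ultimately have "(det2 A)\<^sup>2 < 1"
    using uw(3) by simp
  then have d1: "\<bar>det2 A\<bar> < 1"
    by (simp add: abs_square_less_1)
  have "cmod z < 1" if "eigenvalue_on (tangent_space S x) (tangent_map S (f ^^ n) x) z" for z
    using eig[OF that] d1 by (metis abs_norm_cancel abs_square_less_1)
  moreover have "\<exists>U. open U \<and> x \<in> U \<and> (\<forall>y\<in>U. (\<forall>k. (f ^^ (n * k)) y \<in> W) \<and> (\<lambda>k. (f ^^ (n * k)) y) \<longlonglongrightarrow> x)"
    if W: "open W" "x \<in> W" for W
  proof -
    have der: "(rep c c F has_derivative A) (at (cmap c x))"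
      unfolding AF by (rule rep_has_derivative[OF diffeo_tdiff[OF F(1)] c cF])
    \<comment> \<open>Points of \<open>W\<close> that remain in the chart after one application of
      \<open>F\<close>; there the chart expression and \<open>F\<close> are genuinely
      conjugate.\<close>
    define W' where "W' = cdom c \<inter> F -` cdom c \<inter> W"
    have contF: "continuous_on UNIV F"
      using F(1) by (auto simp: continuous_on_eq_continuous_at diffeo_def tdiff_def)
    have W': "open W'" "x \<in> W'" "W' \<subseteq> cdom c"
      using W c F(2) charts_atD[of c x] chartD(1)[of c] open_vimage[OF _ contF, of "cdom c"]
      by (auto simp: W'_def)
    then have "open (cmap c ` W')" "cmap c x \<in> cmap c ` W'"
      using open_cmap_image charts_atD[OF c] c by (auto dest: charts_atD)
    then obtain \<epsilon> where \<epsilon>: "0 < \<epsilon>" "ball (cmap c x) \<epsilon> \<subseteq> cmap c ` W'"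
      by (meson openE)
    obtain N :: "real^2 \<Rightarrow> real^2" and \<sigma> where N: "linear N" "0 \<le> \<sigma>" "\<sigma> < 1"
      "\<And>a. norm (A a, N (A a)) \<le> \<sigma> * norm (a, N a)"
      using contracting_graph_norm[of A] A(2,3) d1 linear_chart_deriv[OF diffeo_tdiff[OF F(1)] c cF] AF by blast
    define \<phi> where "\<phi> = rep c c F"
    obtain U where U: "open U" "cmap c x \<in> U" "U \<subseteq> ball (cmap c x) \<epsilon>" "\<phi> ` U \<subseteq> U"
      "\<And>q. q \<in> U \<Longrightarrow> (\<lambda>k. (\<phi> ^^ k) q) \<longlonglongrightarrow> cmap c x"
      using local_contraction[OF der[folded \<phi>_def] _ N \<epsilon>(1)] c F(2) by (auto simp: cinv_cmap \<phi>_def)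
    have UW: "cinv c q \<in> W'" "cmap c (cinv c q) = q" if "q \<in> U" for q
      using that U(3) \<epsilon>(2) W'(3) cinv_cmap[of c] c by (auto simp: charts_at_def dest!: subsetD)
    \<comment> \<open>Conjugacy persists for all times because \<open>U\<close> is forward
      invariant.\<close>
    have iter: "(F ^^ k) (cinv c q) = cinv c ((\<phi> ^^ k) q) \<and> (\<phi> ^^ k) q \<in> U" if "q \<in> U" for k q
    proof (induction k)
      case (Suc k)
      let ?q = "(\<phi> ^^ k) q"
      have "F (cinv c ?q) \<in> cdom c"
        using UW(1) Suc by (auto simp: W'_def)
      then have "cinv c (cmap c (F (cinv c ?q))) = F (cinv c ?q)"
        using c by (intro cinv_cmap) (auto simp: charts_at_def)
      then have "cinv c (\<phi> ?q) = F (cinv c ?q)"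
        by (simp add: \<phi>_def)
      then show ?case
        using Suc U(4) by auto
    qed (use that in simp)
    define V where "V = cdom c \<inter> cmap c -` U"
    have "openin (top_of_set (cdom c)) V"
      unfolding V_def using chartD(3)[of c] c U(1)
      by (intro continuous_openin_preimage_gen) (auto simp: charts_at_def homeomorphism_def)
    then have "open V"
      using chartD(1)[of c] c by (auto simp: charts_at_def openin_open_eq)
    moreover have "x \<in> V"
      using c U(2) by (auto simp: V_def charts_at_def)
    moreover have "(F ^^ k) y \<in> W \<and> (\<lambda>k. (F ^^ k) y) \<longlonglongrightarrow> x" if "y \<in> V" for y k
    proof
      have q: "cmap c y \<in> U" "cinv c (cmap c y) = y"
        using that c by (auto simp: V_def charts_at_def cinv_cmap)
      show "(F ^^ k) y \<in> W"
        using iter[OF q(1), of k] UW(1) q(2) by (auto simp: W'_def)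
      have "(\<lambda>k. cinv c ((\<phi> ^^ k) (cmap c y))) \<longlonglongrightarrow> cinv c (cmap c x)"
        by (rule isCont_tendsto_compose[OF isCont_cinv[OF c] U(5)[OF q(1)]])
      then show "(\<lambda>k. (F ^^ k) y) \<longlonglongrightarrow> x"
        using iter[OF q(1)] q(2) cinv_cmap[OF c] by simp
    qed
    moreover have "f ^^ (n * k) = F ^^ k" for k
      by (simp add: F_def funpow_mult)
    ultimately show ?thesis
      by auto
  qed
  ultimately show ?thesis
    unfolding attracting_periodic_point_def using n per by blast
qed

theorem critical_periodic_point:
  assumes f: "diffeo f" and crit: "x \<in> Crit S f \<Lambda>" and inv: "f ` \<Lambda> = \<Lambda>"
    and n: "0 < n" and per: "(f ^^ n) x = x"
  defines "V \<equiv> tangent_space S x" and "L \<equiv> tangent_map S (f ^^ n) x"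
  shows "homothety_on V L \<or> elliptic_on V L \<or> parabolic_on V L"
    and "eigenvalue_on V L z \<Longrightarrow> eigenvalue_on V L z' \<Longrightarrow> cmod z = cmod z'"
    and "dissipative_on S f \<Lambda> \<Longrightarrow> attracting_periodic_point S f n x"
proof -
  obtain v where v: "critical_direction S f x v" and x: "x \<in> \<Lambda>"
    using crit by (auto simp: Crit_def)
  obtain c where c: "c \<in> charts_at S x"
    using charts_at_nonempty .
  define A where "A = chart_deriv c c (f ^^ n) x"
  note A = critical_periodic_moduli[OF f v c per, folded A_def]
  note td = diffeo_tdiff[OF diffeo_funpow[OF f, of n], of x]
  have linA: "linear A"
    unfolding A_def using c per by (intro linear_chart_deriv[OF td]) auto
  have LV: "L u \<in> V" if "u \<in> V" for u
    using tangent_map_in[OF td] that by (simp add: V_def L_def per)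
  have LA: "L u c = A (u c)" if "u \<in> V" for u
    using tangent_map_nth[OF td _ c, of u c] that c by (simp add: V_def L_def A_def per)
  have V: "subspace V"
    unfolding V_def by (rule subspace_tangent_space)
  have lin: "L (a *\<^sub>R u + b *\<^sub>R w) = a *\<^sub>R L u + b *\<^sub>R L w" if "u \<in> V" "w \<in> V" for u w a b
    using tangent_map_lincomb[OF td] that by (simp add: V_def L_def)
  have ch: "L (L u) = trace2 A *\<^sub>R L u - det2 A *\<^sub>R u" if "u \<in> V" for u
  proof (rule tangent_space_eqI[OF _ _ c])
    show "L (L u) c = (trace2 A *\<^sub>R L u - det2 A *\<^sub>R u) c"
      using that LV cayley_hamilton_plane[OF linA, of "u c"] by (simp add: LA scaleR_fun_def)
  qed (use that LV V in \<open>auto simp: V_def intro: subspace_diff subspace_scale\<close>)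
  show "homothety_on V L \<or> elliptic_on V L \<or> parabolic_on V L"
    using equal_moduli_classification[OF V linear_nth, of c L A] bij_betw_tangent_nth[OF c] LV linA LA A
    by (simp add: V_def)
  have eig: "(cmod z)\<^sup>2 = \<bar>det2 A\<bar>" if "eigenvalue_on V L z" for z
    by (rule eigenvalue_on_modulus[OF lin ch A(2) that])
  show "cmod z = cmod z'" if "eigenvalue_on V L z" "eigenvalue_on V L z'"
    using eig[OF that(1)] eig[OF that(2)] by (metis norm_ge_zero power2_eq_imp_eq)
  show "attracting_periodic_point S f n x" if "dissipative_on S f \<Lambda>"
    by (rule critical_periodic_attracting[OF f x inv that c n per A_def A eig]) (simp add: V_def L_def)
qed

section \<open>Continuity of the tangent map in the C1 topology\<close>

abbreviation C1_nhds :: "('m \<Rightarrow> 'm) \<Rightarrow> ('m \<Rightarrow> 'm) filter"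
  where "C1_nhds f \<equiv> nhdsin (C1_topology S) f"

lemma openin_C1_close_set:
  assumes "f \<in> Diff1 S" "c \<in> charts S" "d \<in> charts S" "compact K" "K \<subseteq> cdom c" "f ` K \<subseteq> cdom d" "0 < e"
  shows "openin (C1_topology S) (C1_close_set S f c d K e)"
  unfolding C1_topology_def by (rule topology_generated_by_Basis) (use assms in blast)

lemma in_C1_close_set:
  assumes "f \<in> Diff1 S" "f ` K \<subseteq> cdom d" "0 < e"
  shows "f \<in> C1_close_set S f c d K e"
  using assms by (simp add: C1_close_set_def onorm_zero)

text \<open>For an empty \<open>K\<close> the closeness conditions are vacuous, so
  \<open>Diff1 S\<close> is itself one of the generating sets.\<close>

lemma openin_Diff1: "openin (C1_topology S) (Diff1 S)"
proof (cases "Diff1 S = {}")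
  case False
  then obtain f where f: "f \<in> Diff1 S"
    by blast
  obtain c where "c \<in> charts S"
    using charts_at_nonempty charts_atD by metis
  then have "openin (C1_topology S) (C1_close_set S f c c {} 1)"
    using f by (intro openin_C1_close_set) auto
  then show ?thesis
    by (simp add: C1_close_set_def)
qed simp

lemma Diff1_topspace: "f \<in> Diff1 S \<Longrightarrow> f \<in> topspace (C1_topology S)"
  using openin_Diff1 openin_subset by blast

lemma eventually_C1_nhds:
  assumes "f \<in> Diff1 S"
  shows "eventually P (C1_nhds f) \<longleftrightarrow> (\<exists>\<V>. openin (C1_topology S) \<V> \<and> f \<in> \<V> \<and> (\<forall>h\<in>\<V>. P h))"
  using Diff1_topspace[OF assms] by (simp add: eventually_nhdsin)

text \<open>The generators of the C1 topology control maps only over compact subsets of chart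
  domains; such a set must contain all points near \<open>x\<close>.\<close>

lemma compact_chart_neighbourhood:
  assumes c: "c \<in> charts_at S x" and W: "open W" "x \<in> W"
  obtains K where "compact K" "K \<subseteq> W" "K \<subseteq> cdom c" "\<forall>\<^sub>F y in nhds x. y \<in> K"
proof -
  have cS: "c \<in> charts S" "x \<in> cdom c"
    using c by (auto simp: charts_at_def)
  have "open (cmap c ` (W \<inter> cdom c))"
    using cS W chartD(1) by (intro open_cmap_image) auto
  moreover have "cmap c x \<in> cmap c ` (W \<inter> cdom c)"
    using cS W by blast
  ultimately obtain r where r: "0 < r" "cball (cmap c x) r \<subseteq> cmap c ` (W \<inter> cdom c)"
    by (meson open_contains_cball)
  define K where "K = cinv c ` cball (cmap c x) r"
  have inv: "cinv c (cmap c y) = y" if "y \<in> cdom c" for y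
    using cS that by (intro cinv_cmap) (auto simp: charts_at_def)
  have "continuous_on (cball (cmap c x) r) (cinv c)"
    using homeomorphism_cont2[OF chartD(3)[OF cS(1)]] by (rule continuous_on_subset) (use r(2) in blast)
  then have "compact K"
    unfolding K_def by (intro compact_continuous_image compact_cball)
  moreover have "K \<subseteq> W \<inter> cdom c"
    using r(2) inv by (fastforce simp: K_def)
  moreover have "\<forall>\<^sub>F y in nhds x. y \<in> K"
  proof -
    have "\<forall>\<^sub>F y in nhds x. cmap c y \<in> ball (cmap c x) r"
      using r(1) by (intro eventually_in_open isCont_cmap[OF c]) auto
    moreover have "\<forall>\<^sub>F y in nhds x. y \<in> cdom c"
      using cS chartD(1) by (intro eventually_nhds_in_open) auto
    ultimately show ?thesis
    proof eventually_elim
      case (elim y)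
      then show ?case
        unfolding K_def using inv[of y] by (intro image_eqI[of _ _ "cmap c y"]) auto
    qed
  qed
  ultimately show thesis
    using that by blast
qed

lemma chart_deriv_tendsto:
  assumes f: "C1_map S f" and c: "c \<in> charts_at S x" and d: "d \<in> charts_at S (f x)"
  shows "((\<lambda>y. chart_deriv c d f y a) \<longlongrightarrow> chart_deriv c d f x a) (nhds x)"
proof -
  have cd: "c \<in> charts S" "x \<in> cdom c" "d \<in> charts S" "f x \<in> cdom d"
    using c d by (auto simp: charts_at_def)
  define X where "X = cmap c ` (cdom c \<inter> f -` cdom d)"
  have contf: "continuous_on UNIV f"
    using f by (simp add: C1_map_def)
  have "open X"
    unfolding X_def using cd chartD(1) open_vimage[OF chartD(1)[OF cd(3)] contf]
    by (intro open_cmap_image) auto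
  moreover have "cmap c x \<in> X"
    using cd by (auto simp: X_def)
  moreover have "Ck_on 1 X (rep c d f)"
    using f cd unfolding C1_map_def X_def by blast
  then have "continuous_on X (\<lambda>p. frechet_derivative (rep c d f) (at p) a)"
    by (simp only: One_nat_def Ck_on.simps)
  ultimately have "isCont (\<lambda>p. frechet_derivative (rep c d f) (at p) a) (cmap c x)"
    by (simp add: continuous_on_eq_continuous_at)
  then have "isCont (\<lambda>y. chart_deriv c d f y a) x"
    unfolding chart_deriv_def by (rule isCont_o2[OF isCont_cmap[OF c]])
  then show ?thesis
    by (rule isCont_nhds)
qed

text \<open>Map and base point move together. The generating set over a compact neighbourhood
  compares \<open>H z\<close> with \<open>f\<close> at the same point \<open>Y z\<close>; continuity
  of \<open>f\<close> and of its derivative compares \<open>Y z\<close> with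
  \<open>x\<close>.\<close>

lemma C1_tendsto_step:
  assumes f: "f \<in> Diff1 S" and H: "filterlim H (C1_nhds f) F" and Y: "(Y \<longlongrightarrow> x) F"
    and c: "c \<in> charts_at S x" and d: "d \<in> charts_at S (f x)" and e: "0 < e"
  shows "\<forall>\<^sub>F z in F. H z \<in> Diff1 S \<and> c \<in> charts_at S (Y z) \<and> d \<in> charts_at S (H z (Y z)) \<and>
    norm (cmap d (H z (Y z)) - cmap d (f x)) < e \<and>
    (\<forall>a. norm (chart_deriv c d (H z) (Y z) a - chart_deriv c d f x a) \<le> e * norm a)"
proof -
  have cd: "c \<in> charts S" "x \<in> cdom c" "d \<in> charts S" "f x \<in> cdom d"
    using c d by (auto simp: charts_at_def)
  have f1: "C1_map S f"
    using f by (simp add: Diff1_def)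
  then have contf: "continuous_on UNIV f"
    by (simp add: C1_map_def)
  obtain K where K: "compact K" "K \<subseteq> f -` cdom d" "K \<subseteq> cdom c" "\<forall>\<^sub>F y in nhds x. y \<in> K"
    using compact_chart_neighbourhood[OF c open_vimage[OF chartD(1)[OF cd(3)] contf]] cd by blast
  have "\<forall>\<^sub>F h in C1_nhds f. h \<in> C1_close_set S f c d K (e / 2)"
    unfolding eventually_C1_nhds[OF f] using f cd K e
    by (intro exI[of _ "C1_close_set S f c d K (e / 2)"] conjI openin_C1_close_set in_C1_close_set) auto
  then have 1: "\<forall>\<^sub>F z in F. H z \<in> C1_close_set S f c d K (e / 2)"
    by (rule eventually_compose_filterlim[OF _ H])
  have 2: "\<forall>\<^sub>F z in F. Y z \<in> K"
    by (rule eventually_compose_filterlim[OF K(4) Y])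
  have "isCont (\<lambda>y. cmap d (f y)) x"
    using contf by (intro isCont_o2[where f = f and g = "cmap d", OF _ isCont_cmap[OF d]]) (simp add: continuous_on_eq_continuous_at)
  then have "((\<lambda>y. cmap d (f y)) \<longlongrightarrow> cmap d (f x)) (nhds x)"
    by (rule isCont_nhds)
  from filterlim_compose[OF this Y] have 3: "\<forall>\<^sub>F z in F. dist (cmap d (f (Y z))) (cmap d (f x)) < e / 2"
    using e by (intro tendstoD) auto
  \<comment> \<open>Two basis vectors with error \<open>e / 4\<close> each give operator norm error
    \<open>e / 2\<close>, the share left by the generating set.\<close>
  have 4: "\<forall>\<^sub>F z in F. dist (chart_deriv c d f (Y z) a) (chart_deriv c d f x a) < e / 4" for a
    using filterlim_compose[OF chart_deriv_tendsto[OF f1 c d] Y] e by (intro tendstoD) auto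
  from 1 2 3 4[of "axis 1 1"] 4[of "axis 2 1"] show ?thesis
  proof eventually_elim
    case (elim z)
    define h y where "h = H z" and "y = Y z"
    have h: "h \<in> Diff1 S" "h ` K \<subseteq> cdom d" and y: "y \<in> K"
      using elim by (auto simp: h_def y_def C1_close_set_def)
    have cy: "c \<in> charts_at S y" and dhy: "d \<in> charts_at S (h y)" and dfy: "d \<in> charts_at S (f y)"
      using K y h cd by (auto simp: charts_at_def)
    have close: "norm (rep c d h (cmap c y) - rep c d f (cmap c y)) < e / 2"
      "onorm (\<lambda>a. chart_deriv c d h y a - chart_deriv c d f y a) < e / 2"
      using elim(1) y by (auto simp: C1_close_set_def chart_deriv_def h_def)
    have lin: "linear (chart_deriv c d h y)" "linear (chart_deriv c d f y)" "linear (chart_deriv c d f x)"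
      using cy dhy dfy c d h f by (auto intro!: linear_chart_deriv diffeo_tdiff diffeo_Diff1)
    have "norm (cmap d (h y) - cmap d (f x)) \<le> norm (cmap d (h y) - cmap d (f y)) + norm (cmap d (f y) - cmap d (f x))"
      by (rule order_trans[OF _ norm_triangle_ineq]) simp
    also have "\<dots> < e / 2 + e / 2"
      using close(1) elim(3) cy by (intro add_strict_mono) (auto simp: cinv_cmap dist_norm y_def)
    finally have pos: "norm (cmap d (h y) - cmap d (f x)) < e"
      by simp
    have "norm (chart_deriv c d h y a - chart_deriv c d f x a) \<le> e * norm a" for a
    proof -
      have "linear (\<lambda>a. chart_deriv c d h y a - chart_deriv c d f y a)"
        by (intro linear_compose_sub lin)
      then have "norm (chart_deriv c d h y a - chart_deriv c d f y a) \<le> onorm (\<lambda>a. chart_deriv c d h y a - chart_deriv c d f y a) * norm a"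
        by (intro onorm) (simp add: linear_conv_bounded_linear)
      also have "\<dots> \<le> e / 2 * norm a"
        using close(2) by (intro mult_right_mono) auto
      finally have A: "norm (chart_deriv c d h y a - chart_deriv c d f y a) \<le> e / 2 * norm a" .
      have "linear (\<lambda>a. chart_deriv c d f y a - chart_deriv c d f x a)"
        by (intro linear_compose_sub lin)
      note linear_plane_bound[OF this, of a]
      also have "(norm (chart_deriv c d f y (axis 1 1) - chart_deriv c d f x (axis 1 1)) +
          norm (chart_deriv c d f y (axis 2 1) - chart_deriv c d f x (axis 2 1))) * norm a \<le> (e / 4 + e / 4) * norm a"
        using elim(4,5) by (intro mult_right_mono add_mono) (auto simp: dist_norm y_def)
      finally have B: "norm (chart_deriv c d f y a - chart_deriv c d f x a) \<le> e / 2 * norm a"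
        by simp
      have "norm (chart_deriv c d h y a - chart_deriv c d f x a) \<le>
          norm (chart_deriv c d h y a - chart_deriv c d f y a) + norm (chart_deriv c d f y a - chart_deriv c d f x a)"
        by (rule order_trans[OF _ norm_triangle_ineq]) simp
      also have "\<dots> \<le> e / 2 * norm a + e / 2 * norm a"
        using A B by (rule add_mono)
      finally show ?thesis
        by simp
    qed
    then show ?case
      using h(1) cy dhy pos by (simp add: h_def y_def)
  qed
qed

lemma C1_tendsto_deriv:
  assumes "f \<in> Diff1 S" "filterlim H (C1_nhds f) F" "(Y \<longlongrightarrow> x) F"
    and "c \<in> charts_at S x" "d \<in> charts_at S (f x)"
  shows "linear_tendsto F (\<lambda>z. chart_deriv c d (H z) (Y z)) (chart_deriv c d f x)"
  unfolding linear_tendsto_def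
proof (intro allI impI)
  fix e :: real assume "0 < e"
  from C1_tendsto_step[OF assms this]
  show "\<forall>\<^sub>F z in F. \<forall>a. norm (chart_deriv c d (H z) (Y z) a - chart_deriv c d f x a) \<le> e * norm a"
    by eventually_elim blast
qed

lemma C1_tendsto_apply:
  assumes f: "f \<in> Diff1 S" and H: "filterlim H (C1_nhds f) F" and Y: "(Y \<longlongrightarrow> x) F"
  shows "((\<lambda>z. H z (Y z)) \<longlongrightarrow> f x) F"
proof -
  obtain c d where c: "c \<in> charts_at S x" and d: "d \<in> charts_at S (f x)"
    using charts_at_nonempty by metis
  note step = C1_tendsto_step[OF f H Y c d]
  have "((\<lambda>z. cmap d (H z (Y z))) \<longlongrightarrow> cmap d (f x)) F"
  proof (rule tendstoI)
    fix e :: real assume "0 < e"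
    from step[OF this] show "\<forall>\<^sub>F z in F. dist (cmap d (H z (Y z))) (cmap d (f x)) < e"
      by eventually_elim (simp add: dist_norm)
  qed
  then have "((\<lambda>z. cinv d (cmap d (H z (Y z)))) \<longlongrightarrow> cinv d (cmap d (f x))) F"
    by (rule isCont_tendsto_compose[OF isCont_cinv[OF d]])
  then show ?thesis
    unfolding cinv_cmap[OF d]
  proof (rule Lim_transform_eventually)
    from step[OF zero_less_one] show "\<forall>\<^sub>F z in F. cinv d (cmap d (H z (Y z))) = H z (Y z)"
      by eventually_elim (simp add: cinv_cmap)
  qed
qed

lemma eventually_Diff1:
  assumes f: "f \<in> Diff1 S" and H: "filterlim H (C1_nhds f) F"
  shows "\<forall>\<^sub>F z in F. H z \<in> Diff1 S"
proof -
  have "\<forall>\<^sub>F h in C1_nhds f. h \<in> Diff1 S"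
    unfolding eventually_C1_nhds[OF f] using f openin_Diff1 by blast
  then show ?thesis
    by (rule eventually_compose_filterlim[OF _ H])
qed

text \<open>Off a neighbourhood of \<open>f\<^sup>-\<^sup>1(x)\<close>, the values of \<open>f\<close> avoid \<open>x\<close>; by compactness so do the
  values of all nearby maps.\<close>

lemma C1_tendsto_inv_apply:
  assumes f: "f \<in> Diff1 S" and H: "filterlim H (C1_nhds f) F" and Y: "(Y \<longlongrightarrow> x) F"
  shows "((\<lambda>z. inv (H z) (Y z)) \<longlongrightarrow> inv f x) F"
proof (rule topological_tendstoI)
  fix N assume N: "open N" "inv f x \<in> N"
  have "compact (- N)"
    using compact_diff[OF compact_M N(1)] by (simp add: Compl_eq_Diff_UNIV)
  moreover have "\<forall>\<^sub>F zq in F \<times>\<^sub>F nhds p. H (fst zq) (snd zq) \<noteq> Y (fst zq)" if "p \<in> - N" for p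
  proof -
    have "f p \<noteq> x"
      using that N f by (auto simp: Diff1_def bij_is_inj)
    then obtain A B where AB: "open A" "open B" "f p \<in> A" "x \<in> B" "A \<inter> B = {}"
      using hausdorff by metis
    have "filterlim (\<lambda>zq. H (fst zq)) (C1_nhds f) (F \<times>\<^sub>F nhds p)"
      by (rule filterlim_compose[OF H filterlim_fst])
    from C1_tendsto_apply[OF f this filterlim_snd]
    have "\<forall>\<^sub>F zq in F \<times>\<^sub>F nhds p. H (fst zq) (snd zq) \<in> A"
      using AB(1,3) by (rule topological_tendstoD)
    moreover have "\<forall>\<^sub>F zq in F \<times>\<^sub>F nhds p. Y (fst zq) \<in> B"
      by (rule topological_tendstoD[OF filterlim_compose[OF Y filterlim_fst] AB(2,4)])
    ultimately show ?thesis
      by eventually_elim (use AB in auto)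
  qed
  ultimately obtain V where V: "open V" "- N \<subseteq> V" "\<forall>\<^sub>F z in F. \<forall>q\<in>V. H z q \<noteq> Y z"
    by (rule eventually_nhds_compact)
  from eventually_Diff1[OF f H] V(3) show "\<forall>\<^sub>F z in F. inv (H z) (Y z) \<in> N"
  proof eventually_elim
    case (elim z)
    then have "H z (inv (H z) (Y z)) = Y z"
      by (simp add: Diff1_def bij_is_surj surj_f_inv_f)
    then show ?case
      using elim V(2) by blast
  qed
qed

text \<open>Tangent spaces at different points share only their coordinates, so convergence is read
  off in one chart \<open>c\<close> around the limit point.\<close>

definition tangent_tendsto ::
  "'m chart \<Rightarrow> 'z filter \<Rightarrow> ('z \<Rightarrow> 'm) \<Rightarrow> ('z \<Rightarrow> 'm tvec) \<Rightarrow> 'm \<Rightarrow> 'm tvec \<Rightarrow> bool" where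
  "tangent_tendsto c F Y A x u \<longleftrightarrow> c \<in> charts_at S x \<and> (Y \<longlongrightarrow> x) F \<and>
     (\<forall>\<^sub>F z in F. A z \<in> tangent_space S (Y z)) \<and> u \<in> tangent_space S x \<and> ((\<lambda>z. A z c) \<longlongrightarrow> u c) F"

lemma tangent_tendsto_forward:
  assumes A: "tangent_tendsto c F Y A x u" and f: "f \<in> Diff1 S" and H: "filterlim H (C1_nhds f) F"
    and d: "d \<in> charts_at S (f x)"
  shows "tangent_tendsto d F (\<lambda>z. H z (Y z)) (\<lambda>z. tangent_map S (H z) (Y z) (A z)) (f x) (tangent_map S f x u)"
proof -
  have c: "c \<in> charts_at S x" and Y: "(Y \<longlongrightarrow> x) F" and Ain: "\<forall>\<^sub>F z in F. A z \<in> tangent_space S (Y z)"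
    and u: "u \<in> tangent_space S x" and lim: "((\<lambda>z. A z c) \<longlongrightarrow> u c) F"
    using A by (auto simp: tangent_tendsto_def)
  note tf = diffeo_tdiff[OF diffeo_Diff1[OF f], of x]
  have ev: "\<forall>\<^sub>F z in F. tangent_map S (H z) (Y z) (A z) \<in> tangent_space S (H z (Y z)) \<and>
    chart_deriv c d (H z) (Y z) (A z c) = tangent_map S (H z) (Y z) (A z) d"
    using C1_tendsto_step[OF f H Y c d zero_less_one] Ain
  proof eventually_elim
    case (elim z)
    then have "tdiff (H z) (Y z)"
      by (auto intro: diffeo_tdiff diffeo_Diff1)
    with elim show ?case
      by (simp add: tangent_map_in tangent_map_nth[of "H z" "Y z" "A z" c d])
  qed
  have "((\<lambda>z. chart_deriv c d (H z) (Y z) (A z c)) \<longlongrightarrow> chart_deriv c d f x (u c)) F"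
    by (rule linear_tendsto_apply[OF linear_chart_deriv[OF tf c d] C1_tendsto_deriv[OF f H Y c d] lim])
  then have "((\<lambda>z. tangent_map S (H z) (Y z) (A z) d) \<longlongrightarrow> tangent_map S f x u d) F"
    unfolding tangent_map_nth[OF tf u c d]
    by (rule Lim_transform_eventually) (use ev in \<open>auto elim: eventually_mono\<close>)
  then show ?thesis
    unfolding tangent_tendsto_def using d C1_tendsto_apply[OF f H Y] tangent_map_in[OF tf u] ev
    by (auto elim: eventually_mono)
qed

text \<open>The derivative of \<open>inv (H z)\<close> is not controlled directly. The preimage
  vector is instead the solution of a linear system with the derivative of \<open>H z\<close> as
  matrix, and that derivative converges to an injective map.\<close>

lemma tangent_tendsto_backward:
  assumes A: "tangent_tendsto d F Y A x u" and f: "f \<in> Diff1 S" and H: "filterlim H (C1_nhds f) F"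
    and c: "c \<in> charts_at S (inv f x)"
  shows "tangent_tendsto c F (\<lambda>z. inv (H z) (Y z)) (\<lambda>z. tangent_map S (inv (H z)) (Y z) (A z))
    (inv f x) (tangent_map S (inv f) x u)"
proof -
  have d: "d \<in> charts_at S x" and Y: "(Y \<longlongrightarrow> x) F" and Ain: "\<forall>\<^sub>F z in F. A z \<in> tangent_space S (Y z)"
    and u: "u \<in> tangent_space S x" and lim: "((\<lambda>z. A z d) \<longlongrightarrow> u d) F"
    using A by (auto simp: tangent_tendsto_def)
  note df = diffeo_Diff1[OF f]
  define p where "p = inv f x"
  have fp: "f p = x"
    using diffeo_comp_inv(2)[OF df] by (simp add: p_def fun_eq_iff)
  have cp: "c \<in> charts_at S p" and dp: "d \<in> charts_at S (f p)"
    using c d fp by (auto simp: p_def)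
  define X where "X z = inv (H z) (Y z)" for z
  define B where "B z = tangent_map S (inv (H z)) (Y z) (A z)" for z
  define w where "w = tangent_map S (inv f) x u"
  have w: "w \<in> tangent_space S p"
    unfolding w_def p_def using u by (intro tangent_map_in diffeo_tdiff[OF diffeo_inv[OF df]])
  have X: "(X \<longlongrightarrow> p) F"
    unfolding X_def p_def by (rule C1_tendsto_inv_apply[OF f H Y])
  have solve: "B' \<in> tangent_space S (inv h y) \<and> chart_deriv c d h (inv h y) (B' c) = A' d"
    if "diffeo h" "A' \<in> tangent_space S y" "B' = tangent_map S (inv h) y A'"
      "c \<in> charts_at S (inv h y)" "d \<in> charts_at S y" for h y A' B'
  proof -
    have "B' \<in> tangent_space S (inv h y)"
      using that by (auto intro: tangent_map_in diffeo_tdiff diffeo_inv)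
    moreover have "tangent_map S h (inv h y) B' = A'"
      using tangent_map_inverse[OF diffeo_inv[OF that(1)] that(1) diffeo_comp_inv(2)[OF that(1)] that(2)] that(3) by simp
    moreover have "h (inv h y) = y"
      using diffeo_comp_inv(2)[OF that(1)] by (simp add: fun_eq_iff)
    ultimately show ?thesis
      using tangent_map_nth[OF diffeo_tdiff[OF that(1)], of B' "inv h y" c d] that(4,5) by simp
  qed
  have ev: "\<forall>\<^sub>F z in F. B z \<in> tangent_space S (X z) \<and> chart_deriv c d (H z) (X z) (B z c) = A z d"
    using C1_tendsto_step[OF f H X cp dp zero_less_one] Ain
  proof eventually_elim
    case (elim z)
    then have "H z (X z) = Y z"
      using diffeo_comp_inv(2)[OF diffeo_Diff1, of "H z"] by (simp add: fun_eq_iff X_def)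
    with elim show ?case
      using solve[OF diffeo_Diff1, of "H z" "A z" "Y z" "B z"] by (simp add: X_def B_def)
  qed
  have Mw: "chart_deriv c d f p (w c) = u d"
    using solve[OF df u w_def] c d by (simp add: p_def)
  have lin: "linear (chart_deriv c d f p)"
    by (rule linear_chart_deriv[OF diffeo_tdiff[OF df] cp dp])
  have "inj (chart_deriv c d f p)"
  proof (rule inj_on_inverseI[of _ "chart_deriv d c (inv f) x"])
    fix a
    have "inv f (f p) = p"
      by (simp only: fp p_def[symmetric])
    then show "chart_deriv d c (inv f) x (chart_deriv c d f p a) = a"
      using chart_deriv_compose[of f p "inv f" c d c a] cp dp chart_deriv_id_same[OF cp]
        diffeo_comp_inv(1)[OF df] diffeo_tdiff[OF df] diffeo_tdiff[OF diffeo_inv[OF df]] by (simp add: fp)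
  qed
  moreover have "((\<lambda>z. chart_deriv c d (H z) (X z) (B z c)) \<longlongrightarrow> chart_deriv c d f p (w c)) F"
    unfolding Mw using lim by (rule Lim_transform_eventually) (use ev in \<open>auto elim: eventually_mono\<close>)
  ultimately have "((\<lambda>z. B z c) \<longlongrightarrow> w c) F"
    by (rule linear_tendsto_solve[OF lin _ C1_tendsto_deriv[OF f H X cp dp]])
  then show ?thesis
    unfolding tangent_tendsto_def p_def[symmetric] X_def[symmetric] B_def[symmetric] w_def[symmetric]
    using cp X w ev by (auto elim: eventually_mono)
qed

lemma tangent_tendsto_cong:
  assumes "tangent_tendsto c F Y A x u" "\<forall>\<^sub>F z in F. A z = B z"
  shows "tangent_tendsto c F Y B x u"
proof -
  have "((\<lambda>z. B z c) \<longlongrightarrow> u c) F"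
    using assms by (intro Lim_transform_eventually[of "\<lambda>z. A z c" _ _ "\<lambda>z. B z c"])
      (auto simp: tangent_tendsto_def elim: eventually_mono)
  moreover have "\<forall>\<^sub>F z in F. B z \<in> tangent_space S (Y z)"
    using assms unfolding tangent_tendsto_def by (auto elim: eventually_elim2)
  ultimately show ?thesis
    using assms(1) by (simp add: tangent_tendsto_def)
qed

text \<open>The one-step statement is a hypothesis, so the same induction serves the maps and their
  inverses. The final chart \<open>d\<close> is chosen before the vectors, because
  \<open>conf_tendsto\<close> needs both vectors of a pair in one chart.\<close>

lemma tangent_tendsto_funpow:
  assumes step: "\<And>c Y A x u d. tangent_tendsto c F Y A x u \<Longrightarrow> d \<in> charts_at S (g x) \<Longrightarrow>
      tangent_tendsto d F (\<lambda>z. G z (Y z)) (\<lambda>z. tangent_map S (G z) (Y z) (A z)) (g x) (tangent_map S g x u)"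
    and g: "diffeo g" and G: "\<forall>\<^sub>F z in F. diffeo (G z)" and A: "tangent_tendsto c F Y A x u"
  shows "\<exists>d. \<forall>B w. tangent_tendsto c F Y B x w \<longrightarrow> tangent_tendsto d F (\<lambda>z. (G z ^^ k) (Y z))
    (\<lambda>z. tangent_map S (G z ^^ k) (Y z) (B z)) ((g ^^ k) x) (tangent_map S (g ^^ k) x w)"
proof (induction k)
  case 0
  have "tangent_tendsto c F Y (\<lambda>z. tangent_map S id (Y z) (B z)) x (tangent_map S id x w)"
    if B: "tangent_tendsto c F Y B x w" for B w
  proof -
    have w: "w \<in> tangent_space S x" and "\<forall>\<^sub>F z in F. B z \<in> tangent_space S (Y z)"
      using B by (auto simp: tangent_tendsto_def)
    from this(2) have "\<forall>\<^sub>F z in F. B z = tangent_map S id (Y z) (B z)"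
      by eventually_elim (simp add: tangent_map_id)
    from tangent_tendsto_cong[OF B this] show ?thesis
      by (simp only: tangent_map_id[OF w])
  qed
  then show ?case
    by (auto simp: id_def)
next
  case (Suc k)
  then obtain d where d: "\<And>B w. tangent_tendsto c F Y B x w \<Longrightarrow> tangent_tendsto d F (\<lambda>z. (G z ^^ k) (Y z))
    (\<lambda>z. tangent_map S (G z ^^ k) (Y z) (B z)) ((g ^^ k) x) (tangent_map S (g ^^ k) x w)"
    by blast
  obtain d' where d': "d' \<in> charts_at S (g ((g ^^ k) x))"
    using charts_at_nonempty .
  have "tangent_tendsto d' F (\<lambda>z. (G z ^^ Suc k) (Y z))
    (\<lambda>z. tangent_map S (G z ^^ Suc k) (Y z) (B z)) ((g ^^ Suc k) x) (tangent_map S (g ^^ Suc k) x w)"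
    if B: "tangent_tendsto c F Y B x w" for B w
  proof -
    have w: "w \<in> tangent_space S x" and Bin: "\<forall>\<^sub>F z in F. B z \<in> tangent_space S (Y z)"
      using B by (auto simp: tangent_tendsto_def)
    have comp: "tangent_map S (h ^^ Suc k) y v = tangent_map S h ((h ^^ k) y) (tangent_map S (h ^^ k) y v)"
      if "diffeo h" "v \<in> tangent_space S y" for h y v
      using tangent_map_compose[of "h ^^ k" y h v] that
      by (simp only: funpow.simps(2) diffeo_tdiff diffeo_funpow)
    have "\<forall>\<^sub>F z in F. tangent_map S (G z) ((G z ^^ k) (Y z)) (tangent_map S (G z ^^ k) (Y z) (B z)) =
        tangent_map S (G z ^^ Suc k) (Y z) (B z)"
      using G Bin by eventually_elim (simp only: comp)
    from tangent_tendsto_cong[OF step[OF d[OF B] d'] this] show ?thesis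
      unfolding comp[OF g w] by simp
  qed
  then show ?case by blast
qed

lemma int_iterate_pos: "0 \<le> n \<Longrightarrow> int_iterate UNIV h n = h ^^ nat n"
  and int_iterate_nonpos: "\<not> 0 \<le> n \<Longrightarrow> int_iterate UNIV h n = inv h ^^ nat (- n)"
  by (simp_all add: int_iterate_def)

lemma tangent_tendsto_int_iterate:
  assumes f: "f \<in> Diff1 S" and H: "filterlim H (C1_nhds f) F"
    and A: "tangent_tendsto c F Y A x u" and B: "tangent_tendsto c F Y B x w"
  obtains d where
    "tangent_tendsto d F (\<lambda>z. int_iterate UNIV (H z) n (Y z)) (\<lambda>z. tangent_map S (int_iterate UNIV (H z) n) (Y z) (A z))
      (int_iterate UNIV f n x) (tangent_map S (int_iterate UNIV f n) x u)"
    "tangent_tendsto d F (\<lambda>z. int_iterate UNIV (H z) n (Y z)) (\<lambda>z. tangent_map S (int_iterate UNIV (H z) n) (Y z) (B z))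
      (int_iterate UNIV f n x) (tangent_map S (int_iterate UNIV f n) x w)"
proof -
  have G: "\<forall>\<^sub>F z in F. diffeo (H z)" "\<forall>\<^sub>F z in F. diffeo (inv (H z))"
    using eventually_Diff1[OF f H] by (auto elim!: eventually_mono intro: diffeo_Diff1 diffeo_inv)
  note df = diffeo_Diff1[OF f]
  show thesis
  proof (cases "0 \<le> n")
    case True
    have "\<exists>d. \<forall>B w. tangent_tendsto c F Y B x w \<longrightarrow> tangent_tendsto d F (\<lambda>z. (H z ^^ nat n) (Y z))
      (\<lambda>z. tangent_map S (H z ^^ nat n) (Y z) (B z)) ((f ^^ nat n) x) (tangent_map S (f ^^ nat n) x w)"
      by (rule tangent_tendsto_funpow[OF _ df G(1) A]) (rule tangent_tendsto_forward[OF _ f H])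
    then obtain d where "\<And>B w. tangent_tendsto c F Y B x w \<Longrightarrow> tangent_tendsto d F (\<lambda>z. (H z ^^ nat n) (Y z))
      (\<lambda>z. tangent_map S (H z ^^ nat n) (Y z) (B z)) ((f ^^ nat n) x) (tangent_map S (f ^^ nat n) x w)"
      by blast
    from that[OF this[OF A, folded int_iterate_pos[OF True]] this[OF B, folded int_iterate_pos[OF True]]]
    show thesis .
  next
    case False
    have "\<exists>d. \<forall>B w. tangent_tendsto c F Y B x w \<longrightarrow> tangent_tendsto d F (\<lambda>z. (inv (H z) ^^ nat (- n)) (Y z))
      (\<lambda>z. tangent_map S (inv (H z) ^^ nat (- n)) (Y z) (B z)) ((inv f ^^ nat (- n)) x) (tangent_map S (inv f ^^ nat (- n)) x w)"
      by (rule tangent_tendsto_funpow[OF _ diffeo_inv[OF df] G(2) A]) (rule tangent_tendsto_backward[OF _ f H])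
    then obtain d where "\<And>B w. tangent_tendsto c F Y B x w \<Longrightarrow> tangent_tendsto d F (\<lambda>z. (inv (H z) ^^ nat (- n)) (Y z))
      (\<lambda>z. tangent_map S (inv (H z) ^^ nat (- n)) (Y z) (B z)) ((inv f ^^ nat (- n)) x) (tangent_map S (inv f ^^ nat (- n)) x w)"
      by blast
    from that[OF this[OF A, folded int_iterate_nonpos[OF False]] this[OF B, folded int_iterate_nonpos[OF False]]]
    show thesis .
  qed
qed

section \<open>Continuity of the metric and of kappa\<close>

lemma metric_form_tendsto:
  assumes "c \<in> charts_at S x"
  shows "((\<lambda>y. metric_form c y a b) \<longlongrightarrow> metric_form c x a b) (nhds x)"
proof -
  have c: "c \<in> charts S" "x \<in> cdom c"
    using assms by (auto simp: charts_at_def)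
  have "Ck_on 0 (cmap c ` cdom c)
      (\<lambda>p. metric S (cinv c p) (coord_vector S c (cinv c p) a) (coord_vector S c (cinv c p) b))"
    using riemannian c(1) unfolding riemannian_metric_def smooth_on_def by blast
  then have "continuous_on (cmap c ` cdom c) (\<lambda>p. metric_form c (cinv c p) a b)"
    by (simp add: metric_form_def)
  then have "isCont (\<lambda>p. metric_form c (cinv c p) a b) (cmap c x)"
    using c chartD(2) by (simp add: continuous_on_eq_continuous_at)
  then have "isCont (\<lambda>y. metric_form c (cinv c (cmap c y)) a b) x"
    by (rule isCont_o2[OF isCont_cmap[OF assms]])
  then have "((\<lambda>y. metric_form c (cinv c (cmap c y)) a b) \<longlongrightarrow> metric_form c x a b) (nhds x)"
    using isCont_nhds[of x "\<lambda>y. metric_form c (cinv c (cmap c y)) a b"] by (simp only: cinv_cmap[OF assms])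
  then show ?thesis
  proof (rule Lim_transform_eventually)
    have "\<forall>\<^sub>F y in nhds x. y \<in> cdom c"
      using c chartD(1) by (intro eventually_nhds_in_open) auto
    then show "\<forall>\<^sub>F y in nhds x. metric_form c (cinv c (cmap c y)) a b = metric_form c y a b"
      by eventually_elim (use c in \<open>simp add: cinv_cmap charts_at_def\<close>)
  qed
qed

lemma metric_tendsto:
  assumes A: "tangent_tendsto c F Y A x u" and B: "tangent_tendsto c F Y B x w"
  shows "((\<lambda>z. metric S (Y z) (A z) (B z)) \<longlongrightarrow> metric S x u w) F"
proof -
  have c: "c \<in> charts_at S x" and Y: "(Y \<longlongrightarrow> x) F"
    and in_T: "u \<in> tangent_space S x" "w \<in> tangent_space S x"
      "\<forall>\<^sub>F z in F. A z \<in> tangent_space S (Y z)" "\<forall>\<^sub>F z in F. B z \<in> tangent_space S (Y z)"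
    and lim: "((\<lambda>z. A z c) \<longlongrightarrow> u c) F" "((\<lambda>z. B z c) \<longlongrightarrow> w c) F"
    using A B by (auto simp: tangent_tendsto_def)
  have "\<forall>\<^sub>F y in nhds x. y \<in> cdom c"
    using c charts_atD chartD(1) by (intro eventually_nhds_in_open) auto
  then have ev: "\<forall>\<^sub>F z in F. Y z \<in> cdom c"
    by (rule eventually_compose_filterlim[OF _ Y])
  \<comment> \<open>The metric expanded in coordinates: this separates the three coefficient
    functions, which depend on the base point alone, from the coordinates of the two
    vectors.\<close>
  define E where "E y a b = a$1 * (b$1 * metric_form c y (axis 1 1) (axis 1 1) + b$2 * metric_form c y (axis 1 1) (axis 2 1))
      + a$2 * (b$1 * metric_form c y (axis 1 1) (axis 2 1) + b$2 * metric_form c y (axis 2 1) (axis 2 1))"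
    for y and a b :: "real^2"
  have E: "metric S y a b = E y (a c) (b c)"
    if "c \<in> charts_at S y" "a \<in> tangent_space S y" "b \<in> tangent_space S y" for y a b
    unfolding metric_eq_form[OF that(2,3,1)] E_def
    by (rule bilinear_plane_expand[OF metric_form(1,2)[OF that(1)]])
  have "((\<lambda>z. E (Y z) (A z c) (B z c)) \<longlongrightarrow> E x (u c) (w c)) F"
    unfolding E_def
    by (intro tendsto_intros lim filterlim_compose[OF metric_form_tendsto[OF c] Y])
  then show ?thesis
    unfolding E[OF c in_T(1,2)]
  proof (rule Lim_transform_eventually)
    show "\<forall>\<^sub>F z in F. E (Y z) (A z c) (B z c) = metric S (Y z) (A z) (B z)"
      using ev in_T(3,4)
    proof eventually_elim
      case (elim z)
      then have "c \<in> charts_at S (Y z)"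
        using c by (auto simp: charts_at_def)
      with elim show ?case
        by (simp add: E)
    qed
  qed
qed

lemma conf_tendsto:
  assumes A: "tangent_tendsto c F Y A x u" and B: "tangent_tendsto c F Y B x w" and u: "u \<noteq> 0"
  shows "((\<lambda>z. conf (Y z) (A z) (B z)) \<longlongrightarrow> conf x u w) F"
proof -
  have "metric S x u u \<noteq> 0"
    using A u metric_pos[of u x] by (auto simp: tangent_tendsto_def)
  then show ?thesis
    unfolding conf_def gram_def
    by (intro tendsto_intros metric_tendsto[OF A A] metric_tendsto[OF A B] metric_tendsto[OF B B])
qed

section \<open>Critical points are stable under perturbation\<close>

text \<open>The common factor \<open>s\<close> cancels in every value of \<open>conf\<close>, so
  criticality can be tested on a vector that is not normalised for the metric.\<close>

lemma critical_direction_scaled_iff: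
  assumes f: "diffeo f" and u: "u \<in> tangent_space S x" and w: "w \<in> tangent_space S x"
    and g: "0 < gram x u w" and s: "s \<noteq> 0" and unit: "s *\<^sub>R u \<in> unit_tangent_space S x"
  shows "critical_direction S f x (s *\<^sub>R u) \<longleftrightarrow> (\<forall>n. conf x u w \<le> conf (int_iterate UNIV f n x)
    (tangent_map S (int_iterate UNIV f n) x u) (tangent_map S (int_iterate UNIV f n) x w))"
proof -
  have "gram x (s *\<^sub>R u) (s *\<^sub>R w) = s ^ 4 * gram x u w"
    unfolding gram_def metric_scale[OF u u] metric_scale[OF u w] metric_scale[OF w w] by algebra
  then have "0 < gram x (s *\<^sub>R u) (s *\<^sub>R w)"
    using g s by (simp add: zero_less_mult_iff)
  note iff = critical_direction_iff[OF f unit tangent_scale[OF w] this]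
  have "tdiff (int_iterate UNIV f n) x" for n
    by (rule diffeo_tdiff[OF diffeo_int_iterate[OF f]])
  then show ?thesis
    unfolding iff using u w s by (simp add: conf_scale tangent_map_scale tangent_map_in)
qed

text \<open>A quarter turn of the coordinate plane. It supplies a companion vector that is
  independent of \<open>a\<close> and depends continuously on it, as \<open>conf\<close>
  requires.\<close>

definition rot :: "real^2 \<Rightarrow> real^2"
  where "rot a = vector [- (a$2), a$1]"

lemma cross_rot: "a \<noteq> 0 \<Longrightarrow> cross a (rot a) \<noteq> 0"
  by (simp add: cross_def rot_def vec_eq_iff forall_2 sum_squares_eq_zero_iff)

lemma tendsto_rot:
  assumes "(a \<longlongrightarrow> l) F"
  shows "((\<lambda>z. rot (a z)) \<longlongrightarrow> rot l) F"
proof (rule vec_tendstoI)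
  fix i :: 2
  show "((\<lambda>z. rot (a z) $ i) \<longlongrightarrow> rot l $ i) F"
    using exhaust_2[of i] by (auto simp: rot_def intro!: tendsto_minus tendsto_vec_nth[OF assms])
qed

lemma coord_frame:
  assumes "c \<in> charts_at S x" "a \<noteq> 0"
  shows "coord_vector S c x a \<in> tangent_space S x" "coord_vector S c x (rot a) \<in> tangent_space S x"
    and "0 < gram x (coord_vector S c x a) (coord_vector S c x (rot a))" "coord_vector S c x a \<noteq> 0"
proof -
  show in_T: "coord_vector S c x a \<in> tangent_space S x" "coord_vector S c x (rot a) \<in> tangent_space S x"
    using assms by (auto intro: coord_vector_in)
  show "0 < gram x (coord_vector S c x a) (coord_vector S c x (rot a))"
    using gram_pos_iff[OF in_T assms(1)] cross_rot[OF assms(2)] by (simp add: coord_vector_same assms(1))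
  show "coord_vector S c x a \<noteq> 0"
    using coord_vector_same[OF assms(1), of a] assms(2) by (metis zero_fun_apply)
qed

lemma not_critical_stable:
  assumes f: "f \<in> Diff1 S" and nc: "\<And>v. \<not> critical_direction S f x v"
  shows "\<forall>\<^sub>F hy in C1_nhds f \<times>\<^sub>F nhds x. \<forall>v. \<not> critical_direction S (fst hy) (snd hy) v"
proof -
  obtain c where c: "c \<in> charts_at S x"
    using charts_at_nonempty .
  \<comment> \<open>Failure of criticality in direction \<open>a\<close>, with companion
    \<open>rot a\<close>. Each single inequality is strict, hence stable; the time \<open>n\<close>
    may depend on \<open>a\<close>.\<close>
  define P where "P h y a \<longleftrightarrow> (\<exists>n. conf (int_iterate UNIV h n y)
      (tangent_map S (int_iterate UNIV h n) y (coord_vector S c y a))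
      (tangent_map S (int_iterate UNIV h n) y (coord_vector S c y (rot a)))
    < conf y (coord_vector S c y a) (coord_vector S c y (rot a)))" for h y a
  let ?F = "C1_nhds f \<times>\<^sub>F nhds x"
  have near_c: "\<forall>\<^sub>F y in nhds x. c \<in> charts_at S y"
  proof -
    have "\<forall>\<^sub>F y in nhds x. y \<in> cdom c"
      using c charts_atD chartD(1) by (intro eventually_nhds_in_open) auto
    then show ?thesis
      by eventually_elim (use c in \<open>auto simp: charts_at_def\<close>)
  qed
  have "\<forall>\<^sub>F hya in ?F \<times>\<^sub>F nhds a. P (fst (fst hya)) (snd (fst hya)) (snd hya)" if a: "a \<in> sphere 0 1" for a
  proof -
    let ?G = "?F \<times>\<^sub>F nhds a"
    define H Y V where "H = (\<lambda>hya :: (('m \<Rightarrow> 'm) \<times> 'm) \<times> (real^2). fst (fst hya))"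
      and "Y = (\<lambda>hya :: (('m \<Rightarrow> 'm) \<times> 'm) \<times> (real^2). snd (fst hya))"
      and "V = (\<lambda>hya :: (('m \<Rightarrow> 'm) \<times> 'm) \<times> (real^2). snd hya)"
    have H: "filterlim H (C1_nhds f) ?G" and Y: "(Y \<longlongrightarrow> x) ?G" and V: "(V \<longlongrightarrow> a) ?G"
      unfolding H_def Y_def V_def
      by (rule filterlim_compose[OF filterlim_fst filterlim_fst] filterlim_compose[OF filterlim_snd filterlim_fst]
          filterlim_snd)+
    have "a \<noteq> 0"
      using a by auto
    note frame = coord_frame[OF c this]
    define u w where "u = coord_vector S c x a" and "w = coord_vector S c x (rot a)"
    have ev: "\<forall>\<^sub>F z in ?G. c \<in> charts_at S (Y z)"
      by (rule eventually_compose_filterlim[OF near_c Y])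
    have lim: "tangent_tendsto c ?G Y (\<lambda>z. coord_vector S c (Y z) (b z)) x (coord_vector S c x l)"
      if b: "(b \<longlongrightarrow> l) ?G" for b l
    proof -
      have "((\<lambda>z. coord_vector S c (Y z) (b z) c) \<longlongrightarrow> coord_vector S c x l c) ?G"
        unfolding coord_vector_same[OF c] using b
        by (rule Lim_transform_eventually) (use ev in \<open>auto simp: coord_vector_same elim!: eventually_mono\<close>)
      then show ?thesis
        unfolding tangent_tendsto_def using c Y ev by (auto intro: coord_vector_in elim!: eventually_mono)
    qed
    \<comment> \<open>The normalisation is needed only to invoke the hypothesis on critical
      directions, which are unit vectors; the inequality obtained is again about \<open>u\<close>
      and \<open>w\<close>.\<close>
    define s where "s = 1 / tnorm S x u"
    have "s *\<^sub>R u \<in> unit_tangent_space S x"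
      unfolding s_def u_def by (rule normalize_unit[OF frame(1,4)])
    moreover from this have "s \<noteq> 0"
      using unit_nonzero by force
    ultimately obtain n where n: "conf (int_iterate UNIV f n x)
        (tangent_map S (int_iterate UNIV f n) x u) (tangent_map S (int_iterate UNIV f n) x w) < conf x u w"
      using nc[of "s *\<^sub>R u"] critical_direction_scaled_iff[OF diffeo_Diff1[OF f] frame(1,2,3), of s]
      unfolding u_def w_def by (meson not_le)
    note A = lim[OF V] and B = lim[OF tendsto_rot[OF V]]
    obtain d where d:
      "tangent_tendsto d ?G (\<lambda>z. int_iterate UNIV (H z) n (Y z))
        (\<lambda>z. tangent_map S (int_iterate UNIV (H z) n) (Y z) (coord_vector S c (Y z) (V z)))
        (int_iterate UNIV f n x) (tangent_map S (int_iterate UNIV f n) x u)"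
      "tangent_tendsto d ?G (\<lambda>z. int_iterate UNIV (H z) n (Y z))
        (\<lambda>z. tangent_map S (int_iterate UNIV (H z) n) (Y z) (coord_vector S c (Y z) (rot (V z))))
        (int_iterate UNIV f n x) (tangent_map S (int_iterate UNIV f n) x w)"
      unfolding u_def w_def by (rule tangent_tendsto_int_iterate[OF f H A B])
    have "tangent_map S (int_iterate UNIV f n) x u \<noteq> 0"
      unfolding u_def using frame by (intro tangent_map_nonzero diffeo_int_iterate diffeo_Diff1[OF f])
    note lim1 = conf_tendsto[OF d this]
    have lim2: "((\<lambda>z. conf (Y z) (coord_vector S c (Y z) (V z)) (coord_vector S c (Y z) (rot (V z)))) \<longlongrightarrow> conf x u w) ?G"
      unfolding u_def w_def by (rule conf_tendsto[OF A B frame(4)])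
    have "\<forall>\<^sub>F z in ?G. 0 < conf (Y z) (coord_vector S c (Y z) (V z)) (coord_vector S c (Y z) (rot (V z)))
        - conf (int_iterate UNIV (H z) n (Y z))
          (tangent_map S (int_iterate UNIV (H z) n) (Y z) (coord_vector S c (Y z) (V z)))
          (tangent_map S (int_iterate UNIV (H z) n) (Y z) (coord_vector S c (Y z) (rot (V z))))"
      using n by (intro order_tendstoD(1)[OF tendsto_diff[OF lim2 lim1]]) simp
    then show ?thesis
      unfolding P_def H_def Y_def V_def by eventually_elim (auto intro!: exI[of _ n])
  qed
  with compact_sphere obtain V where V: "open V" "sphere 0 1 \<subseteq> V" "\<forall>\<^sub>F hy in ?F. \<forall>a\<in>V. P (fst hy) (snd hy) a"
    by (rule eventually_nhds_compact)
  have "\<forall>\<^sub>F hy in ?F. c \<in> charts_at S (snd hy)"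
    by (rule eventually_compose_filterlim[OF near_c filterlim_snd])
  moreover have "\<forall>\<^sub>F hy in ?F. fst hy \<in> Diff1 S"
    by (rule eventually_Diff1[OF f filterlim_fst])
  ultimately show ?thesis
    using V(3)
  proof eventually_elim
    case (elim hy)
    define h y where "h = fst hy" and "y = snd hy"
    have cy: "c \<in> charts_at S y" and h: "diffeo h"
      using elim by (auto simp: h_def y_def diffeo_Diff1)
    have "\<not> critical_direction S h y v" for v
    proof
      assume crit: "critical_direction S h y v"
      then have v: "v \<in> unit_tangent_space S y" "v \<in> tangent_space S y" "v \<noteq> 0"
        using unit_nonzero by (auto simp: critical_direction_def unit_tangent_iff)
      have "v c \<noteq> 0"
        using v tangent_space_eqI[OF v(2) subspace_0[OF subspace_tangent_space] cy] by auto
      \<comment> \<open>A direction that is unit for the metric at \<open>y\<close> is rescaled to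
        the Euclidean unit circle of the chart, where the uniform statement holds.\<close>
      define s a where "s = norm (v c)" and "a = (1 / s) *\<^sub>R v c"
      have s: "s \<noteq> 0" and a: "a \<in> sphere 0 1" "a \<noteq> 0"
        using \<open>v c \<noteq> 0\<close> by (auto simp: s_def a_def)
      note frame = coord_frame[OF cy a(2)]
      have v_eq: "s *\<^sub>R coord_vector S c y a = v"
      proof (rule tangent_space_eqI[OF tangent_scale[OF frame(1)] v(2) cy])
        show "(s *\<^sub>R coord_vector S c y a) c = v c"
          using s by (simp add: scaleR_fun_def coord_vector_same[OF cy] a_def)
      qed
      have "P h y a"
        using elim(3) V(2) a(1) by (auto simp: h_def y_def)
      moreover have "\<not> P h y a"
        using critical_direction_scaled_iff[OF h frame(1,2,3) s] crit v(1)
        unfolding P_def v_eq by (auto simp: not_less)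
      ultimately show False by blast
    qed
    then show ?case
      by (simp add: h_def y_def)
  qed
qed

lemma not_critical_near:
  assumes f: "f \<in> Diff1 S" and nc: "\<And>v. \<not> critical_direction S f x v"
  shows "\<forall>\<^sub>F y in nhds x. \<forall>v. \<not> critical_direction S f y v"
proof -
  obtain Pf Pg where Pfg: "eventually Pf (C1_nhds f)" "eventually Pg (nhds x)"
    "\<And>h y. Pf h \<Longrightarrow> Pg y \<Longrightarrow> \<forall>v. \<not> critical_direction S h y v"
    using not_critical_stable[OF f nc] unfolding eventually_prod_filter by auto
  \<comment> \<open>The map \<open>f\<close> belongs to each of its own neighbourhoods, so it may be
    kept fixed.\<close>
  have "Pf f"
    using Pfg(1) unfolding eventually_C1_nhds[OF f] by blast
  with Pfg show ?thesis
    by (auto elim: eventually_mono)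
qed

theorem closed_Crit:
  assumes f: "f \<in> Diff1 S" and \<Lambda>: "compact \<Lambda>"
  shows "closed (Crit S f \<Lambda>)"
proof -
  have "\<exists>T. open T \<and> x \<in> T \<and> T \<subseteq> - Crit S f \<Lambda>" if x: "x \<in> - Crit S f \<Lambda>" for x
  proof (cases "x \<in> \<Lambda>")
    case True
    then have "\<forall>\<^sub>F y in nhds x. \<forall>v. \<not> critical_direction S f y v"
      using x by (intro not_critical_near[OF f]) (auto simp: Crit_def)
    then show ?thesis
      unfolding eventually_nhds by (auto simp: Crit_def)
  next
    case False
    then show ?thesis
      using compact_imp_closed[OF \<Lambda>] by (intro exI[of _ "- \<Lambda>"]) (auto simp: Crit_def)
  qed
  then have "open (- Crit S f \<Lambda>)"
    by (subst open_subopen) blast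
  then show ?thesis
    by (simp add: closed_def)
qed

theorem Crit_semicontinuous:
  assumes f: "f \<in> Diff1 S" and \<Lambda>: "compact \<Lambda>" and U: "open U" "Crit S f \<Lambda> \<subseteq> U"
  shows "\<exists>V \<V>. open V \<and> \<Lambda> \<subseteq> V \<and> openin (C1_topology S) \<V> \<and> f \<in> \<V> \<and>
    (\<forall>h\<in>\<V>. \<forall>\<Lambda>'. \<Lambda>' \<subseteq> V \<longrightarrow> Crit S h \<Lambda>' \<subseteq> U)"
proof -
  have "compact (\<Lambda> - U)"
    using \<Lambda> U(1) by (rule compact_diff)
  moreover have "\<forall>\<^sub>F hy in C1_nhds f \<times>\<^sub>F nhds x. \<forall>v. \<not> critical_direction S (fst hy) (snd hy) v"
    if "x \<in> \<Lambda> - U" for x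
    using that U(2) by (intro not_critical_stable[OF f]) (auto simp: Crit_def)
  ultimately obtain V where V: "open V" "\<Lambda> - U \<subseteq> V"
    "\<forall>\<^sub>F h in C1_nhds f. \<forall>y\<in>V. \<forall>v. \<not> critical_direction S h y v"
    by (rule eventually_nhds_compact)
  then obtain \<V> where "openin (C1_topology S) \<V>" "f \<in> \<V>" "\<forall>h\<in>\<V>. \<forall>y\<in>V. \<forall>v. \<not> critical_direction S h y v"
    unfolding eventually_C1_nhds[OF f] by blast
  \<comment> \<open>The neighbourhood of \<open>\<Lambda>\<close> is the union of \<open>U\<close>
    and \<open>V\<close>: points in \<open>V\<close> are not critical for nearby maps, and all
    others already lie in \<open>U\<close>.\<close>
  with V(1,2) U(1) show ?thesis
    by (intro exI[of _ "U \<union> V"] exI[of _ \<V>]) (auto simp: Crit_def)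
qed

end

theorem proposition8:
  fixes S :: "'m::t2_space surface" and f :: "'m \<Rightarrow> 'm" and \<Lambda> :: "'m set"
  assumes "compact_riemannian_surface S"
    and "f \<in> Diff1 S"
    and "compact \<Lambda>" and "f ` \<Lambda> = \<Lambda>"
  shows
    "(\<forall>c n. c \<in> Crit S f \<Lambda> \<and> 0 < n \<and> (f ^^ n) c = c \<longrightarrow>
        (let V = tangent_space S c; L = tangent_map S (f ^^ n) c in
          (homothety_on V L \<or> elliptic_on V L \<or> parabolic_on V L) \<and>
          (\<forall>z z'. eigenvalue_on V L z \<and> eigenvalue_on V L z' \<longrightarrow> cmod z = cmod z') \<and>
          (dissipative_on S f \<Lambda> \<longrightarrow> attracting_periodic_point S f n c)))
     \<and>
     (far_from_homotheties S f \<Lambda> \<longrightarrow>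
        \<not> (\<exists>c v. c \<in> Crit S f \<Lambda> \<and> critical_direction S f c v \<and>
             (\<forall>n::int. int_iterate UNIV f n c \<in> Crit S f \<Lambda> \<and>
                critical_direction S f (int_iterate UNIV f n c) (snd (proj_iterate S f n (c, v))))))
     \<and>
     (closed (Crit S f \<Lambda>) \<and>
      (\<forall>U. open U \<and> Crit S f \<Lambda> \<subseteq> U \<longrightarrow>
         (\<exists>V \<V>. open V \<and> \<Lambda> \<subseteq> V \<and> openin (C1_topology S) \<V> \<and> f \<in> \<V> \<and>
            (\<forall>h\<in>\<V>. \<forall>\<Lambda>'. \<Lambda>' \<subseteq> V \<and> compact \<Lambda>' \<and> h ` \<Lambda>' = \<Lambda>' \<longrightarrow> Crit S h \<Lambda>' \<subseteq> U))))"
proof -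
  interpret riemannian_surface S
    by (rule riemannian_surface.intro) (rule assms(1))
  note f = diffeo_Diff1[OF assms(2)]
  show ?thesis
  proof (intro conjI)
    show "\<forall>c n. c \<in> Crit S f \<Lambda> \<and> 0 < n \<and> (f ^^ n) c = c \<longrightarrow>
        (let V = tangent_space S c; L = tangent_map S (f ^^ n) c in
          (homothety_on V L \<or> elliptic_on V L \<or> parabolic_on V L) \<and>
          (\<forall>z z'. eigenvalue_on V L z \<and> eigenvalue_on V L z' \<longrightarrow> cmod z = cmod z') \<and>
          (dissipative_on S f \<Lambda> \<longrightarrow> attracting_periodic_point S f n c))"
      unfolding Let_def using critical_periodic_point[OF f _ assms(4)] by blast
    show "far_from_homotheties S f \<Lambda> \<longrightarrow>
        \<not> (\<exists>c v. c \<in> Crit S f \<Lambda> \<and> critical_direction S f c v \<and>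
             (\<forall>n::int. int_iterate UNIV f n c \<in> Crit S f \<Lambda> \<and>
                critical_direction S f (int_iterate UNIV f n c) (snd (proj_iterate S f n (c, v)))))"
    proof (intro impI notI, elim exE conjE)
      fix c v
      assume "far_from_homotheties S f \<Lambda>" "c \<in> Crit S f \<Lambda>" "critical_direction S f c v"
        and orbit: "\<forall>n. int_iterate UNIV f n c \<in> Crit S f \<Lambda> \<and>
          critical_direction S f (int_iterate UNIV f n c) (snd (proj_iterate S f n (c, v)))"
      moreover from this have "c \<in> \<Lambda>"
        by (simp add: Crit_def)
      moreover have "critical_direction S f (int_iterate UNIV f n c) (snd (proj_iterate S f n (c, v)))" for n
        using orbit by blast
      ultimately show False
        using no_critical_orbit[OF f] by blast
    qed
    show "closed (Crit S f \<Lambda>)"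
      by (rule closed_Crit[OF assms(2,3)])
    show "\<forall>U. open U \<and> Crit S f \<Lambda> \<subseteq> U \<longrightarrow>
         (\<exists>V \<V>. open V \<and> \<Lambda> \<subseteq> V \<and> openin (C1_topology S) \<V> \<and> f \<in> \<V> \<and>
            (\<forall>h\<in>\<V>. \<forall>\<Lambda>'. \<Lambda>' \<subseteq> V \<and> compact \<Lambda>' \<and> h ` \<Lambda>' = \<Lambda>' \<longrightarrow> Crit S h \<Lambda>' \<subseteq> U))"
      using Crit_semicontinuous[OF assms(2,3)] by (meson order_refl)
  qed
qed

end
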